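(* Assume: (Slater) there are $\overline\pi\in\Pi$ and $\boldsymbol\xi\in\mathbb R^n$, $\boldsymbol\xi>0$ entrywise, with $U^{\overline\pi}_{\mathbf g}(\rho)-\mathbf b\ge\boldsymbol\xi$; (Strong duality) there is a primal-dual pair $(\pi_\tau^\star,\boldsymbol\lambda^\star)$, with $\pi_\tau^\star$ optimal for the primal problem and $\boldsymbol\lambda^\star\in\arg\min_{\boldsymbol\lambda\ge0}D(\boldsymbol\lambda)$, such that $V_\tau^\star=D_\tau^\star=L(\pi_\tau^\star,\boldsymbol\lambda^\star)$; (Exploration) there is $d>0$ with $d^\pi_\rho(s)\ge d$ for all $s\in\mathcal S$, $\pi\in\Pi$. For every $\varepsilon_1>0$, there exist constants $C_1,C_2>0$ such that the Accelerated Gradient Projection Method with NPG Subroutine (Algorithm 1 in the context) with a random initialization and the parameters $\eta=(1-\gamma)/\tau$, $\alpha_k=1/\ell$, $\beta_k=(k-1)/(k+2)$, $N_1=T$, $N_2=\mathcal O(\log T)$ and $N_3=\mathcal O(\log(1/\varepsilon_1))$ returns a solution pair $(\pi,\boldsymbol\lambda)$ such that $$D(\boldsymbol\lambda)-D_\tau^\star\le\varepsilon_0,$$ $$\|\pi-\pi_\tau^\star\|_2\le C_1\sqrt{\varepsilon_0}+\varepsilon_1,$$ $$|V_\tau^\pi(\rho)-V_\tau^\star|\le 2\varepsilon_0+\ell_cC_1C_2\sqrt{\varepsilon_0}+\Big(\ell_cC_2+\frac{3\gamma}{2\tau\sqrt n}\Big)\varepsilon_1,$$ $$\max_{i\in[n]}[b_i-U_{g_i}^\pi(\rho)]_+\le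 \ell_c\big(C_1\sqrt{\varepsilon_0}+\varepsilon_1\big),$$ where $$\varepsilon_0=\frac{2\ell}{(T+1)^2}\big(\|\boldsymbol\lambda^{(0)}-\boldsymbol\lambda^\star\|_2+1\big)^2,\qquad \ell=\frac{2\ln 2\,\big(n|\mathcal A|+(1-\gamma)^2\sqrt{n|\mathcal A|}\big)}{\tau(1-\gamma)^3d},\qquad \ell_c=\frac{\sqrt{|\mathcal A|}}{(1-\gamma)^2}.$$ The total iteration complexity is $N_1\times N_2+N_3=\widetilde{\mathcal O}(T)$, with primal error bounds $\mathcal O(1/T)$ given by the last three inequalities, and a dual error bound $\mathcal O(1/T^2)$ given by the first inequality.
   Context: Constrained MDP: finite state space $\mathcal S$, finite action space $\mathcal A$, transition kernel $P(\cdot|s,a)\in\Delta(\mathcal S)$, reward $r:\mathcal S\times\mathcal A\to[0,1]$, utilities $\mathbf g=(g_1,\dots,g_n):\mathcal S\times\mathcal A\to[0,1]^n$, threshold $\mathbf b\in[0,1/(1-\gamma)]^n$, discount $\gamma\in[0,1)$, initial distribution $\rho\in\Delta(\mathcal S)$, regularization weight $\tau>0$. A policy is a map $\pi:\mathcal S\to\Delta(\mathcal A)$, viewed as a vector in $\mathbb R^{|\mathcal S||\mathcal A|}$; trajectories satisfy $s_0\sim\rho$, $a_t\sim\pi(\cdot|s_t)$, $s_{t+1}\sim P(\cdot|s_t,a_t)$. $\Pi$ is the class of soft-max policies $\pi_\theta(a|s)=\exp(\theta(s,a))/\sum_{a'}\exp(\theta(s,a'))$, $\theta\in\mathbb R^{|\mathcal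 S||\mathcal A|}$. $V^\pi(\rho)=\mathbb E[\sum_{t\ge0}\gamma^t r(s_t,a_t)]$, $U^\pi_{g_i}(\rho)=\mathbb E[\sum_{t\ge0}\gamma^t g_i(s_t,a_t)]$, $U^\pi_{\mathbf g}(\rho)=(U^\pi_{g_1}(\rho),\dots,U^\pi_{g_n}(\rho))$, $\mathcal H(\rho,\pi)=\mathbb E[\sum_{t\ge0}-\gamma^t\log\pi(a_t|s_t)]$, $V_\tau^\pi(\rho)=V^\pi(\rho)+\tau\mathcal H(\rho,\pi)$. Discounted state visitation distribution: $d^\pi_\rho(s)=(1-\gamma)\sum_{t\ge0}\gamma^t\Pr(s_t=s\mid\pi,s_0\sim\rho)$. Primal problem: $\max_{\pi\in\Pi}V_\tau^\pi(\rho)$ subject to $U^\pi_{\mathbf g}(\rho)\ge\mathbf b$ (entrywise), with an optimal policy $\pi_\tau^\star$ and optimal value $V_\tau^\star=V_\tau^{\pi_\tau^\star}(\rho)$. Lagrangian $L(\pi,\boldsymbol\lambda)=V_\tau^\pi(\rho)+\boldsymbol\lambda^\top(U^\pi_{\mathbf g}(\rho)-\mathbf b)$; dual function $D(\boldsymbol\lambda)=\max_{\pi\in\Pi}L(\pi,\boldsymbol\lambda)$; $D_\tau^\star=\min_{\boldsymbol\lambda\ge0}D(\boldsymbol\lambda)$. $\Lambda=\{\boldsymbol\lambda: 0\le\lambda_i\le (V_\tau^\star-V_\tau^{\overline\pi}(\rho))/\xi_i\ \forall i\in[n]\}$, and $\mathcal P_\Lambda$ is Euclidean projection onto $\Lambda$.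 $[x]_+=\max\{x,0\}$. For $\boldsymbol\lambda\in\mathbb R^n$ let $r_{\boldsymbol\lambda}=r+\boldsymbol\lambda^\top\mathbf g$, let $V_{\boldsymbol\lambda}^\pi(s)$ be the entropy-regularized value function (weight $\tau$) with reward $r_{\boldsymbol\lambda}$ and initial state $s$, and let $Q_{\boldsymbol\lambda}^\pi(s,a)=r_{\boldsymbol\lambda}(s,a)+\gamma\,\mathbb E_{s'\sim P(\cdot|s,a)}[V_{\boldsymbol\lambda}^\pi(s')]$. Subroutine $\mathrm{NPG}_{Sub}(\boldsymbol\lambda,\pi^{(0)},\eta,N)$: for $t=0,\dots,N-1$ set $\pi^{(t+1)}(a|s)\propto(\pi^{(t)}(a|s))^{1-\eta\tau/(1-\gamma)}\exp\big(\eta Q_{\boldsymbol\lambda}^{\pi^{(t)}}(s,a)/(1-\gamma)\big)$ (normalized over $a$ for each $s$); return $\pi^{(N)}$. Algorithm 1. Input: initialization $\boldsymbol\lambda^{(-1)},\boldsymbol\lambda^{(0)}$ and a policy $\widetilde\pi_{\boldsymbol\mu^{(-1)}}$; step-sizes $\alpha_t,\eta$; extrapolation weights $\beta_t$; iteration numbers $N_1,N_2,N_3$. For $t=0,\dots,N_1-1$: $\boldsymbol\mu^{(t)}=\boldsymbol\lambda^{(t)}+\beta_t(\boldsymbol\lambda^{(t)}-\boldsymbol\lambda^{(t-1)})$; $\widetilde\pi_{\boldsymbol\mu^{(t)}}=\mathrm{NPG}_{Sub}(\boldsymbol\mu^{(t)},\widetilde\pi_{\boldsymbol\mu^{(t-1)}},\eta,N_2)$;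 $\widetilde\nabla D(\boldsymbol\mu^{(t)})=U_{\mathbf g}^{\widetilde\pi_{\boldsymbol\mu^{(t)}}}(\rho)-\mathbf b$; $\boldsymbol\lambda^{(t+1)}=\mathcal P_\Lambda\big(\boldsymbol\mu^{(t)}-\alpha_t\widetilde\nabla D(\boldsymbol\mu^{(t)})\big)$. Finally $\widetilde\pi_{\boldsymbol\lambda^{(N_1)}}=\mathrm{NPG}_{Sub}(\boldsymbol\lambda^{(N_1)},\widetilde\pi_{\boldsymbol\mu^{(N_1-1)}},\eta,N_3)$. The returned pair is $(\pi,\boldsymbol\lambda)=(\widetilde\pi_{\boldsymbol\lambda^{(N_1)}},\boldsymbol\lambda^{(N_1)})$. All value, utility and $Q$-functions are evaluated exactly. The values of the problem-dependent constants and of the iteration numbers are $$C_1=\sqrt{\frac{2(1-\gamma)\ln2}{\tau d}},\qquad C_2=\big(V_\tau^\star-V_\tau^{\overline\pi}(\rho)\big)\sum_{i=1}^n\frac1{\xi_i},$$ $$N_2=\frac1{1-\gamma}\log\Big(\frac{2\sqrt n|\mathcal A|T(T+1)(1+C_2+\tau\log|\mathcal A|)}{(1-\gamma)^3\tau\ell}\Big),\qquad N_3=\frac1{1-\gamma}\log\Big(\frac{2\sqrt n(1+C_2+\tau\log|\mathcal A|)}{\varepsilon_1\tau(1-\gamma)}\Big).$$ $\widetilde{\mathcal O}$ hides logarithmic factors.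
   Formalization: The initialization has λ^(-1)=λ^(0)∈Λ, and the policy-distance and value-gap bounds hold for N_3 equal to the displayed value plus a constant K depending only on the problem data (still O(log(1/ε_1))); with distinct λ^(-1), λ^(0) or with K=0 the claims fail. *)

theory Defs
  imports "HOL-Probability.Probability" "HOL-Library.Landau_Symbols"
begin

text \<open>
  The state and action spaces and the index set of the constraints are finite types; the
  number of constraints is \<open>CARD('n)\<close>, and vectors in \<open>\<real>\<^sup>n\<close> have type \<open>real ^ 'n\<close>.
\<close>

record ('s, 'a, 'n::finite) cmdp =
  kernel :: "'s \<Rightarrow> 'a \<Rightarrow> 's pmf"
  reward :: "'s \<Rightarrow> 'a \<Rightarrow> real"
  utility :: "'s \<Rightarrow> 'a \<Rightarrow> real ^ 'n"
  threshold :: "real ^ 'n"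
  discount :: real
  start :: "'s pmf"
  temperature :: real

definition valid_cmdp :: "('s, 'a, 'n::finite) cmdp \<Rightarrow> bool" where
  "valid_cmdp M \<longleftrightarrow>
     0 \<le> discount M \<and> discount M < 1 \<and> 0 < temperature M \<and>
     (\<forall>s a. 0 \<le> reward M s a \<and> reward M s a \<le> 1) \<and>
     (\<forall>s a i. 0 \<le> utility M s a $ i \<and> utility M s a $ i \<le> 1) \<and>
     (\<forall>i. 0 \<le> threshold M $ i \<and> threshold M $ i \<le> 1 / (1 - discount M))"

type_synonym ('s, 'a) policy = "'s \<Rightarrow> 'a pmf"

definition softmax :: "('s \<Rightarrow> 'a::finite \<Rightarrow> real) \<Rightarrow> ('s, 'a) policy" where
  "softmax \<theta> = (\<lambda>s. embed_pmf (\<lambda>a. exp (\<theta> s a) / (\<Sum>a'\<in>UNIV. exp (\<theta> s a'))))"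

definition softmax_policies :: "('s, 'a::finite) policy set" where
  "softmax_policies = range softmax"

definition policy_vec :: "('s, 'a) policy \<Rightarrow> real ^ ('s::finite \<times> 'a::finite)" where
  "policy_vec \<pi> = (\<chi> x. pmf (\<pi> (fst x)) (snd x))"

text \<open>
  A trajectory is a sequence of state-action pairs. Its law, for the initial distribution
  \<open>\<mu>\<close>, is the measure which the Ionescu-Tulcea theorem yields for the one-step kernels below;
  \<open>traj_kernel\<close> is given the coordinates before time \<open>n\<close>, of which only the last one matters.
\<close>

definition draw :: "('s, 'a) policy \<Rightarrow> 's pmf \<Rightarrow> ('s \<times> 'a) pmf" where
  "draw \<pi> \<mu> = bind_pmf \<mu> (\<lambda>s. map_pmf (\<lambda>a. (s, a)) (\<pi> s))"

definition traj_kernel ::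
    "('s \<Rightarrow> 'a \<Rightarrow> 's pmf) \<Rightarrow> ('s, 'a) policy \<Rightarrow> 's pmf \<Rightarrow> nat \<Rightarrow> (nat \<Rightarrow> 's \<times> 'a) \<Rightarrow> ('s \<times> 'a) measure"
  where
  "traj_kernel P \<pi> \<mu> n \<omega> =
     measure_pmf (case n of 0 \<Rightarrow> draw \<pi> \<mu> | Suc k \<Rightarrow> draw \<pi> (P (fst (\<omega> k)) (snd (\<omega> k))))"

lemma Ionescu_Tulcea_traj_kernel:
  fixes P :: "'s::finite \<Rightarrow> 'a::finite \<Rightarrow> 's pmf"
  shows "Ionescu_Tulcea (traj_kernel P \<pi> \<mu>) (\<lambda>_. count_space UNIV)"
proof (rule Ionescu_Tulcea.intro)
  fix i :: nat
  show "prob_space (traj_kernel P \<pi> \<mu> i x)" for x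
    unfolding traj_kernel_def by (rule prob_space_measure_pmf)
  show "traj_kernel P \<pi> \<mu> i \<in> PiM {0..<i} (\<lambda>_. count_space UNIV) \<rightarrow>\<^sub>M subprob_algebra (count_space UNIV)"
  proof (cases i)
    case 0
    then show ?thesis
      by (simp add: traj_kernel_def[abs_def] measurable_const measure_pmf_in_subprob_algebra)
  next
    case (Suc k)
    have "(\<lambda>\<omega>. \<omega> k) \<in> PiM {0..<i} (\<lambda>_. count_space (UNIV :: ('s \<times> 'a) set)) \<rightarrow>\<^sub>M count_space UNIV"
      using Suc by (intro measurable_component_singleton) simp
    moreover have "(\<lambda>x. measure_pmf (draw \<pi> (P (fst x) (snd x))))
        \<in> count_space UNIV \<rightarrow>\<^sub>M subprob_algebra (count_space UNIV)"
      by (simp add: measure_pmf_in_subprob_algebra)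
    ultimately show ?thesis
      unfolding Suc traj_kernel_def[abs_def] nat.case by (rule measurable_compose)
  qed
qed

definition traj_measure ::
    "('s \<Rightarrow> 'a \<Rightarrow> 's pmf) \<Rightarrow> ('s, 'a) policy \<Rightarrow> 's pmf \<Rightarrow> (nat \<Rightarrow> 's \<times> 'a) measure" where
  "traj_measure P \<pi> \<mu> =
     projective_family.lim UNIV
       (Ionescu_Tulcea.CI (traj_kernel P \<pi> \<mu>) (\<lambda>_. count_space UNIV)) (\<lambda>_. count_space UNIV)"

definition discounted_return ::
    "('s, 'a, 'n::finite) cmdp \<Rightarrow> ('s \<Rightarrow> 'a \<Rightarrow> real) \<Rightarrow> ('s, 'a) policy \<Rightarrow> 's pmf \<Rightarrow> real" where
  "discounted_return M f \<pi> \<mu> =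
     (\<integral>\<omega>. (\<Sum>t. discount M ^ t * f (fst (\<omega> t)) (snd (\<omega> t))) \<partial>traj_measure (kernel M) \<pi> \<mu>)"

definition entropy_return :: "('s, 'a, 'n::finite) cmdp \<Rightarrow> ('s, 'a) policy \<Rightarrow> 's pmf \<Rightarrow> real" where
  "entropy_return M \<pi> \<mu> =
     (\<integral>\<omega>. (\<Sum>t. - (discount M ^ t) * ln (pmf (\<pi> (fst (\<omega> t))) (snd (\<omega> t))))
        \<partial>traj_measure (kernel M) \<pi> \<mu>)"

definition visitation :: "('s, 'a, 'n::finite) cmdp \<Rightarrow> ('s, 'a) policy \<Rightarrow> 's \<Rightarrow> real" where
  "visitation M \<pi> s =
     (1 - discount M) *
       (\<Sum>t. discount M ^ t *
          measure (traj_measure (kernel M) \<pi> (start M))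
            {\<omega> \<in> space (traj_measure (kernel M) \<pi> (start M)). fst (\<omega> t) = s})"

definition reg_value :: "('s, 'a, 'n::finite) cmdp \<Rightarrow> ('s, 'a) policy \<Rightarrow> real" where
  "reg_value M \<pi> =
     discounted_return M (reward M) \<pi> (start M) + temperature M * entropy_return M \<pi> (start M)"

definition util :: "('s, 'a, 'n::finite) cmdp \<Rightarrow> ('s, 'a) policy \<Rightarrow> real ^ 'n" where
  "util M \<pi> = (\<chi> i. discounted_return M (\<lambda>s a. utility M s a $ i) \<pi> (start M))"

definition feasible :: "('s, 'a::finite, 'n::finite) cmdp \<Rightarrow> ('s, 'a) policy \<Rightarrow> bool" where
  "feasible M \<pi> \<longleftrightarrow> \<pi> \<in> softmax_policies \<and> (\<forall>i. threshold M $ i \<le> util M \<pi> $ i)"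

definition lagrangian :: "('s, 'a, 'n::finite) cmdp \<Rightarrow> ('s, 'a) policy \<Rightarrow> real ^ 'n \<Rightarrow> real" where
  "lagrangian M \<pi> l = reg_value M \<pi> + l \<bullet> (util M \<pi> - threshold M)"

text \<open>
  The maximum and minimum in the dual problem are written as \<open>SUP\<close> and \<open>INF\<close>; that they are
  attained is not built in.
\<close>

definition dual_fun :: "('s, 'a::finite, 'n::finite) cmdp \<Rightarrow> real ^ 'n \<Rightarrow> real" where
  "dual_fun M l = (SUP \<pi>\<in>softmax_policies. lagrangian M \<pi> l)"

definition dual_opt :: "('s, 'a::finite, 'n::finite) cmdp \<Rightarrow> real" where
  "dual_opt M = (INF l\<in>{l. \<forall>i. 0 \<le> l $ i}. dual_fun M l)"

definition dual_box ::
    "('s, 'a, 'n::finite) cmdp \<Rightarrow> ('s, 'a) policy \<Rightarrow> ('s, 'a) policy \<Rightarrow> real ^ 'n \<Rightarrow> (real ^ 'n) set" where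
  "dual_box M \<pi>star \<pi>bar \<xi> =
     {l. \<forall>i. 0 \<le> l $ i \<and> l $ i \<le> (reg_value M \<pi>star - reg_value M \<pi>bar) / \<xi> $ i}"

definition lag_reward :: "('s, 'a, 'n::finite) cmdp \<Rightarrow> real ^ 'n \<Rightarrow> 's \<Rightarrow> 'a \<Rightarrow> real" where
  "lag_reward M l s a = reward M s a + l \<bullet> utility M s a"

definition lag_V :: "('s, 'a, 'n::finite) cmdp \<Rightarrow> real ^ 'n \<Rightarrow> ('s, 'a) policy \<Rightarrow> 's \<Rightarrow> real" where
  "lag_V M l \<pi> s =
     discounted_return M (lag_reward M l) \<pi> (return_pmf s)
       + temperature M * entropy_return M \<pi> (return_pmf s)"

definition lag_Q :: "('s, 'a, 'n::finite) cmdp \<Rightarrow> real ^ 'n \<Rightarrow> ('s, 'a) policy \<Rightarrow> 's \<Rightarrow> 'a \<Rightarrow> real" where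
  "lag_Q M l \<pi> s a =
     lag_reward M l s a + discount M * measure_pmf.expectation (kernel M s a) (lag_V M l \<pi>)"

definition npg_weight ::
    "('s, 'a, 'n::finite) cmdp \<Rightarrow> real ^ 'n \<Rightarrow> real \<Rightarrow> ('s, 'a) policy \<Rightarrow> 's \<Rightarrow> 'a \<Rightarrow> real" where
  "npg_weight M l \<eta> \<pi> s a =
     pmf (\<pi> s) a powr (1 - \<eta> * temperature M / (1 - discount M))
       * exp (\<eta> * lag_Q M l \<pi> s a / (1 - discount M))"

definition npg_step ::
    "('s, 'a::finite, 'n::finite) cmdp \<Rightarrow> real ^ 'n \<Rightarrow> real \<Rightarrow> ('s, 'a) policy \<Rightarrow> ('s, 'a) policy" where
  "npg_step M l \<eta> \<pi> =
     (\<lambda>s. embed_pmf (\<lambda>a. npg_weight M l \<eta> \<pi> s a / (\<Sum>a'\<in>UNIV. npg_weight M l \<eta> \<pi> s a')))"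

definition npg_sub ::
    "('s, 'a::finite, 'n::finite) cmdp \<Rightarrow> real ^ 'n \<Rightarrow> ('s, 'a) policy \<Rightarrow> real \<Rightarrow> nat \<Rightarrow> ('s, 'a) policy" where
  "npg_sub M l \<pi> \<eta> N = (npg_step M l \<eta> ^^ N) \<pi>"

text \<open>
  \<open>apgm_iter \<dots> t\<close> is the triple \<open>(\<lambda>\<^bsup>(t-1)\<^esup>, \<lambda>\<^bsup>(t)\<^esup>, \<pi>)\<close>, where \<open>\<pi>\<close> is the policy computed for
  \<open>\<mu>\<^bsup>(t-1)\<^esup>\<close>; the first two vector arguments are \<open>\<lambda>\<^bsup>(-1)\<^esup>\<close> and \<open>\<lambda>\<^bsup>(0)\<^esup>\<close>.
\<close>

primrec apgm_iter ::
    "('s, 'a::finite, 'n::finite) cmdp \<Rightarrow> (real ^ 'n) set \<Rightarrow> real ^ 'n \<Rightarrow> real ^ 'n \<Rightarrow> ('s, 'a) policy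
      \<Rightarrow> (nat \<Rightarrow> real) \<Rightarrow> (nat \<Rightarrow> real) \<Rightarrow> real \<Rightarrow> nat \<Rightarrow> nat
      \<Rightarrow> (real ^ 'n) \<times> (real ^ 'n) \<times> ('s, 'a) policy" where
  "apgm_iter M \<Lambda> l' l0 \<pi>0 \<alpha> \<beta> \<eta> N2 0 = (l', l0, \<pi>0)"
| "apgm_iter M \<Lambda> l' l0 \<pi>0 \<alpha> \<beta> \<eta> N2 (Suc t) =
     (let (lprev, l, \<pi>) = apgm_iter M \<Lambda> l' l0 \<pi>0 \<alpha> \<beta> \<eta> N2 t;
          m = l + \<beta> t *\<^sub>R (l - lprev);
          \<pi>' = npg_sub M m \<pi> \<eta> N2;
          grad = util M \<pi>' - threshold M
      in (l, closest_point \<Lambda> (m - \<alpha> t *\<^sub>R grad), \<pi>'))"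

definition apgm ::
    "('s, 'a::finite, 'n::finite) cmdp \<Rightarrow> (real ^ 'n) set \<Rightarrow> real ^ 'n \<Rightarrow> real ^ 'n \<Rightarrow> ('s, 'a) policy
      \<Rightarrow> (nat \<Rightarrow> real) \<Rightarrow> (nat \<Rightarrow> real) \<Rightarrow> real \<Rightarrow> nat \<Rightarrow> nat \<Rightarrow> nat
      \<Rightarrow> ('s, 'a) policy \<times> (real ^ 'n)" where
  "apgm M \<Lambda> l' l0 \<pi>0 \<alpha> \<beta> \<eta> N1 N2 N3 =
     (let (_, l, \<pi>) = apgm_iter M \<Lambda> l' l0 \<pi>0 \<alpha> \<beta> \<eta> N2 N1
      in (npg_sub M l \<pi> \<eta> N3, l))"

definition ell :: "('s, 'a::finite, 'n::finite) cmdp \<Rightarrow> real \<Rightarrow> real" where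
  "ell M d =
     2 * ln 2 * (real CARD('n) * real CARD('a)
                 + (1 - discount M)\<^sup>2 * sqrt (real CARD('n) * real CARD('a)))
       / (temperature M * (1 - discount M) ^ 3 * d)"

definition ell_c :: "('s, 'a::finite, 'n::finite) cmdp \<Rightarrow> real" where
  "ell_c M = sqrt (real CARD('a)) / (1 - discount M)\<^sup>2"

definition const_C1 :: "('s, 'a, 'n::finite) cmdp \<Rightarrow> real \<Rightarrow> real" where
  "const_C1 M d = sqrt (2 * (1 - discount M) * ln 2 / (temperature M * d))"

definition const_C2 ::
    "('s, 'a, 'n::finite) cmdp \<Rightarrow> ('s, 'a) policy \<Rightarrow> ('s, 'a) policy \<Rightarrow> real ^ 'n \<Rightarrow> real" where
  "const_C2 M \<pi>star \<pi>bar \<xi> = (reg_value M \<pi>star - reg_value M \<pi>bar) * (\<Sum>i\<in>UNIV. 1 / \<xi> $ i)"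

definition eps0 ::
    "('s, 'a::finite, 'n::finite) cmdp \<Rightarrow> real \<Rightarrow> nat \<Rightarrow> real ^ 'n \<Rightarrow> real ^ 'n \<Rightarrow> real" where
  "eps0 M d T l0 lstar = 2 * ell M d / (real T + 1)\<^sup>2 * (norm (l0 - lstar) + 1)\<^sup>2"

text \<open>The real-valued formulas for the iteration numbers are rounded up, and negative values to \<open>0\<close>.\<close>

definition iter_N2 :: "('s, 'a::finite, 'n::finite) cmdp \<Rightarrow> real \<Rightarrow> real \<Rightarrow> nat \<Rightarrow> nat" where
  "iter_N2 M d C2 T =
     nat \<lceil>1 / (1 - discount M) *
          ln (2 * sqrt (real CARD('n)) * real CARD('a) * real T * (real T + 1)
                * (1 + C2 + temperature M * ln (real CARD('a)))
              / ((1 - discount M) ^ 3 * temperature M * ell M d))\<rceil>"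

definition iter_N3 :: "('s, 'a::finite, 'n::finite) cmdp \<Rightarrow> real \<Rightarrow> real \<Rightarrow> nat" where
  "iter_N3 M C2 \<epsilon>1 =
     nat \<lceil>1 / (1 - discount M) *
          ln (2 * sqrt (real CARD('n)) * (1 + C2 + temperature M * ln (real CARD('a)))
              / (\<epsilon>1 * temperature M * (1 - discount M)))\<rceil>"

text \<open>\<open>soft_O g\<close> is the class of functions that are \<open>O(g)\<close> up to powers of \<open>ln g\<close>.\<close>

definition soft_O :: "(nat \<Rightarrow> real) \<Rightarrow> (nat \<Rightarrow> real) set" where
  "soft_O g = {f. \<exists>k::nat. f \<in> O(\<lambda>x. g x * ln (g x) ^ k)}"

end

theory Submission
  imports Defs "HOL-Real_Asymp.Real_Asymp"
begin

text \<open>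
  With \<open>\<eta> = (1 - \<gamma>) / \<tau>\<close> the subroutine is soft policy iteration: one step replaces \<open>\<pi>\<close> by the
  softmax of \<open>Q\<^sup>\<pi> / \<tau>\<close>, which contracts the gap to the optimal soft value by \<open>\<gamma>\<close>, and the softmax is
  1-Lipschitz from the maximum norm to the \<open>L\<^sup>1\<close> norm. The gap \<open>D(\<lambda>) - L(\<pi>, \<lambda>)\<close> equals \<open>\<tau>\<close> times the
  relative entropy of \<open>\<pi>\<close> with respect to the maximiser \<open>\<pi>\<^sub>\<lambda>\<close>, integrated over the occupancy measure of
  \<open>\<pi>\<close>; by Pinsker's inequality and the exploration assumption it grows quadratically in the
  distance of \<open>\<pi>\<close> to \<open>\<pi>\<^sub>\<lambda>\<close>. This makes \<open>D\<close> smooth with constant \<open>\<ell>\<close>, so that accelerated projected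
  gradient descent with gradient errors \<open>\<ell> / (T (T + 1))\<close> yields the dual bound, and it turns the
  dual bound into a bound on the distance of \<open>\<pi>\<^sub>\<lambda>\<close> to the optimal policy, since
  \<open>L(\<pi>\<^sup>*, \<lambda>) \<ge> V\<^sup>*\<close>.
\<close>

subsection \<open>Occupancy measures of the trajectory law\<close>

text \<open>The trajectory law enters only through its one-coordinate marginals; once returns are
  written with occupancy measures, everything is a finite sum.

  Extrapolated multipliers can have negative entries. The soft value, the maximising policy and the
  first-order bounds on D are therefore set up on all of R^n, without a sign condition.

  No estimate passes from one call of the subroutine to the next: the gap of every softmax policy is
  at most the range of the reward plus \<tau> ln |A|, divided by 1 - \<gamma>, so a warm start only
  has to be a softmax policy.

  The obstacle is the last call. The formula for N_3 has no factor |S|, but an L^1 bound in each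
  state costs sqrt |S| for the policy vector, and the value bound must fit a term proportional to
  \<gamma>. Hence a fixed number \<open>K\<close> of extra iterations, chosen from |S|, \<gamma> and
  \<tau> alone, which keeps the logarithmic order. Utilities depend on the L^1 errors of the single
  states, so the constraint bound holds for the formula as it stands.\<close>

lemma pmf_expectation_finite:
  fixes f :: "'a::finite \<Rightarrow> real"
  shows "measure_pmf.expectation p f = (\<Sum>a\<in>UNIV. pmf p a * f a)"
  by (subst integral_measure_pmf_real[of UNIV]) (auto simp: mult.commute)

text \<open>The law of the state at time t. It suffices because each term of a discounted series
  looks at one coordinate of the trajectory, and the action is drawn afresh given the state.\<close>

primrec state_law ::
    "('s \<Rightarrow> 'a \<Rightarrow> 's pmf) \<Rightarrow> ('s, 'a) policy \<Rightarrow> 's pmf \<Rightarrow> nat \<Rightarrow> 's pmf" where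
  "state_law P \<pi> \<mu> 0 = \<mu>"
| "state_law P \<pi> \<mu> (Suc t) = bind_pmf (state_law P \<pi> \<mu> t) (\<lambda>s. bind_pmf (\<pi> s) (P s))"

lemma bind_draw:
  "bind_pmf (draw \<pi> \<mu>) (\<lambda>x. draw \<pi> (P (fst x) (snd x)))
     = draw \<pi> (bind_pmf \<mu> (\<lambda>s. bind_pmf (\<pi> s) (P s)))"
  by (simp add: draw_def bind_assoc_pmf map_pmf_def bind_return_pmf)

lemma nn_integral_bind_pmf_pmf:
  "(\<integral>\<^sup>+x. f x \<partial>measure_pmf (bind_pmf p k)) = (\<integral>\<^sup>+y. (\<integral>\<^sup>+x. f x \<partial>measure_pmf (k y)) \<partial>measure_pmf p)"
  by (simp add: measure_pmf_bind)
     (subst nn_integral_bind[where B="count_space UNIV"], auto simp: measure_pmf_in_subprob_algebra)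

context
  fixes P :: "'s::finite \<Rightarrow> 'a::finite \<Rightarrow> 's pmf" and \<pi> :: "('s, 'a) policy" and \<mu> :: "'s pmf"
begin

interpretation IT: Ionescu_Tulcea "traj_kernel P \<pi> \<mu>" "\<lambda>_. count_space UNIV"
  by (rule Ionescu_Tulcea_traj_kernel)

text \<open>\<open>C 0 (Suc n)\<close> is \<open>C 0 n\<close> followed by a draw of coordinate n,
  so a function of that coordinate is first integrated against the kernel.\<close>

lemma nn_integral_Suc_coordinate:
  "(\<integral>\<^sup>+\<omega>. g (\<omega> n) \<partial>IT.C 0 (Suc n) (\<lambda>_. undefined))
     = (\<integral>\<^sup>+\<omega>. (\<integral>\<^sup>+x. g x \<partial>traj_kernel P \<pi> \<mu> n \<omega>) \<partial>IT.C 0 n (\<lambda>_. undefined))"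
proof -
  let ?u = "\<lambda>_::nat. undefined :: 's \<times> 'a"
  have u: "?u \<in> space (PiM {0..<0} (\<lambda>_. count_space UNIV))"
    by (simp add: space_PiM)
  have meas: "(\<lambda>\<omega>. g (\<omega> n)) \<in> borel_measurable (PiM {0..<Suc n} (\<lambda>_. count_space UNIV))"
    by (rule measurable_compose[OF measurable_component_singleton]) auto
  have "(\<integral>\<^sup>+\<omega>. g (\<omega> n) \<partial>IT.C 0 (Suc n) ?u)
    = (\<integral>\<^sup>+\<omega>. (\<integral>\<^sup>+\<omega>'. g (\<omega>' n) \<partial>IT.eP n \<omega>) \<partial>IT.C 0 n ?u)"
    using IT.measurable_eP[of n]
    by (simp, subst nn_integral_bind[OF meas])
       (simp_all add: measurable_cong_sets[OF IT.sets_C[OF u]])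
  also have "\<dots> = (\<integral>\<^sup>+\<omega>. (\<integral>\<^sup>+x. g x \<partial>traj_kernel P \<pi> \<mu> n \<omega>) \<partial>IT.C 0 n ?u)"
  proof (rule nn_integral_cong)
    fix \<omega> assume "\<omega> \<in> space (IT.C 0 n ?u)"
    then have "\<omega> \<in> space (PiM {0..<n} (\<lambda>_. count_space UNIV))"
      using IT.space_C[OF u, of n] by simp
    from IT.nn_integral_eP[OF this meas]
    show "(\<integral>\<^sup>+\<omega>'. g (\<omega>' n) \<partial>IT.eP n \<omega>) = (\<integral>\<^sup>+x. g x \<partial>traj_kernel P \<pi> \<mu> n \<omega>)"
      by simp
  qed
  finally show ?thesis .
qed

text \<open>The induction varies \<open>g\<close> because the Markov step replaces it by its
  conditional expectation given the preceding pair.\<close>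

lemma nn_integral_coordinate:
  "(\<integral>\<^sup>+\<omega>. g (\<omega> n) \<partial>IT.C 0 (Suc n) (\<lambda>_. undefined))
     = (\<integral>\<^sup>+x. g x \<partial>measure_pmf (draw \<pi> (state_law P \<pi> \<mu> n)))"
proof (induction n arbitrary: g)
  case 0
  have u: "(\<lambda>_::nat. undefined :: 's \<times> 'a) \<in> space (PiM {0..<0} (\<lambda>_. count_space UNIV))"
    by (simp add: space_PiM)
  have "emeasure (IT.C 0 0 (\<lambda>_. undefined)) (space (IT.C 0 0 (\<lambda>_. undefined))) = 1"
    by (rule prob_space.emeasure_space_1[OF IT.prob_space_C[OF u]])
  then show ?case
    unfolding nn_integral_Suc_coordinate by (simp add: traj_kernel_def del: IT.C.simps)
next
  case (Suc n)
  show ?case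
    unfolding nn_integral_Suc_coordinate[where n="Suc n"]
    using Suc.IH[of "\<lambda>x. \<integral>\<^sup>+y. g y \<partial>measure_pmf (draw \<pi> (P (fst x) (snd x)))"]
    by (simp only: traj_kernel_def[of _ _ _ "Suc n"] nat.case state_law.simps bind_draw[symmetric]
        nn_integral_bind_pmf_pmf)
qed

lemma measurable_traj_coordinate:
  "(\<lambda>\<omega>. \<omega> n) \<in> measurable (traj_measure P \<pi> \<mu>) (count_space UNIV)"
proof -
  have "sets (traj_measure P \<pi> \<mu>) = sets (PiM UNIV (\<lambda>_. count_space (UNIV :: ('s \<times> 'a) set)))"
    by (simp add: traj_measure_def IT.PF.sets_lim)
  then have "measurable (traj_measure P \<pi> \<mu>) (count_space (UNIV :: ('s \<times> 'a) set))
      = measurable (PiM UNIV (\<lambda>_. count_space (UNIV :: ('s \<times> 'a) set))) (count_space UNIV)"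
    by (rule measurable_cong_sets) simp
  then show ?thesis
    using measurable_component_singleton[of n UNIV "\<lambda>_. count_space (UNIV :: ('s \<times> 'a) set)"] by simp
qed

text \<open>The event that coordinate n lies in A is a cylinder over {n}; the projective limit gives
  it the measure that it has under the finite-horizon law \<open>C 0 (Suc n)\<close>.\<close>

lemma distr_traj_measure:
  "distr (traj_measure P \<pi> \<mu>) (count_space UNIV) (\<lambda>\<omega>. \<omega> n) = measure_pmf (draw \<pi> (state_law P \<pi> \<mu> n))"
proof (rule measure_eqI)
  fix A :: "('s \<times> 'a) set"
  let ?M = "\<lambda>_::nat. count_space (UNIV :: ('s \<times> 'a) set)"
  let ?u = "\<lambda>_::nat. undefined :: 's \<times> 'a"
  let ?X = "PiE {n} (\<lambda>_. A)"
  have u: "?u \<in> space (PiM {0..<0} ?M)"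
    by (simp add: space_PiM)
  have X: "?X \<in> sets (PiM {n} ?M)"
    by (intro sets_PiM_I_finite) auto
  have sets: "sets (traj_measure P \<pi> \<mu>) = sets (PiM UNIV ?M)"
    by (simp add: traj_measure_def IT.PF.sets_lim)
  have "emeasure (distr (traj_measure P \<pi> \<mu>) (count_space UNIV) (\<lambda>\<omega>. \<omega> n)) A
      = emeasure (traj_measure P \<pi> \<mu>) (prod_emb UNIV ?M {n} ?X)"
    using sets_eq_imp_space_eq[OF sets]
    by (subst emeasure_distr[OF measurable_traj_coordinate]) (auto intro!: arg_cong2[where f=emeasure] simp: prod_emb_def space_PiM)
  also have "\<dots> = emeasure (IT.CI {n}) ?X"
    unfolding traj_measure_def by (rule IT.lim[OF _ X]) simp
  also have "\<dots> = emeasure (IT.C 0 (Suc n) ?u) (prod_emb {0..<Suc n} ?M {n} ?X)"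
    by (rule IT.emeasure_CI[OF _ X]) auto
  also have "\<dots> = (\<integral>\<^sup>+\<omega>. indicator (prod_emb {0..<Suc n} ?M {n} ?X) \<omega> \<partial>IT.C 0 (Suc n) ?u)"
    using IT.sets_C[OF u, of "Suc n"] X
    by (subst nn_integral_indicator) (auto simp del: IT.C.simps intro!: measurable_prod_emb)
  also have "\<dots> = (\<integral>\<^sup>+\<omega>. indicator A (\<omega> n) \<partial>IT.C 0 (Suc n) ?u)"
    using IT.space_C[OF u, of "Suc n"]
    by (intro nn_integral_cong) (auto simp: prod_emb_def space_PiM restrict_def PiE_iff extensional_def simp del: IT.C.simps split: split_indicator)
  also have "\<dots> = emeasure (draw \<pi> (state_law P \<pi> \<mu> n)) A"
    by (simp add: nn_integral_coordinate del: IT.C.simps)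
  finally show "emeasure (distr (traj_measure P \<pi> \<mu>) (count_space UNIV) (\<lambda>\<omega>. \<omega> n)) A
      = emeasure (draw \<pi> (state_law P \<pi> \<mu> n)) A" .
qed simp

lemma prob_space_traj_measure: "prob_space (traj_measure P \<pi> \<mu>)"
  by (rule prob_space_distrD[OF measurable_traj_coordinate[of 0]])
     (simp add: distr_traj_measure prob_space_measure_pmf)

lemma integral_traj_coordinate:
  fixes f :: "'s \<times> 'a \<Rightarrow> real"
  shows "(\<integral>\<omega>. f (\<omega> n) \<partial>traj_measure P \<pi> \<mu>)
    = (\<Sum>s\<in>UNIV. pmf (state_law P \<pi> \<mu> n) s * (\<Sum>a\<in>UNIV. pmf (\<pi> s) a * f (s, a)))"
proof -
  have "(\<integral>\<omega>. f (\<omega> n) \<partial>traj_measure P \<pi> \<mu>) = measure_pmf.expectation (draw \<pi> (state_law P \<pi> \<mu> n)) f"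
    using integral_distr[OF measurable_traj_coordinate, of f n] by (simp add: distr_traj_measure)
  also have "\<dots> = (\<Sum>x\<in>UNIV. pmf (draw \<pi> (state_law P \<pi> \<mu> n)) x * f x)"
    by (rule pmf_expectation_finite)
  also have "\<dots> = (\<Sum>x\<in>UNIV. pmf (state_law P \<pi> \<mu> n) (fst x) * pmf (\<pi> (fst x)) (snd x) * f x)"
  proof (rule sum.cong[OF refl])
    fix x :: "'s \<times> 'a"
    have "pmf (map_pmf (Pair s) (\<pi> s)) x = (if s = fst x then pmf (\<pi> s) (snd x) else 0)" for s
    proof (cases "s = fst x")
      case True
      have "inj (Pair s :: 'a \<Rightarrow> 's \<times> 'a)" by (rule inj_onI) simp
      from pmf_map_inj'[OF this, of "\<pi> s" "snd x"] True show ?thesis by simp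
    next
      case False
      then show ?thesis by (auto simp: pmf_eq_0_set_pmf)
    qed
    from this show "pmf (draw \<pi> (state_law P \<pi> \<mu> n)) x * f x
      = pmf (state_law P \<pi> \<mu> n) (fst x) * pmf (\<pi> (fst x)) (snd x) * f x"
      by (simp only: draw_def pmf_bind pmf_expectation_finite) (simp add: if_distrib cong: if_cong)
  qed
  also have "\<dots> = (\<Sum>s\<in>UNIV. pmf (state_law P \<pi> \<mu> n) s * (\<Sum>a\<in>UNIV. pmf (\<pi> s) a * f (s, a)))"
    by (simp add: UNIV_Times_UNIV[symmetric] sum.cartesian_product' sum_distrib_left mult.assoc
             del: UNIV_Times_UNIV)
  finally show ?thesis .
qed

end

text \<open>Unnormalised, with total mass 1 / (1 - \<gamma>), and with a free initial law, so that
  point masses give the values at single states.\<close>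

definition occupancy :: "('s, 'a, 'n::finite) cmdp \<Rightarrow> ('s, 'a) policy \<Rightarrow> 's pmf \<Rightarrow> 's \<Rightarrow> real" where
  "occupancy M \<pi> \<mu> s = (\<Sum>t. discount M ^ t * pmf (state_law (kernel M) \<pi> \<mu> t) s)"

context
  fixes M :: "('s::finite, 'a::finite, 'n::finite) cmdp"
  assumes disc: "0 \<le> discount M" "discount M < 1"
begin

lemma summable_occupancy: "summable (\<lambda>t. discount M ^ t * pmf (state_law (kernel M) \<pi> \<mu> t) s)"
  by (rule summable_comparison_test'[OF summable_geometric[of "discount M"], of 0])
     (use disc in \<open>auto simp: abs_mult pmf_le_1 mult_left_le\<close>)

lemma occupancy_nonneg: "0 \<le> occupancy M \<pi> \<mu> s"
  unfolding occupancy_def using disc by (intro suminf_nonneg summable_occupancy) auto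

text \<open>Integral and series are exchanged by domination with B \<gamma>^t. Finiteness of the
  types bounds every \<open>f\<close>, including the logarithm of a policy.\<close>

lemma discounted_return_eq:
  "discounted_return M f \<pi> \<mu> = (\<Sum>s\<in>UNIV. occupancy M \<pi> \<mu> s * (\<Sum>a\<in>UNIV. pmf (\<pi> s) a * f s a))"
proof -
  let ?T = "traj_measure (kernel M) \<pi> \<mu>"
  let ?g = "\<lambda>t \<omega>. discount M ^ t * f (fst (\<omega> t)) (snd (\<omega> t))"
  interpret T: prob_space ?T
    by (rule prob_space_traj_measure)
  define B where "B = (\<Sum>x\<in>UNIV. \<bar>case_prod f x\<bar>)"
  have B: "\<bar>f s a\<bar> \<le> B" for s a
    unfolding B_def using member_le_sum[of "(s, a)" UNIV "\<lambda>x. \<bar>case_prod f x\<bar>"] by simp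
  have [measurable]: "(\<lambda>\<omega>. f (fst (\<omega> t)) (snd (\<omega> t))) \<in> borel_measurable ?T" for t
    by (rule measurable_compose[OF measurable_traj_coordinate]) auto
  have g_bound: "norm (?g t \<omega>) \<le> B * discount M ^ t" for t \<omega>
    using mult_left_mono[OF B, of "discount M ^ t"] disc by (simp add: abs_mult mult.commute[of B])
  have int: "integrable ?T (?g t)" for t
    by (rule T.integrable_const_bound[where B="B * discount M ^ t"]) (use g_bound in auto)
  have geo: "summable (\<lambda>t. B * discount M ^ t)"
    using disc by (intro summable_mult summable_geometric) auto
  have "discounted_return M f \<pi> \<mu> = (\<Sum>t. (\<integral>\<omega>. ?g t \<omega> \<partial>?T))"
    unfolding discounted_return_def
  proof (rule integral_suminf[OF int])
    show "AE \<omega> in ?T. summable (\<lambda>t. norm (?g t \<omega>))"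
      by (intro AE_I2 summable_comparison_test'[OF geo, of 0]) (use g_bound in auto)
    have "(\<integral>\<omega>. norm (?g t \<omega>) \<partial>?T) \<le> B * discount M ^ t" for t
      using T.integral_le_const[OF integrable_norm[OF int[of t]], of "B * discount M ^ t"] g_bound by auto
    then show "summable (\<lambda>t. \<integral>\<omega>. norm (?g t \<omega>) \<partial>?T)"
      by (intro summable_comparison_test'[OF geo, of 0]) auto
  qed
  also have "\<dots> = (\<Sum>t. \<Sum>s\<in>UNIV. discount M ^ t * pmf (state_law (kernel M) \<pi> \<mu> t) s
      * (\<Sum>a\<in>UNIV. pmf (\<pi> s) a * f s a))"
    using integral_traj_coordinate[where f="case_prod f" and P="kernel M"]
    by (simp add: case_prod_beta sum_distrib_left mult.assoc)
  also have "\<dots> = (\<Sum>s\<in>UNIV. \<Sum>t. discount M ^ t * pmf (state_law (kernel M) \<pi> \<mu> t) s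
      * (\<Sum>a\<in>UNIV. pmf (\<pi> s) a * f s a))"
    by (rule suminf_sum) (intro summable_mult2 summable_occupancy)
  finally show ?thesis
    by (simp add: occupancy_def suminf_mult2[OF summable_occupancy])
qed

lemma entropy_return_eq: "entropy_return M \<pi> \<mu> = discounted_return M (\<lambda>s a. - ln (pmf (\<pi> s) a)) \<pi> \<mu>"
  by (simp add: entropy_return_def discounted_return_def)

lemma visitation_eq: "visitation M \<pi> s = (1 - discount M) * occupancy M \<pi> (start M) s"
proof -
  let ?T = "traj_measure (kernel M) \<pi> (start M)"
  have "measure ?T {\<omega> \<in> space ?T. fst (\<omega> t) = s} = pmf (state_law (kernel M) \<pi> (start M) t) s" for t
  proof -
    have "measure ?T {\<omega> \<in> space ?T. fst (\<omega> t) = s}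
        = measure (distr ?T (count_space UNIV) (\<lambda>\<omega>. \<omega> t)) {x. fst x = s}"
      by (subst measure_distr[OF measurable_traj_coordinate]) (auto intro!: arg_cong2[where f=measure])
    also have "\<dots> = pmf (map_pmf fst (draw \<pi> (state_law (kernel M) \<pi> (start M) t))) s"
      by (simp add: distr_traj_measure pmf_map vimage_def)
    also have "map_pmf fst (draw \<pi> (state_law (kernel M) \<pi> (start M) t))
        = state_law (kernel M) \<pi> (start M) t"
      by (simp add: draw_def map_bind_pmf map_pmf_comp bind_return_pmf' comp_def)
    finally show ?thesis .
  qed
  then show ?thesis by (simp add: visitation_def occupancy_def)
qed

text \<open>Flow conservation, obtained by telescoping the expectations of \<open>w\<close> along the trajectory.\<close>

lemma occupancy_flow:
  "(\<Sum>s\<in>UNIV. pmf \<mu> s * w s) = (\<Sum>s\<in>UNIV. occupancy M \<pi> \<mu> s *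
     (w s - discount M * (\<Sum>a\<in>UNIV. pmf (\<pi> s) a * measure_pmf.expectation (kernel M s a) w)))"
proof -
  let ?q = "state_law (kernel M) \<pi> \<mu>" and ?g = "discount M"
  define e where "e t = ?g ^ t * measure_pmf.expectation (?q t) w" for t
  define Pw where "Pw s = (\<Sum>a\<in>UNIV. pmf (\<pi> s) a * measure_pmf.expectation (kernel M s a) w)" for s
  have exp_bind: "measure_pmf.expectation (bind_pmf p k) w
      = (\<Sum>y\<in>UNIV. pmf p y * measure_pmf.expectation (k y) w)"
    for p :: "'y::finite pmf" and k
    by (simp add: pmf_expectation_finite pmf_bind sum_distrib_left sum_distrib_right mult.assoc)
       (subst sum.swap, rule refl)
  have next_e: "e (Suc t) = (\<Sum>s\<in>UNIV. ?g ^ t * pmf (?q t) s * (?g * Pw s))" for t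
    by (simp add: e_def exp_bind Pw_def sum_distrib_left mult_ac)
  have "(\<lambda>t. e t - e (Suc t)) sums (e 0 - 0)"
  proof (rule telescope_sums')
    define B where "B = (\<Sum>x\<in>UNIV. \<bar>w x\<bar>)"
    have "\<bar>measure_pmf.expectation (?q t) w\<bar> \<le> B" for t
      unfolding pmf_expectation_finite B_def
      by (rule order_trans[OF sum_abs], rule sum_mono) (simp add: abs_mult pmf_le_1 mult_left_le_one_le)
    then have "norm (e t) \<le> B * ?g ^ t" for t
      using disc by (simp add: e_def abs_mult mult.commute[of B] mult_left_mono)
    moreover have "(\<lambda>t. B * ?g ^ t) \<longlonglongrightarrow> 0"
      using tendsto_mult_right_zero[OF LIMSEQ_power_zero[of ?g]] disc by simp
    ultimately show "e \<longlonglongrightarrow> 0"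
      by (intro Lim_null_comparison[of e]) auto
  qed
  moreover have "e t - e (Suc t) = (\<Sum>s\<in>UNIV. ?g ^ t * pmf (?q t) s * (w s - ?g * Pw s))" for t
    by (simp add: next_e right_diff_distrib sum_subtractf)
       (simp add: e_def pmf_expectation_finite sum_distrib_left mult_ac)
  ultimately have "e 0 = (\<Sum>t. \<Sum>s\<in>UNIV. ?g ^ t * pmf (?q t) s * (w s - ?g * Pw s))"
    by (simp add: sums_iff)
  also have "\<dots> = (\<Sum>s\<in>UNIV. \<Sum>t. ?g ^ t * pmf (?q t) s * (w s - ?g * Pw s))"
    by (rule suminf_sum) (intro summable_mult2 summable_occupancy)
  finally show ?thesis
    by (simp add: e_def pmf_expectation_finite[of \<mu>] occupancy_def suminf_mult2[OF summable_occupancy]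
        Pw_def)
qed

section \<open>Linearity in the initial law and the Bellman equation\<close>

lemma state_law_Suc_left:
  "state_law P \<pi> \<mu> (Suc t) = state_law P \<pi> (bind_pmf \<mu> (\<lambda>s. bind_pmf (\<pi> s) (P s))) t"
  by (induction t) simp_all

lemma state_law_bind: "state_law P \<pi> (bind_pmf \<mu> k) t = bind_pmf \<mu> (\<lambda>y. state_law P \<pi> (k y) t)"
  by (induction t) (simp_all add: bind_assoc_pmf)

lemma occupancy_bind:
  fixes p :: "'y::finite pmf"
  shows "occupancy M \<pi> (bind_pmf p k) s = measure_pmf.expectation p (\<lambda>y. occupancy M \<pi> (k y) s)"
proof -
  have "occupancy M \<pi> (bind_pmf p k) s
      = (\<Sum>t. \<Sum>y\<in>UNIV. pmf p y * (discount M ^ t * pmf (state_law (kernel M) \<pi> (k y) t) s))"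
    by (simp add: occupancy_def state_law_bind pmf_bind pmf_expectation_finite sum_distrib_left mult_ac)
  also have "\<dots> = (\<Sum>y\<in>UNIV. \<Sum>t. pmf p y * (discount M ^ t * pmf (state_law (kernel M) \<pi> (k y) t) s))"
    by (rule suminf_sum) (intro summable_mult summable_occupancy)
  finally show ?thesis
    by (simp add: occupancy_def pmf_expectation_finite suminf_mult[OF summable_occupancy])
qed

lemma discounted_return_bind:
  fixes p :: "'y::finite pmf"
  shows "discounted_return M f \<pi> (bind_pmf p k)
    = measure_pmf.expectation p (\<lambda>y. discounted_return M f \<pi> (k y))"
  by (simp add: discounted_return_eq occupancy_bind pmf_expectation_finite sum_distrib_left
      sum_distrib_right mult_ac) (subst sum.swap, rule refl)

lemma occupancy_first_step:
  "occupancy M \<pi> \<mu> s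
    = pmf \<mu> s + discount M * occupancy M \<pi> (bind_pmf \<mu> (\<lambda>s. bind_pmf (\<pi> s) (kernel M s))) s"
proof -
  have "occupancy M \<pi> \<mu> s
      = pmf \<mu> s + (\<Sum>t. discount M * (discount M ^ t
          * pmf (state_law (kernel M) \<pi> (bind_pmf \<mu> (\<lambda>s. bind_pmf (\<pi> s) (kernel M s))) t) s))"
    unfolding occupancy_def
    using suminf_split_head[OF summable_occupancy, of \<pi> \<mu> s]
    by (simp add: state_law_Suc_left mult.assoc del: state_law.simps(2))
  then show ?thesis
    by (simp add: occupancy_def suminf_mult[OF summable_occupancy])
qed

text \<open>Time 0 is split off the occupancy measure. The remainder is \<gamma> times the return
  started from the law of the next state, and returns are linear in the initial law.\<close>

lemma discounted_return_Bellman: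
  "discounted_return M f \<pi> (return_pmf s)
    = (\<Sum>a\<in>UNIV. pmf (\<pi> s) a * (f s a + discount M *
        measure_pmf.expectation (kernel M s a) (\<lambda>s'. discounted_return M f \<pi> (return_pmf s'))))"
proof -
  let ?\<mu> = "bind_pmf (\<pi> s) (kernel M s)"
  have start: "discounted_return M f \<pi> \<mu> = measure_pmf.expectation \<mu> (\<lambda>s'. discounted_return M f \<pi> (return_pmf s'))" for \<mu>
    using discounted_return_bind[of f \<pi> \<mu> return_pmf] by (simp add: bind_return_pmf')
  have "discounted_return M f \<pi> (return_pmf s)
      = (\<Sum>x\<in>UNIV. pmf (return_pmf s) x * (\<Sum>a\<in>UNIV. pmf (\<pi> x) a * f x a))
        + discount M * discounted_return M f \<pi> ?\<mu>"
    unfolding discounted_return_eq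
    by (subst occupancy_first_step)
       (simp add: bind_return_pmf distrib_right sum.distrib sum_distrib_left mult.assoc)
  also have "(\<Sum>x\<in>UNIV. pmf (return_pmf s) x * (\<Sum>a\<in>UNIV. pmf (\<pi> x) a * f x a))
      = (\<Sum>a\<in>UNIV. pmf (\<pi> s) a * f s a)"
    by (simp add: indicator_def if_distrib if_distribR cong: if_cong)
  also have "discounted_return M f \<pi> ?\<mu> = (\<Sum>a\<in>UNIV. pmf (\<pi> s) a *
      measure_pmf.expectation (kernel M s a) (\<lambda>s'. discounted_return M f \<pi> (return_pmf s')))"
    by (simp add: discounted_return_bind pmf_expectation_finite[of "\<pi> s"] start[symmetric])
  finally show ?thesis
    by (simp add: distrib_left sum.distrib sum_distrib_left mult_ac)
qed

lemma discounted_return_start: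
  "discounted_return M f \<pi> \<mu> = (\<Sum>s\<in>UNIV. pmf \<mu> s * discounted_return M f \<pi> (return_pmf s))"
  using discounted_return_bind[of f \<pi> \<mu> return_pmf] by (simp add: bind_return_pmf' pmf_expectation_finite)

end

subsection \<open>Relative entropy and softmax distributions\<close>

text \<open>The difference \<open>F\<close> of the two sides has F(1) = F'(1) = 0, and its second
  derivative \<open>H\<close> is nonnegative by ln y \<le> y - 1 at y = 1 / t. So F' changes sign at
  1, where F has its minimum.\<close>

lemma pinsker_pointwise:
  fixes x :: real
  assumes "0 < x"
  shows "3 / 2 * (x - 1)\<^sup>2 \<le> (x + 2) * (x * ln x - x + 1)"
proof -
  define F where "F t = (t + 2) * (t * ln t - t + 1) - 3 / 2 * (t - 1)\<^sup>2" for t :: real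
  define G where "G t = (2 * t + 2) * ln t - 4 * (t - 1)" for t :: real
  define H where "H t = 2 * ln t + 2 / t - 2" for t :: real
  have F': "(F has_real_derivative G t) (at t)" if "0 < t" for t
    unfolding F_def G_def
    by (rule derivative_eq_intros refl | use that in \<open>simp add: field_simps power2_eq_square\<close>)+
  have G': "(G has_real_derivative H t) (at t)" if "0 < t" for t
    unfolding G_def H_def
    by (rule derivative_eq_intros refl | use that in \<open>simp add: field_simps\<close>)+
  have H: "0 \<le> H t" if "0 < t" for t
    using ln_le_minus_one[of "1 / t"] that by (simp add: H_def ln_div)
  have G_mono: "G s \<le> G t" if "0 < s" "s \<le> t" for s t
    using that by (intro DERIV_nonneg_imp_nondecreasing[of s t G]) (auto intro!: exI G' H)
  have G_1: "G 1 = 0"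
    by (simp add: G_def)
  have "0 \<le> F x"
  proof (cases "1 \<le> x")
    case True
    have "F 1 \<le> F x"
    proof (rule DERIV_nonneg_imp_nondecreasing[of 1 x F])
      fix t :: real assume "1 \<le> t" "t \<le> x"
      then show "\<exists>y. (F has_real_derivative y) (at t) \<and> 0 \<le> y"
        using F'[of t] G_mono[of 1 t] G_1 by (intro exI[of _ "G t"]) auto
    qed (use True in simp)
    then show ?thesis by (simp add: F_def)
  next
    case False
    have "F 1 \<le> F x"
    proof (rule DERIV_nonpos_imp_nonincreasing[of x 1 F])
      fix t assume "x \<le> t" "t \<le> 1"
      then show "\<exists>y. (F has_real_derivative y) (at t) \<and> y \<le> 0"
        using assms F'[of t] G_mono[of t 1] G_1 by (intro exI[of _ "G t"]) auto
    qed (use False in simp)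
    then show ?thesis by (simp add: F_def)
  qed
  then show ?thesis by (simp add: F_def)
qed

text \<open>A difference of logarithms instead of the logarithm of a quotient: for softmax
  distributions each of them is a score minus a log-partition constant.\<close>

definition kl_div :: "'a::finite pmf \<Rightarrow> 'a pmf \<Rightarrow> real" where
  "kl_div p q = (\<Sum>a\<in>UNIV. pmf p a * (ln (pmf p a) - ln (pmf q a)))"

definition l1_dist :: "'a::finite pmf \<Rightarrow> 'a pmf \<Rightarrow> real" where
  "l1_dist p q = (\<Sum>a\<in>UNIV. \<bar>pmf p a - pmf q a\<bar>)"

lemma sum_pmf_UNIV [simp]: "(\<Sum>a\<in>UNIV. pmf (p :: 'a::finite pmf) a) = 1"
  by (rule sum_pmf_eq_1) auto

text \<open>Cauchy-Schwarz with weights p + 2 q, whose total mass 3 is matched by the factor 3 / 2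
  of \<open>pinsker_pointwise\<close> at x = p / q. The linear terms - p + q of the pointwise bound
  sum to zero.\<close>

lemma pinsker:
  fixes p q :: "'a::finite pmf"
  assumes p: "\<And>a. 0 < pmf p a" and q: "\<And>a. 0 < pmf q a"
  shows "(l1_dist p q)\<^sup>2 / 2 \<le> kl_div p q"
proof -
  let ?w = "\<lambda>a. pmf p a + 2 * pmf q a"
  have w: "0 < ?w a" for a
    using p[of a] q[of a] by linarith
  have w_nonzero: "?w a \<noteq> 0" for a
    using w[of a] by linarith
  have bound: "3 / 2 * ((pmf p a - pmf q a)\<^sup>2 / ?w a)
      \<le> pmf p a * (ln (pmf p a) - ln (pmf q a)) - pmf p a + pmf q a" for a
  proof -
    define x where "x = pmf p a / pmf q a"
    have x: "0 < x" "pmf p a = x * pmf q a"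
      using p[of a] q[of a] by (simp_all add: x_def)
    have ln: "ln x = ln (pmf p a) - ln (pmf q a)"
      using p[of a] q[of a] by (simp add: x_def ln_div)
    have "3 / 2 * ((pmf p a - pmf q a)\<^sup>2 / ?w a) = pmf q a * (3 / 2 * (x - 1)\<^sup>2 / (x + 2))"
    proof -
      have "?w a = pmf q a * (x + 2)" and "pmf p a - pmf q a = pmf q a * (x - 1)"
        by (simp_all add: x(2) algebra_simps)
      then show ?thesis
        using q[of a] by (simp only: power_mult_distrib) (simp add: power2_eq_square)
    qed
    also have "\<dots> \<le> pmf q a * (x * ln x - x + 1)"
    proof (rule mult_left_mono)
      have "0 < x + 2" using x(1) by simp
      then show "3 / 2 * (x - 1)\<^sup>2 / (x + 2) \<le> x * ln x - x + 1"
        by (subst pos_divide_le_eq) (use pinsker_pointwise[OF x(1)] in \<open>simp_all only: mult.commute[of _ "x + 2"]\<close>)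
    qed simp
    also have "\<dots> = pmf p a * (ln (pmf p a) - ln (pmf q a)) - pmf p a + pmf q a"
      unfolding ln[symmetric] by (simp only: x(2)) (simp add: algebra_simps)
    finally show ?thesis .
  qed
  have "(l1_dist p q)\<^sup>2 = (\<Sum>a\<in>UNIV. (\<bar>pmf p a - pmf q a\<bar> / sqrt (?w a)) * sqrt (?w a))\<^sup>2"
    using w_nonzero by (simp add: l1_dist_def)
  also have "\<dots> \<le> (\<Sum>a\<in>UNIV. (\<bar>pmf p a - pmf q a\<bar> / sqrt (?w a))\<^sup>2) * (\<Sum>a\<in>UNIV. (sqrt (?w a))\<^sup>2)"
    by (rule Cauchy_Schwarz_ineq_sum)
  also have "(\<Sum>a\<in>UNIV. (sqrt (?w a))\<^sup>2) = 3"
    by (simp add: sum.distrib sum_distrib_left[symmetric])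
  finally have "(l1_dist p q)\<^sup>2 / 2 \<le> (\<Sum>a\<in>UNIV. 3 / 2 * ((pmf p a - pmf q a)\<^sup>2 / ?w a))"
    unfolding sum_distrib_left[symmetric] using w by (simp add: power_divide less_imp_le)
  also have "\<dots> \<le> (\<Sum>a\<in>UNIV. pmf p a * (ln (pmf p a) - ln (pmf q a)) - pmf p a + pmf q a)"
    by (rule sum_mono) (rule bound)
  also have "\<dots> = kl_div p q"
    by (simp add: kl_div_def sum.distrib sum_subtractf)
  finally show ?thesis .
qed

text \<open>A vector whose entries sum to zero has its positive and its negative part of equal mass.\<close>

lemma sum_squares_le_l1_dist: "(\<Sum>a\<in>UNIV. (pmf p a - pmf q a)\<^sup>2) \<le> (l1_dist p q)\<^sup>2 / 2"
  for p q :: "'a::finite pmf"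
proof -
  define S where "S = l1_dist p q / 2"
  have zero: "(\<Sum>a\<in>UNIV. pmf p a - pmf q a) = 0"
    by (simp add: sum_subtractf)
  have "\<bar>pmf p a - pmf q a\<bar> \<le> S" for a
  proof -
    have "(\<Sum>b\<in>UNIV - {a}. pmf p b - pmf q b) = - (pmf p a - pmf q a)"
      using zero by (simp add: sum.remove[of UNIV a])
    then have "\<bar>pmf p a - pmf q a\<bar> \<le> (\<Sum>b\<in>UNIV - {a}. \<bar>pmf p b - pmf q b\<bar>)"
      using sum_abs[of "\<lambda>b. pmf p b - pmf q b" "UNIV - {a}"] by simp
    then show ?thesis
      by (simp add: S_def l1_dist_def sum.remove[of UNIV a])
  qed
  then have "\<bar>pmf p a - pmf q a\<bar> * \<bar>pmf p a - pmf q a\<bar> \<le> S * \<bar>pmf p a - pmf q a\<bar>" for a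
    by (rule mult_right_mono) simp
  then have "(\<Sum>a\<in>UNIV. (pmf p a - pmf q a)\<^sup>2) \<le> (\<Sum>a\<in>UNIV. S * \<bar>pmf p a - pmf q a\<bar>)"
    by (intro sum_mono) (simp add: power2_eq_square)
  also have "\<dots> = (l1_dist p q)\<^sup>2 / 2"
    unfolding sum_distrib_left[symmetric] l1_dist_def[symmetric] by (simp add: S_def power2_eq_square)
  finally show ?thesis .
qed

lemma l1_dist_nonneg: "0 \<le> l1_dist p q"
  by (simp add: l1_dist_def sum_nonneg)

lemma l1_dist_commute: "l1_dist p q = l1_dist q p"
  by (simp add: l1_dist_def abs_minus_commute)

lemma l1_dist_le_L2:
  "l1_dist p q \<le> sqrt (real CARD('a)) * sqrt (\<Sum>a\<in>UNIV. (pmf p a - pmf q a)\<^sup>2)"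
  for p q :: "'a::finite pmf"
proof (rule power2_le_imp_le)
  have "(\<Sum>a\<in>UNIV. 1 * \<bar>pmf p a - pmf q a\<bar>)\<^sup>2 \<le> (\<Sum>a\<in>(UNIV::'a set). 1\<^sup>2) * (\<Sum>a\<in>UNIV. \<bar>pmf p a - pmf q a\<bar>\<^sup>2)"
    by (rule Cauchy_Schwarz_ineq_sum)
  then show "(l1_dist p q)\<^sup>2 \<le> (sqrt (real CARD('a)) * sqrt (\<Sum>a\<in>UNIV. (pmf p a - pmf q a)\<^sup>2))\<^sup>2"
    by (simp add: l1_dist_def power_mult_distrib sum_nonneg)
qed (simp add: sum_nonneg)

definition softmax_pmf :: "('a::finite \<Rightarrow> real) \<Rightarrow> 'a pmf" where
  "softmax_pmf x = embed_pmf (\<lambda>a. exp (x a) / (\<Sum>a'\<in>UNIV. exp (x a')))"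

lemma softmax_eq: "softmax \<theta> = (\<lambda>s. softmax_pmf (\<theta> s))"
  by (simp add: softmax_def softmax_pmf_def)

lemma sum_exp_pos: "0 < (\<Sum>a\<in>UNIV. exp (x (a::'a::finite) :: real))"
  by (rule sum_pos) auto

lemma pmf_softmax_pmf: "pmf (softmax_pmf x) a = exp (x a) / (\<Sum>a'\<in>UNIV. exp (x a'))"
  unfolding softmax_pmf_def
proof (rule pmf_embed_pmf)
  show "0 \<le> exp (x a) / (\<Sum>a'\<in>UNIV. exp (x a'))" for a
    using sum_exp_pos[of x] by simp
  have "(\<Sum>a\<in>UNIV. exp (x a) / (\<Sum>a'\<in>UNIV. exp (x a'))) = 1"
    using sum_exp_pos[of x] by (simp add: sum_divide_distrib[symmetric])
  then show "(\<integral>\<^sup>+ a. ennreal (exp (x a) / (\<Sum>a'\<in>UNIV. exp (x a'))) \<partial>count_space UNIV) = 1"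
    using sum_exp_pos[of x] by (simp add: nn_integral_count_space_finite sum_ennreal less_imp_le)
qed

lemma pmf_softmax_pmf_pos: "0 < pmf (softmax_pmf x) a"
  using sum_exp_pos[of x] by (simp add: pmf_softmax_pmf)

definition log_sum_exp :: "('a::finite \<Rightarrow> real) \<Rightarrow> real" where
  "log_sum_exp x = ln (\<Sum>a\<in>UNIV. exp (x a))"

lemma ln_pmf_softmax_pmf: "ln (pmf (softmax_pmf x) a) = x a - log_sum_exp x"
  using sum_exp_pos[of x] by (simp add: pmf_softmax_pmf log_sum_exp_def ln_div)

text \<open>The symmetrised divergence of two softmax distributions is
  \<open>\<Sum>a. (p a - q a) * (x a - y a)\<close>, the log-partition functions dropping out.\<close>

lemma softmax_pmf_Lipschitz:
  assumes "\<And>a. \<bar>x a - y a\<bar> \<le> e"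
  shows "l1_dist (softmax_pmf x) (softmax_pmf y) \<le> e"
proof -
  let ?p = "softmax_pmf x" and ?q = "softmax_pmf y"
  have e: "0 \<le> e" using assms[of undefined] by linarith
  have "(l1_dist ?p ?q)\<^sup>2 \<le> kl_div ?p ?q + kl_div ?q ?p"
    using pinsker[of ?p ?q] pinsker[of ?q ?p]
    by (simp add: pmf_softmax_pmf_pos l1_dist_commute[of ?q ?p])
  also have "\<dots> = (\<Sum>a\<in>UNIV. (pmf ?p a - pmf ?q a) * (x a - y a))
      + (log_sum_exp y - log_sum_exp x) * (\<Sum>a\<in>UNIV. pmf ?p a - pmf ?q a)"
    unfolding kl_div_def ln_pmf_softmax_pmf sum_distrib_left sum.distrib[symmetric]
    by (rule sum.cong) (simp_all add: algebra_simps)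
  also have "\<dots> = (\<Sum>a\<in>UNIV. (pmf ?p a - pmf ?q a) * (x a - y a))"
    by (simp add: sum_subtractf)
  also have "\<dots> \<le> (\<Sum>a\<in>UNIV. \<bar>pmf ?p a - pmf ?q a\<bar> * e)"
  proof (rule sum_mono)
    fix a
    have "(pmf ?p a - pmf ?q a) * (x a - y a) \<le> \<bar>pmf ?p a - pmf ?q a\<bar> * \<bar>x a - y a\<bar>"
      by (metis abs_ge_self abs_mult)
    also have "\<dots> \<le> \<bar>pmf ?p a - pmf ?q a\<bar> * e"
      by (intro mult_left_mono assms) simp
    finally show "(pmf ?p a - pmf ?q a) * (x a - y a) \<le> \<bar>pmf ?p a - pmf ?q a\<bar> * e" .
  qed
  also have "\<dots> = l1_dist ?p ?q * e"
    by (simp add: l1_dist_def sum_distrib_right)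
  finally have "l1_dist ?p ?q * l1_dist ?p ?q \<le> l1_dist ?p ?q * e"
    by (simp add: power2_eq_square)
  then show ?thesis
    using l1_dist_nonneg[of ?p ?q] e
    by (cases "l1_dist ?p ?q = 0") (auto simp: mult_le_cancel_left)
qed

text \<open>An identity and not just an inequality, since the divergence left over is what later
  measures the duality gap.\<close>

lemma gibbs_variational:
  "(\<Sum>a\<in>UNIV. pmf p a * (x a - ln (pmf p a))) = log_sum_exp x - kl_div p (softmax_pmf x)"
proof -
  have "(\<Sum>a\<in>UNIV. pmf p a * (x a - ln (pmf p a)))
      = (\<Sum>a\<in>UNIV. pmf p a * log_sum_exp x) - kl_div p (softmax_pmf x)"
    unfolding kl_div_def ln_pmf_softmax_pmf sum_subtractf[symmetric]
    by (rule sum.cong) (simp_all add: algebra_simps)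
  then show ?thesis by (simp add: sum_distrib_right[symmetric])
qed

lemma kl_div_nonneg:
  assumes "\<And>a. 0 < pmf p a" "\<And>a. 0 < pmf q a"
  shows "0 \<le> kl_div p q"
  using pinsker[OF assms] by (meson order_trans zero_le_power2 divide_nonneg_nonneg zero_le_numeral)

lemma kl_div_refl [simp]: "kl_div p p = 0"
  by (simp add: kl_div_def)

lemma entropy_nonneg: "0 \<le> (\<Sum>a\<in>UNIV. pmf p a * - ln (pmf p a))"
proof (rule sum_nonneg)
  fix a
  have "ln (pmf p a) \<le> 0"
    by (cases "pmf p a = 0") (auto simp: pmf_le_1 pmf_pos)
  then show "0 \<le> pmf p a * - ln (pmf p a)"
    by (intro mult_nonneg_nonneg) auto
qed

lemma entropy_le:
  fixes p :: "'a::finite pmf"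
  assumes "\<And>a. 0 < pmf p a"
  shows "(\<Sum>a\<in>UNIV. pmf p a * - ln (pmf p a)) \<le> ln (real CARD('a))"
  using gibbs_variational[of p "\<lambda>_. 0"] kl_div_nonneg[OF assms pmf_softmax_pmf_pos, of "\<lambda>_. 0"]
  by (simp add: log_sum_exp_def)

subsection \<open>Entropy-regularised policy iteration\<close>

lemma occupancy_total:
  fixes M :: "('s::finite, 'a::finite, 'n::finite) cmdp"
  assumes disc: "0 \<le> discount M" "discount M < 1"
  shows "(\<Sum>s\<in>UNIV. occupancy M \<pi> \<mu> s) = 1 / (1 - discount M)"
  using occupancy_flow[OF disc, of \<mu> "\<lambda>_. 1" \<pi>] disc
  by (simp add: pmf_expectation_finite sum_distrib_right[symmetric] eq_divide_eq)

text \<open>The bounds concern rewards averaged over actions: the negative logarithm of a policy has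
  no pointwise bound common to all policies, but its average, the entropy, lies between 0 and ln
  |A|.\<close>

lemma discounted_return_bounds:
  fixes M :: "('s::finite, 'a::finite, 'n::finite) cmdp"
  assumes disc: "0 \<le> discount M" "discount M < 1"
    and "\<And>s. lo \<le> (\<Sum>a\<in>UNIV. pmf (\<pi> s) a * f s a)"
    and "\<And>s. (\<Sum>a\<in>UNIV. pmf (\<pi> s) a * f s a) \<le> hi"
  shows "lo / (1 - discount M) \<le> discounted_return M f \<pi> \<mu>"
    and "discounted_return M f \<pi> \<mu> \<le> hi / (1 - discount M)"
proof -
  have "(\<Sum>s\<in>UNIV. occupancy M \<pi> \<mu> s * c) = c / (1 - discount M)" for c
    by (simp add: sum_distrib_right[symmetric] occupancy_total[OF disc])
  note total = this
  show "lo / (1 - discount M) \<le> discounted_return M f \<pi> \<mu>"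
    unfolding total[symmetric] discounted_return_eq[OF disc]
    by (intro sum_mono mult_left_mono assms occupancy_nonneg[OF disc])
  show "discounted_return M f \<pi> \<mu> \<le> hi / (1 - discount M)"
    unfolding total[symmetric] discounted_return_eq[OF disc]
    by (intro sum_mono mult_left_mono assms occupancy_nonneg[OF disc])
qed

lemma expectation_pmf_bounds:
  fixes f :: "'a::finite \<Rightarrow> real"
  assumes "\<And>x. lo \<le> f x" "\<And>x. f x \<le> hi"
  shows "lo \<le> (\<Sum>x\<in>UNIV. pmf p x * f x)" "(\<Sum>x\<in>UNIV. pmf p x * f x) \<le> hi"
proof -
  have c: "(\<Sum>x\<in>UNIV. pmf p x * c) = c" for c
    by (simp add: sum_distrib_right[symmetric])
  show "lo \<le> (\<Sum>x\<in>UNIV. pmf p x * f x)"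
    using sum_mono[of UNIV "\<lambda>x. pmf p x * lo" "\<lambda>x. pmf p x * f x"] assms(1) by (simp add: c mult_left_mono)
  show "(\<Sum>x\<in>UNIV. pmf p x * f x) \<le> hi"
    using sum_mono[of UNIV "\<lambda>x. pmf p x * f x" "\<lambda>x. pmf p x * hi"] assms(2) by (simp add: c mult_left_mono)
qed

lemma discounted_return_add_scale:
  fixes M :: "('s::finite, 'a::finite, 'n::finite) cmdp"
  assumes disc: "0 \<le> discount M" "discount M < 1"
  shows "discounted_return M (\<lambda>s a. f s a + c * g s a) \<pi> \<mu>
    = discounted_return M f \<pi> \<mu> + c * discounted_return M g \<pi> \<mu>"
  by (simp add: discounted_return_eq[OF disc] sum_distrib_left sum.distrib distrib_left mult_ac)

text \<open>Flow conservation expresses the mean of \<open>w\<close> under \<mu> by the occupancy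
  measure, so the difference is the integrated Bellman residual of \<open>w\<close>. Leaving
  \<open>w\<close> free covers values of policies as well as the optimal soft value.\<close>

lemma performance_difference:
  fixes M :: "('s::finite, 'a::finite, 'n::finite) cmdp"
  assumes disc: "0 \<le> discount M" "discount M < 1"
  shows "discounted_return M f \<pi> \<mu> - (\<Sum>s\<in>UNIV. pmf \<mu> s * w s)
    = (\<Sum>s\<in>UNIV. occupancy M \<pi> \<mu> s * ((\<Sum>a\<in>UNIV. pmf (\<pi> s) a *
        (f s a + discount M * measure_pmf.expectation (kernel M s a) w)) - w s))"
  unfolding discounted_return_eq[OF disc] occupancy_flow[OF disc, of \<mu> w \<pi>] sum_subtractf[symmetric]
  by (rule sum.cong) (simp_all add: distrib_left right_diff_distrib sum.distrib sum_distrib_left mult_ac)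

text \<open>With w the value of \<pi>', the residual at s is the sum of (\<pi> - \<pi>') Q over
  actions, and Q lies in [0, 1 / (1 - \<gamma>)].\<close>

lemma discounted_return_diff_le:
  fixes M :: "('s::finite, 'a::finite, 'n::finite) cmdp"
  assumes disc: "0 \<le> discount M" "discount M < 1"
    and f: "\<And>s a. 0 \<le> f s a" "\<And>s a. f s a \<le> 1"
  shows "\<bar>discounted_return M f \<pi> \<mu> - discounted_return M f \<pi>' \<mu>\<bar>
    \<le> (\<Sum>s\<in>UNIV. occupancy M \<pi> \<mu> s * l1_dist (\<pi> s) (\<pi>' s)) / (1 - discount M)"
proof -
  let ?g = "discount M"
  define v where "v s = discounted_return M f \<pi>' (return_pmf s)" for s
  define Q where "Q s a = f s a + ?g * measure_pmf.expectation (kernel M s a) v" for s a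
  have v: "0 \<le> v s" "v s \<le> 1 / (1 - ?g)" for s
    using discounted_return_bounds[OF disc, of 0 \<pi>' f 1 "return_pmf s"] expectation_pmf_bounds[of 0 "f _" 1] f
    by (auto simp: v_def)
  have Q: "0 \<le> Q s a" "Q s a \<le> 1 / (1 - ?g)" for s a
  proof -
    have e: "0 \<le> measure_pmf.expectation (kernel M s a) v" "measure_pmf.expectation (kernel M s a) v \<le> 1 / (1 - ?g)"
      using expectation_pmf_bounds[of 0 v "1 / (1 - ?g)", OF v] by (auto simp: pmf_expectation_finite)
    show "0 \<le> Q s a"
      using e f disc by (simp add: Q_def)
    have "Q s a \<le> 1 + ?g * (1 / (1 - ?g))"
      unfolding Q_def by (intro add_mono mult_left_mono f e disc)
    also have "\<dots> = 1 / (1 - ?g)"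
      using disc by (simp add: field_simps)
    finally show "Q s a \<le> 1 / (1 - ?g)" .
  qed
  have vQ: "v s = (\<Sum>a\<in>UNIV. pmf (\<pi>' s) a * Q s a)" for s
    unfolding v_def Q_def by (subst discounted_return_Bellman[OF disc]) simp
  have term_le: "\<bar>(\<Sum>a\<in>UNIV. pmf (\<pi> s) a * Q s a) - v s\<bar> \<le> l1_dist (\<pi> s) (\<pi>' s) / (1 - ?g)" for s
  proof -
    have "(\<Sum>a\<in>UNIV. pmf (\<pi> s) a * Q s a) - v s = (\<Sum>a\<in>UNIV. (pmf (\<pi> s) a - pmf (\<pi>' s) a) * Q s a)"
      by (simp add: vQ sum_subtractf left_diff_distrib)
    also have "\<bar>\<dots>\<bar> \<le> (\<Sum>a\<in>UNIV. \<bar>(pmf (\<pi> s) a - pmf (\<pi>' s) a) * Q s a\<bar>)"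
      by (rule sum_abs)
    also have "\<dots> \<le> (\<Sum>a\<in>UNIV. \<bar>pmf (\<pi> s) a - pmf (\<pi>' s) a\<bar> * (1 / (1 - ?g)))"
    proof (rule sum_mono)
      fix a
      show "\<bar>(pmf (\<pi> s) a - pmf (\<pi>' s) a) * Q s a\<bar> \<le> \<bar>pmf (\<pi> s) a - pmf (\<pi>' s) a\<bar> * (1 / (1 - ?g))"
        unfolding abs_mult using Q[of s a] by (intro mult_left_mono) auto
    qed
    finally show ?thesis
      by (simp add: l1_dist_def sum_distrib_right[symmetric] sum_divide_distrib)
  qed
  have "discounted_return M f \<pi> \<mu> - discounted_return M f \<pi>' \<mu>
      = (\<Sum>s\<in>UNIV. occupancy M \<pi> \<mu> s * ((\<Sum>a\<in>UNIV. pmf (\<pi> s) a * Q s a) - v s))"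
    unfolding Q_def performance_difference[OF disc, symmetric]
    by (subst (2) discounted_return_start[OF disc]) (simp add: v_def)
  also have "\<bar>\<dots>\<bar> \<le> (\<Sum>s\<in>UNIV. \<bar>occupancy M \<pi> \<mu> s * ((\<Sum>a\<in>UNIV. pmf (\<pi> s) a * Q s a) - v s)\<bar>)"
    by (rule sum_abs)
  also have "\<dots> \<le> (\<Sum>s\<in>UNIV. occupancy M \<pi> \<mu> s * (l1_dist (\<pi> s) (\<pi>' s) / (1 - ?g)))"
    unfolding abs_mult abs_of_nonneg[OF occupancy_nonneg[OF disc]]
    by (intro sum_mono mult_left_mono term_le occupancy_nonneg[OF disc])
  finally show ?thesis
    by (simp add: sum_divide_distrib)
qed

section \<open>The soft Bellman operator and soft policy iteration\<close>

lemma log_sum_exp_le: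
  assumes "\<And>a. x a \<le> y a + c"
  shows "log_sum_exp x \<le> log_sum_exp y + c"
proof -
  have "log_sum_exp x \<le> ln (\<Sum>a\<in>UNIV. exp (y a) * exp c)"
    unfolding log_sum_exp_def using assms sum_exp_pos
    by (subst ln_le_cancel_iff) (auto intro!: sum_mono sum_pos simp: exp_add[symmetric])
  also have "\<dots> = log_sum_exp y + c"
    using sum_exp_pos[of y] by (simp add: log_sum_exp_def sum_distrib_right[symmetric] ln_mult)
  finally show ?thesis .
qed

text \<open>The entropy is folded into the one-step reward, so that
  \<open>performance_difference\<close> applies to the regularised value as it stands.\<close>

definition soft_return ::
    "('s, 'a, 'n::finite) cmdp \<Rightarrow> real ^ 'n \<Rightarrow> ('s, 'a) policy \<Rightarrow> 's pmf \<Rightarrow> real" where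
  "soft_return M l \<pi> \<mu> =
     discounted_return M (\<lambda>s a. lag_reward M l s a - temperature M * ln (pmf (\<pi> s) a)) \<pi> \<mu>"

definition soft_Q :: "('s, 'a, 'n::finite) cmdp \<Rightarrow> real ^ 'n \<Rightarrow> ('s \<Rightarrow> real) \<Rightarrow> 's \<Rightarrow> 'a \<Rightarrow> real" where
  "soft_Q M l w s a = lag_reward M l s a + discount M * measure_pmf.expectation (kernel M s a) w"

text \<open>The soft Bellman optimality operator: by the Gibbs principle, the maximum over action
  distributions of the mean of Q plus \<tau> times the entropy.\<close>

definition soft_backup ::
    "('s, 'a::finite, 'n::finite) cmdp \<Rightarrow> real ^ 'n \<Rightarrow> ('s \<Rightarrow> real) \<Rightarrow> 's \<Rightarrow> real" where
  "soft_backup M l w s = temperature M * log_sum_exp (\<lambda>a. soft_Q M l w s a / temperature M)"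

definition soft_greedy ::
    "('s, 'a::finite, 'n::finite) cmdp \<Rightarrow> real ^ 'n \<Rightarrow> ('s \<Rightarrow> real) \<Rightarrow> ('s, 'a) policy" where
  "soft_greedy M l w = softmax (\<lambda>s a. soft_Q M l w s a / temperature M)"

text \<open>An arbitrary fixed point may be chosen: \<open>lag_V_opt_policy\<close> and
  \<open>lag_V_le_opt_V\<close> derive optimality from the fixed-point equation.\<close>

definition opt_V :: "('s::finite, 'a::finite, 'n::finite) cmdp \<Rightarrow> real ^ 'n \<Rightarrow> 's \<Rightarrow> real" where
  "opt_V M l = (SOME w. soft_backup M l w = w)"

definition opt_policy :: "('s::finite, 'a::finite, 'n::finite) cmdp \<Rightarrow> real ^ 'n \<Rightarrow> ('s, 'a) policy" where
  "opt_policy M l = soft_greedy M l (opt_V M l)"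

lemma softmax_policies_pos: "\<pi> \<in> softmax_policies \<Longrightarrow> 0 < pmf (\<pi> s) a"
  by (auto simp: softmax_policies_def softmax_eq pmf_softmax_pmf_pos)

lemma soft_greedy_in [simp]: "soft_greedy M l w \<in> softmax_policies"
  by (simp add: soft_greedy_def softmax_policies_def)

lemma opt_policy_in [simp]: "opt_policy M l \<in> softmax_policies"
  by (simp add: opt_policy_def)

context
  fixes M :: "('s::finite, 'a::finite, 'n::finite) cmdp"
  assumes valid: "valid_cmdp M"
begin

lemma disc: "0 \<le> discount M" "discount M < 1" and temp: "0 < temperature M"
  using valid by (auto simp: valid_cmdp_def)

text \<open>Monotonicity and \<gamma>-contraction in one one-sided statement, the form that suits
  the gaps, which are differences of a known sign.\<close>

lemma soft_backup_le:
  assumes "\<And>s. w s \<le> w' s + c"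
  shows "soft_backup M l w s \<le> soft_backup M l w' s + discount M * c"
proof -
  have "measure_pmf.expectation (kernel M s a) w \<le> measure_pmf.expectation (kernel M s a) w' + c" for a
  proof -
    have "measure_pmf.expectation (kernel M s a) w \<le> (\<Sum>x\<in>UNIV. pmf (kernel M s a) x * (w' x + c))"
      unfolding pmf_expectation_finite by (intro sum_mono mult_left_mono assms) simp
    then show ?thesis
      by (simp add: pmf_expectation_finite distrib_left sum.distrib sum_distrib_right[symmetric])
  qed
  from mult_left_mono[OF this disc(1)]
  have "soft_Q M l w s a / temperature M \<le> soft_Q M l w' s a / temperature M + discount M * c / temperature M" for a
    unfolding add_divide_distrib[symmetric] soft_Q_def
    by (intro divide_right_mono) (use temp in \<open>auto simp: distrib_left\<close>)
  from mult_left_mono[OF log_sum_exp_le[of "\<lambda>a. soft_Q M l w s a / temperature M", OF this], of "temperature M"]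
  show ?thesis
    using temp by (simp add: soft_backup_def distrib_left)
qed

text \<open>Brouwer's theorem on the cube [-B, B]^S. The choice R + \<gamma> B = B, with R bounding
  the backup of 0, makes the operator map the cube into itself.\<close>

lemma soft_backup_fixed_point: "\<exists>w. soft_backup M l w = w"
proof -
  define R where "R = (\<Sum>s\<in>UNIV. \<bar>soft_backup M l (\<lambda>_. 0) s\<bar>)"
  define B where "B = R / (1 - discount M)"
  define F :: "real ^ 's \<Rightarrow> real ^ 's" where "F x = (\<chi> s. soft_backup M l (($) x) s)" for x
  let ?S = "cbox (\<chi> _. - B) (\<chi> _. B) :: (real ^ 's) set"
  have R: "\<bar>soft_backup M l (\<lambda>_. 0) s\<bar> \<le> R" for s
    unfolding R_def by (rule member_le_sum) auto
  then have R0: "0 \<le> R"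
    using abs_ge_zero order_trans by blast
  have B: "0 \<le> B" "R + discount M * B = B"
    using disc R0 by (auto simp: B_def field_simps)
  have mem: "x \<in> ?S \<longleftrightarrow> (\<forall>s. - B \<le> x $ s \<and> x $ s \<le> B)" for x
    by (simp add: mem_box_cart)
  have "F \<in> ?S \<rightarrow> ?S"
  proof
    fix x assume x: "x \<in> ?S"
    have "F x $ s \<le> R + discount M * B" for s
      using soft_backup_le[of "($) x" "\<lambda>_. 0" B l s] x R[of s] by (simp add: mem F_def)
    moreover have "- R \<le> F x $ s + discount M * B" for s
    proof -
      have "0 \<le> x $ s' + B" for s'
        using x unfolding mem by (metis add.commute add.right_neutral diff_le_eq minus_le_iff diff_0)
      then show ?thesis
        using soft_backup_le[of "\<lambda>_. 0" "($) x" B l s] R[of s] by (simp add: F_def)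
    qed
    ultimately show "F x \<in> ?S"
      using B unfolding mem by (smt (verit))
  qed
  moreover have nonzero: "(\<Sum>a\<in>UNIV. exp (x a)) \<noteq> 0" for x :: "'a \<Rightarrow> real"
    using sum_exp_pos[of x] by linarith
  have "continuous_on ?S F"
    unfolding F_def soft_backup_def log_sum_exp_def soft_Q_def pmf_expectation_finite
    by (intro continuous_intros ballI nonzero) (use temp in simp_all)
  moreover have "?S \<noteq> {}"
    using B mem[of 0] by auto
  ultimately obtain x where "F x = x"
    using brouwer[of ?S F] by (auto simp: compact_cbox)
  then have "soft_backup M l (($) x) = ($) x"
    unfolding F_def by (metis (no_types) vec_lambda_beta ext)
  from exI[of "\<lambda>w. soft_backup M l w = w" "($) x", OF this] show ?thesis .
qed

lemma soft_backup_opt_V: "soft_backup M l (opt_V M l) = opt_V M l"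
  unfolding opt_V_def by (rule someI_ex[OF soft_backup_fixed_point])

lemma soft_step_value:
  "(\<Sum>a\<in>UNIV. pmf (\<pi> s) a * (soft_Q M l w s a - temperature M * ln (pmf (\<pi> s) a)))
    = soft_backup M l w s - temperature M * kl_div (\<pi> s) (soft_greedy M l w s)"
proof -
  have "(\<Sum>a\<in>UNIV. pmf (\<pi> s) a * (soft_Q M l w s a - temperature M * ln (pmf (\<pi> s) a)))
      = temperature M * (\<Sum>a\<in>UNIV. pmf (\<pi> s) a * (soft_Q M l w s a / temperature M - ln (pmf (\<pi> s) a)))"
    unfolding sum_distrib_left using temp by (intro sum.cong) (auto simp: field_simps)
  then show ?thesis
    unfolding gibbs_variational by (simp add: soft_backup_def soft_greedy_def softmax_eq right_diff_distrib)
qed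

text \<open>Used with two choices of \<open>w\<close>. For \<open>opt_V\<close> the backup term
  cancels and only the divergence stays, an exact formula for the gap; for the value of a policy the
  residual is nonnegative, which gives policy improvement.\<close>

lemma soft_performance_difference:
  "soft_return M l \<pi> \<mu> - (\<Sum>s\<in>UNIV. pmf \<mu> s * w s)
    = (\<Sum>s\<in>UNIV. occupancy M \<pi> \<mu> s *
        (soft_backup M l w s - w s - temperature M * kl_div (\<pi> s) (soft_greedy M l w s)))"
proof -
  have "(\<Sum>a\<in>UNIV. pmf (\<pi> s) a * (lag_reward M l s a - temperature M * ln (pmf (\<pi> s) a)
      + discount M * measure_pmf.expectation (kernel M s a) w)) - w s
    = soft_backup M l w s - w s - temperature M * kl_div (\<pi> s) (soft_greedy M l w s)" for s
    using soft_step_value[of \<pi> s l w] by (simp add: soft_Q_def algebra_simps)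
  then show ?thesis
    unfolding soft_return_def performance_difference[OF disc] by (simp only:)
qed

lemma soft_return_gap:
  "(\<Sum>s\<in>UNIV. pmf \<mu> s * opt_V M l s) - soft_return M l \<pi> \<mu>
    = temperature M * (\<Sum>s\<in>UNIV. occupancy M \<pi> \<mu> s * kl_div (\<pi> s) (opt_policy M l s))"
  using soft_performance_difference[of l \<pi> \<mu> "opt_V M l"]
  by (simp add: soft_backup_opt_V opt_policy_def sum_distrib_left sum_negf mult_ac)

lemma lag_V_eq: "lag_V M l \<pi> s = soft_return M l \<pi> (return_pmf s)"
  using discounted_return_add_scale[OF disc, of "lag_reward M l" "temperature M" "\<lambda>s a. - ln (pmf (\<pi> s) a)"]
  by (simp add: lag_V_def soft_return_def entropy_return_eq[OF disc])

lemma lag_Q_eq: "lag_Q M l \<pi> = soft_Q M l (lag_V M l \<pi>)"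
  by (intro ext) (simp add: lag_Q_def soft_Q_def)

lemma return_pmf_sum: "(\<Sum>x\<in>UNIV. pmf (return_pmf s) x * w x) = (w (s :: 's) :: real)"
  using pmf_expectation_finite[of "return_pmf s" w] by simp

lemma lag_V_le_opt_V:
  assumes "\<pi> \<in> softmax_policies"
  shows "lag_V M l \<pi> s \<le> opt_V M l s"
proof -
  have "0 \<le> temperature M * (\<Sum>x\<in>UNIV. occupancy M \<pi> (return_pmf s) x * kl_div (\<pi> x) (opt_policy M l x))"
    using temp by (intro mult_nonneg_nonneg sum_nonneg occupancy_nonneg[OF disc] kl_div_nonneg
        softmax_policies_pos[OF assms] softmax_policies_pos[OF opt_policy_in]) auto
  then show ?thesis
    using soft_return_gap[of "return_pmf s" l \<pi>] by (simp add: lag_V_eq return_pmf_sum)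
qed

lemma lag_V_opt_policy: "lag_V M l (opt_policy M l) s = opt_V M l s"
  using soft_return_gap[of "return_pmf s" l "opt_policy M l"] by (simp add: lag_V_eq return_pmf_sum)

lemma lag_V_Bellman:
  "lag_V M l \<pi> s = soft_backup M l (lag_V M l \<pi>) s
     - temperature M * kl_div (\<pi> s) (soft_greedy M l (lag_V M l \<pi>) s)"
proof -
  have "lag_V M l \<pi> s = (\<Sum>a\<in>UNIV. pmf (\<pi> s) a * (soft_Q M l (lag_V M l \<pi>) s a - temperature M * ln (pmf (\<pi> s) a)))"
    unfolding lag_V_eq[abs_def] soft_return_def
    by (subst discounted_return_Bellman[OF disc]) (simp add: soft_Q_def algebra_simps)
  then show ?thesis
    by (simp only: soft_step_value)
qed

lemma lag_V_le_soft_backup: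
  assumes "\<pi> \<in> softmax_policies"
  shows "lag_V M l \<pi> s \<le> soft_backup M l (lag_V M l \<pi>) s"
  using lag_V_Bellman[of l \<pi> s] temp
    kl_div_nonneg[OF softmax_policies_pos[OF assms] softmax_policies_pos[OF soft_greedy_in[of M l "lag_V M l \<pi>"]], of s s]
  by (smt (verit) mult_nonneg_nonneg)

text \<open>The divergence of the greedy policy from itself is zero, so its value dominates the old
  one. Inserting this into its own Bellman equation lifts the bound from the old value to the backup
  of the old value, and that backup is what contracts.\<close>

lemma policy_improvement:
  assumes "\<pi> \<in> softmax_policies"
  shows "soft_backup M l (lag_V M l \<pi>) s \<le> lag_V M l (soft_greedy M l (lag_V M l \<pi>)) s"
proof -
  let ?v = "lag_V M l \<pi>"
  let ?\<pi>' = "soft_greedy M l ?v"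
  have improves: "?v s \<le> lag_V M l ?\<pi>' s" for s
  proof -
    have "0 \<le> (\<Sum>x\<in>UNIV. occupancy M ?\<pi>' (return_pmf s) x *
        (soft_backup M l ?v x - ?v x - temperature M * kl_div (?\<pi>' x) (soft_greedy M l ?v x)))"
      using lag_V_le_soft_backup[OF assms] by (intro sum_nonneg mult_nonneg_nonneg occupancy_nonneg[OF disc]) simp
    then show ?thesis
      using soft_performance_difference[of l ?\<pi>' "return_pmf s" ?v] by (simp add: lag_V_eq[of l ?\<pi>'] return_pmf_sum)
  qed
  have "soft_backup M l ?v s
      = (\<Sum>a\<in>UNIV. pmf (?\<pi>' s) a * (soft_Q M l ?v s a - temperature M * ln (pmf (?\<pi>' s) a)))"
    by (simp add: soft_step_value)
  also have "\<dots> \<le> (\<Sum>a\<in>UNIV. pmf (?\<pi>' s) a * (soft_Q M l (lag_V M l ?\<pi>') s a - temperature M * ln (pmf (?\<pi>' s) a)))"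
    unfolding soft_Q_def pmf_expectation_finite using disc
    by (intro sum_mono mult_left_mono diff_right_mono add_left_mono improves) auto
  also have "\<dots> = lag_V M l ?\<pi>' s"
    by (simp add: soft_step_value lag_V_Bellman[of l ?\<pi>' s, symmetric])
  finally show ?thesis .
qed

lemma policy_iteration_contraction:
  assumes "\<pi> \<in> softmax_policies" and "\<And>s. opt_V M l s - lag_V M l \<pi> s \<le> e"
  shows "opt_V M l s - lag_V M l (soft_greedy M l (lag_V M l \<pi>)) s \<le> discount M * e"
proof -
  have "opt_V M l s \<le> soft_backup M l (lag_V M l \<pi>) s + discount M * e"
    using soft_backup_le[of "opt_V M l" "lag_V M l \<pi>" e l s] assms(2)
    by (simp add: soft_backup_opt_V algebra_simps)
  with policy_improvement[OF assms(1), of l s] show ?thesis by linarith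
qed

text \<open>For this step size the old probabilities carry exponent 0. They must be positive,
  because \<open>0 powr 0 = 0\<close>.\<close>

lemma npg_step_eq:
  assumes "\<pi> \<in> softmax_policies" and \<eta>: "\<eta> = (1 - discount M) / temperature M"
  shows "npg_step M l \<eta> \<pi> = soft_greedy M l (lag_V M l \<pi>)"
proof -
  have "1 - \<eta> * temperature M / (1 - discount M) = 0"
    using disc temp by (simp add: \<eta>)
  moreover have "\<eta> * q / (1 - discount M) = q / temperature M" for q
    using disc temp by (simp add: \<eta>)
  ultimately have "npg_weight M l \<eta> \<pi> s a = exp (soft_Q M l (lag_V M l \<pi>) s a / temperature M)" for s a
    using softmax_policies_pos[OF assms(1), of s a]
    by (simp only: npg_weight_def lag_Q_eq powr_zero_eq_one) auto
  then show ?thesis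
    by (simp add: npg_step_def soft_greedy_def softmax_def)
qed

lemma npg_sub_convergence:
  assumes "\<pi> \<in> softmax_policies" and \<eta>: "\<eta> = (1 - discount M) / temperature M"
    and "\<And>s. opt_V M l s - lag_V M l \<pi> s \<le> e"
  shows "npg_sub M l \<pi> \<eta> N \<in> softmax_policies"
    and "opt_V M l s - lag_V M l (npg_sub M l \<pi> \<eta> N) s \<le> discount M ^ N * e"
proof -
  have "npg_sub M l \<pi> \<eta> N \<in> softmax_policies \<and>
      (\<forall>s. opt_V M l s - lag_V M l (npg_sub M l \<pi> \<eta> N) s \<le> discount M ^ N * e)"
  proof (induction N)
    case 0
    then show ?case using assms by (simp add: npg_sub_def)
  next
    case (Suc N)
    let ?\<pi> = "npg_sub M l \<pi> \<eta> N"
    have "npg_sub M l \<pi> \<eta> (Suc N) = soft_greedy M l (lag_V M l ?\<pi>)"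
      using npg_step_eq[of ?\<pi> \<eta> l] Suc \<eta> by (simp add: npg_sub_def)
    then show ?case
      using policy_iteration_contraction[of ?\<pi> l "discount M ^ N * e"] Suc by (simp add: mult.assoc)
  qed
  then show "npg_sub M l \<pi> \<eta> N \<in> softmax_policies"
    and "opt_V M l s - lag_V M l (npg_sub M l \<pi> \<eta> N) s \<le> discount M ^ N * e" by auto
qed

text \<open>The last policy is greedy for the value after N - 1 steps; passing to Q supplies the
  missing factor \<gamma>, and the scores of the softmax are Q / \<tau>. For N = 0 the output is the
  input policy, which need not be greedy for anything.\<close>

lemma npg_sub_l1_dist:
  assumes "\<pi> \<in> softmax_policies" and \<eta>: "\<eta> = (1 - discount M) / temperature M"
    and e: "\<And>s. opt_V M l s - lag_V M l \<pi> s \<le> e" and "0 < N"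
  shows "l1_dist (npg_sub M l \<pi> \<eta> N s) (opt_policy M l s) \<le> discount M ^ N * e / temperature M"
proof -
  obtain K where N: "N = Suc K"
    using \<open>0 < N\<close> gr0_conv_Suc by auto
  let ?\<pi> = "npg_sub M l \<pi> \<eta> K"
  note conv = npg_sub_convergence[OF assms(1) \<eta> e]
  have eq: "npg_sub M l \<pi> \<eta> N = soft_greedy M l (lag_V M l ?\<pi>)"
    using npg_step_eq[OF conv(1) \<eta>] by (simp add: N npg_sub_def)
  have "\<bar>soft_Q M l (lag_V M l ?\<pi>) s a - soft_Q M l (opt_V M l) s a\<bar> \<le> discount M * (discount M ^ K * e)" for a
  proof -
    have "\<bar>soft_Q M l (lag_V M l ?\<pi>) s a - soft_Q M l (opt_V M l) s a\<bar>
        = discount M * \<bar>\<Sum>x\<in>UNIV. pmf (kernel M s a) x * (lag_V M l ?\<pi> x - opt_V M l x)\<bar>"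
      using disc by (simp add: soft_Q_def pmf_expectation_finite right_diff_distrib[symmetric] abs_mult
          sum_subtractf[symmetric] del: sum_subtractf)
    also have "\<bar>\<Sum>x\<in>UNIV. pmf (kernel M s a) x * (lag_V M l ?\<pi> x - opt_V M l x)\<bar> \<le> discount M ^ K * e"
      using expectation_pmf_bounds[of "- (discount M ^ K * e)" "\<lambda>x. lag_V M l ?\<pi> x - opt_V M l x" 0 "kernel M s a"]
        conv(2) lag_V_le_opt_V[OF conv(1)] by (auto simp: abs_le_iff algebra_simps)
    finally show ?thesis
      using disc by (simp add: mult_left_mono)
  qed
  then have "\<bar>soft_Q M l (lag_V M l ?\<pi>) s a / temperature M - soft_Q M l (opt_V M l) s a / temperature M\<bar>
      \<le> discount M ^ N * e / temperature M" for a
    using temp by (simp add: diff_divide_distrib[symmetric] divide_right_mono N mult.assoc)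
  from softmax_pmf_Lipschitz[of "\<lambda>a. soft_Q M l (lag_V M l ?\<pi>) s a / temperature M", OF this]
  show ?thesis
    by (simp add: eq opt_policy_def soft_greedy_def softmax_eq)
qed

text \<open>Uniform in \<pi>, since the entropy is at least 0 for the policy at hand and at most ln
  |A| for the optimal one.\<close>

lemma opt_V_gap_le:
  assumes "\<pi> \<in> softmax_policies"
    and r: "\<And>s a. lo \<le> lag_reward M l s a" "\<And>s a. lag_reward M l s a \<le> hi"
  shows "opt_V M l s - lag_V M l \<pi> s \<le> (hi - lo + temperature M * ln (real CARD('a))) / (1 - discount M)"
proof -
  have bounds: "lo \<le> (\<Sum>a\<in>UNIV. pmf (\<pi> s) a * (lag_reward M l s a - temperature M * ln (pmf (\<pi> s) a)))"
    "(\<Sum>a\<in>UNIV. pmf (\<pi> s) a * (lag_reward M l s a - temperature M * ln (pmf (\<pi> s) a)))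
        \<le> hi + temperature M * ln (real CARD('a))"
    if "\<pi> \<in> softmax_policies" for \<pi> s
  proof -
    have "(\<Sum>a\<in>UNIV. pmf (\<pi> s) a * (lag_reward M l s a - temperature M * ln (pmf (\<pi> s) a)))
        = (\<Sum>a\<in>UNIV. pmf (\<pi> s) a * lag_reward M l s a)
          + temperature M * (\<Sum>a\<in>UNIV. pmf (\<pi> s) a * - ln (pmf (\<pi> s) a))"
      unfolding sum_distrib_left sum.distrib[symmetric] by (rule sum.cong) (auto simp: algebra_simps)
    moreover have "0 \<le> temperature M * (\<Sum>a\<in>UNIV. pmf (\<pi> s) a * - ln (pmf (\<pi> s) a))"
      using entropy_nonneg temp by (intro mult_nonneg_nonneg) auto
    moreover have "temperature M * (\<Sum>a\<in>UNIV. pmf (\<pi> s) a * - ln (pmf (\<pi> s) a)) \<le> temperature M * ln (real CARD('a))"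
      using entropy_le[OF softmax_policies_pos[OF that]] temp by (intro mult_left_mono) auto
    moreover note expectation_pmf_bounds[of lo "lag_reward M l s" hi "\<pi> s", OF r]
    ultimately show "lo \<le> (\<Sum>a\<in>UNIV. pmf (\<pi> s) a * (lag_reward M l s a - temperature M * ln (pmf (\<pi> s) a)))"
      "(\<Sum>a\<in>UNIV. pmf (\<pi> s) a * (lag_reward M l s a - temperature M * ln (pmf (\<pi> s) a)))
        \<le> hi + temperature M * ln (real CARD('a))"
      by linarith+
  qed
  have "opt_V M l s \<le> (hi + temperature M * ln (real CARD('a))) / (1 - discount M)"
    unfolding lag_V_opt_policy[symmetric] lag_V_eq soft_return_def
    by (rule discounted_return_bounds(2)[OF disc bounds]) auto
  moreover have "lo / (1 - discount M) \<le> lag_V M l \<pi> s"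
    unfolding lag_V_eq soft_return_def
    by (rule discounted_return_bounds(1)[OF disc bounds]) (use assms in auto)
  ultimately show ?thesis
    by (simp add: diff_divide_distrib add_divide_distrib)
qed

end

subsection \<open>The dual function\<close>

lemma inner_util:
  fixes M :: "('s::finite, 'a::finite, 'n::finite) cmdp"
  assumes disc: "0 \<le> discount M" "discount M < 1"
  shows "l \<bullet> util M \<pi> = discounted_return M (\<lambda>s a. l \<bullet> utility M s a) \<pi> (start M)"
proof -
  have "l \<bullet> util M \<pi> = (\<Sum>i\<in>UNIV. \<Sum>s\<in>UNIV. \<Sum>a\<in>UNIV.
      occupancy M \<pi> (start M) s * (pmf (\<pi> s) a * (l $ i * utility M s a $ i)))"
    by (simp add: inner_vec_def util_def discounted_return_eq[OF disc] sum_distrib_left mult_ac)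
  also have "\<dots> = (\<Sum>s\<in>UNIV. \<Sum>i\<in>UNIV. \<Sum>a\<in>UNIV.
      occupancy M \<pi> (start M) s * (pmf (\<pi> s) a * (l $ i * utility M s a $ i)))"
    by (rule sum.swap)
  also have "\<dots> = (\<Sum>s\<in>UNIV. \<Sum>a\<in>UNIV. \<Sum>i\<in>UNIV.
      occupancy M \<pi> (start M) s * (pmf (\<pi> s) a * (l $ i * utility M s a $ i)))"
    by (intro sum.cong refl sum.swap)
  finally show ?thesis
    by (simp add: inner_vec_def discounted_return_eq[OF disc] sum_distrib_left)
qed

lemma power2_norm_policy_vec_diff:
  "(norm (policy_vec \<pi> - policy_vec \<pi>'))\<^sup>2 = (\<Sum>s\<in>UNIV. \<Sum>a\<in>UNIV. (pmf (\<pi> s) a - pmf (\<pi>' s) a)\<^sup>2)"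
  for \<pi> \<pi>' :: "('s::finite, 'a::finite) policy"
proof -
  have "(norm (policy_vec \<pi> - policy_vec \<pi>'))\<^sup>2 = (\<Sum>x\<in>UNIV. (pmf (\<pi> (fst x)) (snd x) - pmf (\<pi>' (fst x)) (snd x))\<^sup>2)"
    unfolding power2_norm_eq_inner by (simp add: inner_vec_def policy_vec_def power2_eq_square)
  also have "\<dots> = (\<Sum>s\<in>UNIV. \<Sum>a\<in>UNIV. (pmf (\<pi> s) a - pmf (\<pi>' s) a)\<^sup>2)"
    by (simp add: UNIV_Times_UNIV[symmetric] sum.cartesian_product' del: UNIV_Times_UNIV)
  finally show ?thesis .
qed

lemma l1_dist_le_norm_policy_vec:
  "l1_dist (\<pi> s) (\<pi>' s) \<le> sqrt (real CARD('a)) * norm (policy_vec \<pi> - policy_vec \<pi>')"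
  for \<pi> \<pi>' :: "('s::finite, 'a::finite) policy"
proof -
  have "(\<Sum>a\<in>UNIV. (pmf (\<pi> s) a - pmf (\<pi>' s) a)\<^sup>2) \<le> (norm (policy_vec \<pi> - policy_vec \<pi>'))\<^sup>2"
    unfolding power2_norm_policy_vec_diff by (rule member_le_sum) (auto simp: sum_nonneg)
  then have "sqrt (\<Sum>a\<in>UNIV. (pmf (\<pi> s) a - pmf (\<pi>' s) a)\<^sup>2) \<le> norm (policy_vec \<pi> - policy_vec \<pi>')"
    by (simp add: real_le_lsqrt)
  from mult_left_mono[OF this, of "sqrt (real CARD('a))"] show ?thesis
    by (rule order_trans[OF l1_dist_le_L2]) simp
qed

text \<open>The source of the factor sqrt |S| that the extra iterations have to absorb.\<close>

lemma norm_policy_vec_diff_le: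
  fixes \<pi> \<pi>' :: "('s::finite, 'a::finite) policy"
  assumes "\<And>s. l1_dist (\<pi> s) (\<pi>' s) \<le> e"
  shows "norm (policy_vec \<pi> - policy_vec \<pi>') \<le> sqrt (real CARD('s)) * e"
proof (rule power2_le_imp_le)
  have e: "0 \<le> e"
    using assms[of undefined] l1_dist_nonneg[of "\<pi> undefined" "\<pi>' undefined"] by linarith
  have "(\<Sum>a\<in>UNIV. (pmf (\<pi> s) a - pmf (\<pi>' s) a)\<^sup>2) \<le> e\<^sup>2" for s
    using sum_squares_le_l1_dist[of "\<pi> s" "\<pi>' s"] power_mono[OF assms[of s] l1_dist_nonneg, of 2]
      zero_le_power2[of e] by linarith
  then have "(norm (policy_vec \<pi> - policy_vec \<pi>'))\<^sup>2 \<le> (\<Sum>s\<in>(UNIV::'s set). e\<^sup>2)"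
    unfolding power2_norm_policy_vec_diff by (rule sum_mono)
  then show "(norm (policy_vec \<pi> - policy_vec \<pi>'))\<^sup>2 \<le> (sqrt (real CARD('s)) * e)\<^sup>2"
    by (simp add: power_mult_distrib)
  show "0 \<le> sqrt (real CARD('s)) * e"
    using e by simp
qed

lemma norm_vec_le_sqrt_card:
  fixes x :: "real ^ 'n"
  assumes "\<And>i. \<bar>x $ i\<bar> \<le> c"
  shows "norm x \<le> sqrt (real CARD('n)) * c"
proof (rule power2_le_imp_le)
  have c: "0 \<le> c"
    using assms[of undefined] by linarith
  have "(norm x)\<^sup>2 = (\<Sum>i\<in>UNIV. \<bar>x $ i\<bar>\<^sup>2)"
    unfolding power2_norm_eq_inner by (simp add: inner_vec_def power2_eq_square)
  also have "\<dots> \<le> (\<Sum>i\<in>(UNIV::'n set). c\<^sup>2)"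
    by (intro sum_mono power_mono assms) simp
  finally show "(norm x)\<^sup>2 \<le> (sqrt (real CARD('n)) * c)\<^sup>2"
    by (simp add: power_mult_distrib)
  show "0 \<le> sqrt (real CARD('n)) * c"
    using c by simp
qed

lemma ell_c_nonneg: "0 \<le> ell_c M"
  by (simp add: ell_c_def)

context
  fixes M :: "('s::finite, 'a::finite, 'n::finite) cmdp"
  assumes valid: "valid_cmdp M"
begin

lemma util_bounds: "0 \<le> util M \<pi> $ i" "util M \<pi> $ i \<le> 1 / (1 - discount M)"
proof -
  have g: "0 \<le> utility M s a $ i" "utility M s a $ i \<le> 1" for s a
    using valid by (auto simp: valid_cmdp_def)
  show "0 \<le> util M \<pi> $ i" "util M \<pi> $ i \<le> 1 / (1 - discount M)"
    using discounted_return_bounds[OF disc[OF valid], of 0 \<pi> "\<lambda>s a. utility M s a $ i" 1 "start M"]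
      expectation_pmf_bounds[of 0 "\<lambda>a. utility M _ a $ i" 1, OF g]
    by (auto simp: util_def)
qed

lemma util_diff_le:
  assumes "\<And>s. l1_dist (\<pi> s) (\<pi>' s) \<le> e"
  shows "\<bar>util M \<pi> $ i - util M \<pi>' $ i\<bar> \<le> e / (1 - discount M)\<^sup>2"
proof -
  have g: "0 \<le> utility M s a $ i" "utility M s a $ i \<le> 1" for s a
    using valid by (auto simp: valid_cmdp_def)
  have "(\<Sum>s\<in>UNIV. occupancy M \<pi> (start M) s * l1_dist (\<pi> s) (\<pi>' s))
      \<le> (\<Sum>s\<in>UNIV. occupancy M \<pi> (start M) s * e)"
    by (intro sum_mono mult_left_mono assms occupancy_nonneg[OF disc[OF valid]])
  also have "\<dots> = e / (1 - discount M)"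
    by (simp add: sum_distrib_right[symmetric] occupancy_total[OF disc[OF valid]])
  finally have "(\<Sum>s\<in>UNIV. occupancy M \<pi> (start M) s * l1_dist (\<pi> s) (\<pi>' s)) / (1 - discount M)
      \<le> e / (1 - discount M) / (1 - discount M)"
    using disc[OF valid] by (intro divide_right_mono) auto
  with discounted_return_diff_le[OF disc[OF valid], of "\<lambda>s a. utility M s a $ i" \<pi> "start M" \<pi>', OF g]
  show ?thesis
    by (simp add: util_def power2_eq_square)
qed

text \<open>In \<open>ell_c\<close> one factor 1 / (1 - \<gamma>) bounds Q, the other is the mass of
  the occupancy measure, and sqrt |A| is the price of passing from L^1 to the Euclidean
  norm.\<close>

lemma util_diff_le_norm:
  "\<bar>util M \<pi> $ i - util M \<pi>' $ i\<bar> \<le> ell_c M * norm (policy_vec \<pi> - policy_vec \<pi>')"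
  using util_diff_le[of \<pi> \<pi>', OF l1_dist_le_norm_policy_vec, of i] by (simp add: ell_c_def)

lemma lagrangian_eq: "lagrangian M \<pi> l = soft_return M l \<pi> (start M) - l \<bullet> threshold M"
proof -
  have "soft_return M l \<pi> (start M)
      = discounted_return M (\<lambda>s a. (reward M s a + 1 * (l \<bullet> utility M s a)) + temperature M * (- ln (pmf (\<pi> s) a))) \<pi> (start M)"
    by (simp add: soft_return_def lag_reward_def)
  also have "\<dots> = reg_value M \<pi> + l \<bullet> util M \<pi>"
    unfolding discounted_return_add_scale[OF disc[OF valid]]
    by (simp add: reg_value_def entropy_return_eq[OF disc[OF valid]] inner_util[OF disc[OF valid]])
  finally show ?thesis
    by (simp add: lagrangian_def inner_diff_right)
qed

lemma lagrangian_shift: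
  "lagrangian M \<pi> l' = lagrangian M \<pi> l + (l' - l) \<bullet> (util M \<pi> - threshold M)"
  by (simp add: lagrangian_def inner_diff_left)

lemma kl_sum_nonneg:
  assumes "\<pi> \<in> softmax_policies" "\<pi>' \<in> softmax_policies"
  shows "0 \<le> temperature M * (\<Sum>s\<in>UNIV. occupancy M \<pi> \<mu> s * kl_div (\<pi> s) (\<pi>' s))"
  using temp[OF valid] by (intro mult_nonneg_nonneg sum_nonneg occupancy_nonneg[OF disc[OF valid]]
      kl_div_nonneg softmax_policies_pos[OF assms(1)] softmax_policies_pos[OF assms(2)]) auto

lemma lagrangian_gap:
  "lagrangian M (opt_policy M l) l - lagrangian M \<pi> l
    = temperature M * (\<Sum>s\<in>UNIV. occupancy M \<pi> (start M) s * kl_div (\<pi> s) (opt_policy M l s))"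
  using soft_return_gap[OF valid, of "start M" l \<pi>] soft_return_gap[OF valid, of "start M" l "opt_policy M l"]
  by (simp add: lagrangian_eq)

lemma dual_fun_eq: "dual_fun M l = lagrangian M (opt_policy M l) l"
  unfolding dual_fun_def
proof (rule cSup_eq_maximum)
  show "lagrangian M (opt_policy M l) l \<in> (\<lambda>\<pi>. lagrangian M \<pi> l) ` softmax_policies"
    by simp
  show "x \<le> lagrangian M (opt_policy M l) l" if "x \<in> (\<lambda>\<pi>. lagrangian M \<pi> l) ` softmax_policies" for x
  proof -
    from that obtain \<pi> where "\<pi> \<in> softmax_policies" "x = lagrangian M \<pi> l" by auto
    then show ?thesis
      using lagrangian_gap[of l \<pi>] kl_sum_nonneg[of \<pi> "opt_policy M l" "start M"] by simp
  qed
qed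

lemma lagrangian_le_dual_fun: "\<pi> \<in> softmax_policies \<Longrightarrow> lagrangian M \<pi> l \<le> dual_fun M l"
  using lagrangian_gap[of l \<pi>] kl_sum_nonneg[of \<pi> "opt_policy M l" "start M"] by (simp add: dual_fun_eq)

lemma lagrangian_eq_lag_V: "lagrangian M \<pi> l = (\<Sum>s\<in>UNIV. pmf (start M) s * lag_V M l \<pi> s) - l \<bullet> threshold M"
  unfolding lagrangian_eq lag_V_eq[OF valid] soft_return_def
  by (subst discounted_return_start[OF disc[OF valid]]) simp

lemma dual_fun_gap_le:
  assumes "\<And>s. opt_V M l s - lag_V M l \<pi> s \<le> e"
  shows "dual_fun M l - lagrangian M \<pi> l \<le> e"
proof -
  have "dual_fun M l - lagrangian M \<pi> l
      = (\<Sum>s\<in>UNIV. pmf (start M) s * (opt_V M l s - lag_V M l \<pi> s))"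
    by (simp add: dual_fun_eq lagrangian_eq_lag_V lag_V_opt_policy[OF valid] sum_subtractf right_diff_distrib)
  also have "\<dots> \<le> (\<Sum>s\<in>UNIV. pmf (start M) s * e)"
    by (intro sum_mono mult_left_mono assms) simp
  finally show ?thesis
    by (simp add: sum_distrib_right[symmetric])
qed

text \<open>The maximiser at \<open>m\<close> competes at \<open>l\<close>, where its Lagrangian
  differs by an affine term. This is Danskin's argument, and it also supplies the convexity of D
  that the acceleration uses.\<close>

lemma dual_fun_subgradient:
  "dual_fun M m + (l - m) \<bullet> (util M (opt_policy M m) - threshold M) \<le> dual_fun M l"
  using lagrangian_le_dual_fun[of "opt_policy M m" l] lagrangian_shift[of "opt_policy M m" l m]
  by (simp add: dual_fun_eq)

context
  fixes d :: real
  assumes exploration: "0 < d" "\<forall>\<pi>\<in>softmax_policies. \<forall>s. d \<le> visitation M \<pi> s"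
begin

text \<open>The divergence is weighted by the occupancy measure of \<pi> itself, which exploration
  bounds below by d / (1 - \<gamma>). Pinsker and \<open>sum_squares_le_l1_dist\<close> share the
  middle term, half the squared L^1 distance, so no numerical factor remains.\<close>

lemma dual_gap_quadratic_growth:
  assumes \<pi>: "\<pi> \<in> softmax_policies"
  shows "temperature M * d / (1 - discount M) * (norm (policy_vec \<pi> - policy_vec (opt_policy M l)))\<^sup>2
    \<le> dual_fun M l - lagrangian M \<pi> l"
proof -
  let ?\<pi>' = "opt_policy M l"
  have "d / (1 - discount M) * (\<Sum>a\<in>UNIV. (pmf (\<pi> s) a - pmf (?\<pi>' s) a)\<^sup>2)
      \<le> occupancy M \<pi> (start M) s * kl_div (\<pi> s) (?\<pi>' s)" for s
  proof (rule mult_mono)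
    show "d / (1 - discount M) \<le> occupancy M \<pi> (start M) s"
      using exploration(2)[THEN bspec, OF \<pi>, THEN spec, of s] disc[OF valid] visitation_eq[OF disc[OF valid], of \<pi> s]
      by (simp add: pos_divide_le_eq mult.commute)
    show "(\<Sum>a\<in>UNIV. (pmf (\<pi> s) a - pmf (?\<pi>' s) a)\<^sup>2) \<le> kl_div (\<pi> s) (?\<pi>' s)"
      using sum_squares_le_l1_dist[of "\<pi> s" "?\<pi>' s"]
        pinsker[of "\<pi> s" "?\<pi>' s", OF softmax_policies_pos[OF \<pi>] softmax_policies_pos[OF opt_policy_in]] by linarith
  qed (auto intro: occupancy_nonneg[OF disc[OF valid]] sum_nonneg)
  then have "(\<Sum>s\<in>UNIV. d / (1 - discount M) * (\<Sum>a\<in>UNIV. (pmf (\<pi> s) a - pmf (?\<pi>' s) a)\<^sup>2))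
      \<le> (\<Sum>s\<in>UNIV. occupancy M \<pi> (start M) s * kl_div (\<pi> s) (?\<pi>' s))"
    by (rule sum_mono)
  then have "temperature M * (\<Sum>s\<in>UNIV. d / (1 - discount M) * (\<Sum>a\<in>UNIV. (pmf (\<pi> s) a - pmf (?\<pi>' s) a)\<^sup>2))
      \<le> dual_fun M l - lagrangian M \<pi> l"
    unfolding dual_fun_eq lagrangian_gap using temp[OF valid] by (intro mult_left_mono) auto
  then show ?thesis
    unfolding power2_norm_policy_vec_diff sum_distrib_left[symmetric] by (simp add: mult.assoc)
qed

lemma ell_pos: "0 < ell M d"
  unfolding ell_def using disc[OF valid] temp[OF valid] exploration(1)
  by (intro divide_pos_pos mult_pos_pos add_pos_nonneg) auto

text \<open>The quadratic growth of the gap absorbs the first-order change of the utility: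
  \<open>a * x - c * x\<^sup>2 \<le> a\<^sup>2 / (4 * c)\<close>.\<close>

lemma dual_fun_smooth:
  "dual_fun M l \<le> dual_fun M m + (l - m) \<bullet> (util M (opt_policy M m) - threshold M)
    + ell M d / 2 * (norm (l - m))\<^sup>2"
proof -
  let ?\<pi>' = "opt_policy M l" and ?\<pi> = "opt_policy M m" and ?g = "discount M"
  define x where "x = norm (policy_vec ?\<pi>' - policy_vec ?\<pi>)"
  define c where "c = temperature M * d / (1 - ?g)"
  define a where "a = norm (l - m) * (sqrt (real CARD('n)) * ell_c M)"
  have c: "0 < c"
    using temp[OF valid] disc[OF valid] exploration(1) by (simp add: c_def)
  have g: "0 < 1 - ?g"
    using disc[OF valid] by simp
  have "(l - m) \<bullet> (util M ?\<pi>' - util M ?\<pi>) \<le> norm (l - m) * norm (util M ?\<pi>' - util M ?\<pi>)"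
    by (rule norm_cauchy_schwarz)
  also have "\<dots> \<le> norm (l - m) * (sqrt (real CARD('n)) * (ell_c M * x))"
    unfolding x_def by (intro mult_left_mono norm_vec_le_sqrt_card) (auto simp: util_diff_le_norm)
  finally have cross: "(l - m) \<bullet> (util M ?\<pi>' - util M ?\<pi>) \<le> a * x"
    by (simp add: a_def mult.assoc)
  have "0 \<le> (a - 2 * c * x)\<^sup>2"
    by simp
  then have "a * x - c * x\<^sup>2 \<le> a\<^sup>2 / (4 * c)"
    using c by (simp add: field_simps power2_eq_square)
  also have "a\<^sup>2 = (norm (l - m))\<^sup>2 * (real CARD('n) * real CARD('a) / (1 - ?g) ^ 4)"
    by (simp add: a_def ell_c_def power_mult_distrib power_divide power_mult[symmetric])
  also have "\<dots> / (4 * c) = (norm (l - m))\<^sup>2 * (1 / 2 * (real CARD('n) * real CARD('a))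
      / (temperature M * (1 - ?g) ^ 3 * d)) / 2"
  proof -
    have "y * (u / h ^ 4) / (4 * (t * d / h)) = y * (1 / 2 * u / (t * h ^ 3 * d)) / 2"
      if "0 < h" "0 < t" for y u h t :: real
      using that exploration(1) by (simp add: divide_simps power_numeral_reduce)
    from this[OF g temp[OF valid]] show ?thesis
      by (simp only: c_def)
  qed
  \<comment> \<open>Completing the square asks for the smoothness constant n |A| / (2 \<tau> (1 -
    \<gamma>)^3 d); \<open>ell\<close> exceeds it because 2 ln 2 is at least 1 / 2 and its second
    summand is nonnegative.\<close>
  also have "\<dots> \<le> (norm (l - m))\<^sup>2 * ell M d / 2"
  proof -
    have "1 / 2 * (real CARD('n) * real CARD('a)) \<le> 2 * ln 2 * (real CARD('n) * real CARD('a))"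
      using ln2_ge_two_thirds by (intro mult_right_mono) auto
    also have "\<dots> \<le> 2 * ln 2 * (real CARD('n) * real CARD('a) + (1 - ?g)\<^sup>2 * sqrt (real CARD('n) * real CARD('a)))"
      by (intro mult_left_mono) auto
    finally show ?thesis
      unfolding ell_def using g temp[OF valid] exploration(1)
      by (intro divide_right_mono mult_left_mono) auto
  qed
  finally have "a * x - c * x\<^sup>2 \<le> ell M d / 2 * (norm (l - m))\<^sup>2"
    by (simp add: mult.commute)
  moreover have "dual_fun M l = lagrangian M ?\<pi>' m + (l - m) \<bullet> (util M ?\<pi>' - threshold M)"
    using lagrangian_shift[of ?\<pi>' l m] by (simp add: dual_fun_eq)
  moreover have "c * x\<^sup>2 \<le> dual_fun M m - lagrangian M ?\<pi>' m"
    unfolding c_def x_def by (rule dual_gap_quadratic_growth) simp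
  ultimately show ?thesis
    using cross by (simp add: inner_diff_right)
qed

end

end

subsection \<open>Accelerated projected gradient descent with inexact gradients\<close>

text \<open>The points \<open>z\<close> and \<open>z'\<close> are the extrapolated iterates whose distances to \<open>lstar\<close> enter the
  potential; \<open>G\<close> is the inexact gradient and \<open>g\<close> the exact one.\<close>

lemma inexact_accelerated_step:
  fixes lam lam' mu z z' lstar g G :: "'a::euclidean_space"
  assumes S: "convex S" "closed S" "lam \<in> S" "lstar \<in> S"
    and \<theta>: "0 < \<theta>" "\<theta> \<le> 1" and L: "0 < L"
    and lam': "lam' = closest_point S (mu - (1 / L) *\<^sub>R G)"
    and mu: "mu = (1 - \<theta>) *\<^sub>R lam + \<theta> *\<^sub>R z"
    and z': "lam' = (1 - \<theta>) *\<^sub>R lam + \<theta> *\<^sub>R z'"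
    and lower: "\<And>u. u \<in> S \<Longrightarrow> D mu + (u - mu) \<bullet> g \<le> D u"
    and upper: "D lam' \<le> D mu + (lam' - mu) \<bullet> g + L / 2 * (norm (lam' - mu))\<^sup>2"
    and err: "norm (G - g) \<le> \<delta>"
  shows "D lam' - D lstar + L / 2 * \<theta>\<^sup>2 * (norm (lstar - z'))\<^sup>2
    \<le> (1 - \<theta>) * (D lam - D lstar) + L / 2 * \<theta>\<^sup>2 * (norm (lstar - z))\<^sup>2 + \<delta> * (\<theta> * norm (lstar - z'))"
proof -
  \<comment> \<open>The comparison point is \<open>mu\<close> with \<open>z\<close> replaced by
    \<open>lstar\<close>. It lies in S by convexity, and its distances to \<open>mu\<close> and
    \<open>lam'\<close> are \<theta> times those of \<open>lstar\<close> to \<open>z\<close> and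
    \<open>z'\<close>.\<close>
  define u where "u = (1 - \<theta>) *\<^sub>R lam + \<theta> *\<^sub>R lstar"
  have u_mu: "u - mu = \<theta> *\<^sub>R (lstar - z)" and u_lam': "u - lam' = \<theta> *\<^sub>R (lstar - z')"
    unfolding u_def mu by (simp_all add: z' algebra_simps)
  have "u \<in> S"
    unfolding u_def using S \<theta> by (intro convexD) auto
  then have "(mu - (1 / L) *\<^sub>R G - lam') \<bullet> (u - lam') \<le> 0"
    unfolding lam' by (rule closest_point_dot[OF S(1,2)])
  then have "L * ((mu - (1 / L) *\<^sub>R G - lam') \<bullet> (u - lam')) \<le> 0"
    using L by (simp add: mult_le_0_iff)
  then have proj: "L * ((mu - lam') \<bullet> (u - lam')) \<le> G \<bullet> (u - lam')"
    using L by (simp add: inner_diff_left algebra_simps)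
  \<comment> \<open>The affine minorant at \<open>mu\<close> is averaged over \<open>lam\<close> and
    \<open>lstar\<close>.\<close>
  have "D mu + (u - mu) \<bullet> g
      = (1 - \<theta>) * (D mu + (lam - mu) \<bullet> g) + \<theta> * (D mu + (lstar - mu) \<bullet> g)"
    by (simp add: u_def algebra_simps inner_add_left inner_diff_left)
  also have "\<dots> \<le> (1 - \<theta>) * D lam + \<theta> * D lstar"
    using \<theta> by (intro add_mono mult_left_mono lower S) auto
  finally have conv: "D mu + (u - mu) \<bullet> g \<le> (1 - \<theta>) * D lam + \<theta> * D lstar" .
  have "(G - g) \<bullet> (u - lam') \<le> norm (G - g) * norm (u - lam')"
    by (rule norm_cauchy_schwarz)
  also have "\<dots> \<le> \<delta> * (\<theta> * norm (lstar - z'))"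
    using \<theta> err by (simp add: u_lam' mult_right_mono)
  finally have error: "(G - g) \<bullet> (u - lam') \<le> \<delta> * (\<theta> * norm (lstar - z'))" .
  \<comment> \<open>Three-point identity, which turns the obtuse angle at the projection into a
    difference of squared distances.\<close>
  have "L / 2 * (norm (u - mu))\<^sup>2 - L / 2 * (norm (u - lam'))\<^sup>2
      = L / 2 * (norm (lam' - mu))\<^sup>2 - L * ((mu - lam') \<bullet> (u - lam'))"
    by (simp add: power2_norm_eq_inner inner_diff_left inner_diff_right inner_commute algebra_simps)
  moreover have "(norm (u - mu))\<^sup>2 = \<theta>\<^sup>2 * (norm (lstar - z))\<^sup>2"
    "(norm (u - lam'))\<^sup>2 = \<theta>\<^sup>2 * (norm (lstar - z'))\<^sup>2"
    by (simp_all add: u_mu u_lam' power_mult_distrib)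
  moreover have "(lam' - mu) \<bullet> g = (u - mu) \<bullet> g - G \<bullet> (u - lam') + (G - g) \<bullet> (u - lam')"
    by (simp add: inner_diff_left inner_diff_right inner_commute)
  ultimately show ?thesis
    using upper proj conv error by (simp add: algebra_simps)
qed

text \<open>With \<theta> = 2 / (k + 2) each step adds at most L w(k + 1) / (2 T) to the potential
  \<open>F\<close>, where w(k + 1) is a distance not yet controlled. One induction therefore bounds
  \<open>w\<close> by w(0) + 1 together with \<open>F\<close>. The T errors then add up to at most L
  (w(0) + 1) / 2, and w(0)^2 + w(0) + 1 is at most (w(0) + 1)^2.\<close>

lemma inexact_accelerated_projected_gradient:
  fixes lam mu g G :: "nat \<Rightarrow> 'a::euclidean_space"
  assumes S: "convex S" "closed S" "lstar \<in> S" "lam 0 \<in> S"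
    and L: "0 < L" and T: "0 < T"
    and mu_0: "mu 0 = lam 0"
    and mu_Suc: "\<And>k. mu (Suc k) = lam (Suc k) + (real k / (real k + 3)) *\<^sub>R (lam (Suc k) - lam k)"
    and lam_Suc: "\<And>k. lam (Suc k) = closest_point S (mu k - (1 / L) *\<^sub>R G k)"
    and minimal: "\<And>x. x \<in> S \<Longrightarrow> D lstar \<le> D x"
    and lower: "\<And>k u. u \<in> S \<Longrightarrow> D (mu k) + (u - mu k) \<bullet> g k \<le> D u"
    and upper: "\<And>k. D (lam (Suc k)) \<le> D (mu k) + (lam (Suc k) - mu k) \<bullet> g k
        + L / 2 * (norm (lam (Suc k) - mu k))\<^sup>2"
    and err: "\<And>k. k < T \<Longrightarrow> norm (G k - g k) \<le> L / (real T * (real T + 1))"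
  shows "D (lam T) - D lstar \<le> 2 * L / (real T + 1)\<^sup>2 * (norm (lam 0 - lstar) + 1)\<^sup>2"
proof -
  \<comment> \<open>\<open>z (Suc k)\<close> is \<open>lam k\<close> plus the last increment divided
    by \<theta>. The extrapolation weights are exactly those for which \<open>mu k\<close> is the
    \<theta>-average of \<open>lam k\<close> and \<open>z k\<close>.\<close>
  define z where "z k = (case k of 0 \<Rightarrow> lam 0 | Suc j \<Rightarrow> lam j + ((real j + 2) / 2) *\<^sub>R (lam (Suc j) - lam j))" for k
  define w where "w k = norm (lstar - z k)" for k
  define \<Delta> where "\<Delta> k = D (lam k) - D lstar" for k
  \<comment> \<open>The weight k (k + 2) / 4 is (1 - \<theta>) / \<theta>^2.\<close>
  define F where "F k = real k * (real k + 2) / 4 * \<Delta> k + L / 2 * (w k)\<^sup>2" for k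
  have lam_in: "lam k \<in> S" for k
    using S by (cases k) (auto simp: lam_Suc intro!: closest_point_in_set)
  have \<Delta>: "0 \<le> \<Delta> k" for k
    using minimal[OF lam_in] by (simp add: \<Delta>_def)
  have w_nonneg: "0 \<le> w k" for k
    by (simp add: w_def)
  have step: "(real k + 2)\<^sup>2 / 4 * \<Delta> (Suc k) + L / 2 * (w (Suc k))\<^sup>2 \<le> F k + L / (2 * real T) * w (Suc k)"
    if k: "k < T" for k
  proof -
    define \<theta> where "\<theta> = 2 / (real k + 2)"
    have \<theta>: "0 < \<theta>" "\<theta> \<le> 1" and inv: "(real k + 2) / 2 * \<theta> = 1"
      by (auto simp: \<theta>_def field_simps)
    have z_Suc: "lam (Suc k) = (1 - \<theta>) *\<^sub>R lam k + \<theta> *\<^sub>R z (Suc k)"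
    proof -
      have "\<theta> *\<^sub>R ((real k + 2) / 2) *\<^sub>R (lam (Suc k) - lam k) = lam (Suc k) - lam k"
        using inv by (simp add: mult.commute)
      then show ?thesis
        by (simp add: z_def scaleR_add_right scaleR_diff_left del: scaleR_scaleR)
    qed
    have mu_eq: "mu k = (1 - \<theta>) *\<^sub>R lam k + \<theta> *\<^sub>R z k"
    proof (cases k)
      case 0
      then show ?thesis by (simp add: mu_0 \<theta>_def z_def)
    next
      case (Suc j)
      have "\<theta> *\<^sub>R (z k - lam k) = (\<theta> * (real j / 2)) *\<^sub>R (lam (Suc j) - lam j)"
      proof -
        have "z k - lam k = ((real j + 2) / 2 - 1) *\<^sub>R (lam (Suc j) - lam j)"
          by (simp add: Suc z_def scaleR_diff_left)
        also have "(real j + 2) / 2 - 1 = real j / 2"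
          by (simp add: field_simps)
        finally show ?thesis by simp
      qed
      also have "\<theta> * (real j / 2) = real j / (real j + 3)"
        by (simp add: \<theta>_def Suc field_simps)
      finally have "mu k = lam k + \<theta> *\<^sub>R (z k - lam k)"
        by (simp add: Suc mu_Suc)
      then show ?thesis by (simp add: algebra_simps)
    qed
    have "D (lam (Suc k)) - D lstar + L / 2 * \<theta>\<^sup>2 * (norm (lstar - z (Suc k)))\<^sup>2
      \<le> (1 - \<theta>) * (D (lam k) - D lstar) + L / 2 * \<theta>\<^sup>2 * (norm (lstar - z k))\<^sup>2
        + L / (real T * (real T + 1)) * (\<theta> * norm (lstar - z (Suc k)))"
      by (rule inexact_accelerated_step[OF S(1,2) lam_in S(3) \<theta> L lam_Suc mu_eq z_Suc lower upper err[OF k]])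
    then have "\<Delta> (Suc k) + L / 2 * \<theta>\<^sup>2 * (w (Suc k))\<^sup>2
      \<le> (1 - \<theta>) * \<Delta> k + L / 2 * \<theta>\<^sup>2 * (w k)\<^sup>2 + L / (real T * (real T + 1)) * (\<theta> * w (Suc k))"
      by (simp only: \<Delta>_def w_def)
    moreover define A where "A = ((real k + 2) / 2)\<^sup>2"
    ultimately have "A * (\<Delta> (Suc k) + L / 2 * \<theta>\<^sup>2 * (w (Suc k))\<^sup>2)
      \<le> A * ((1 - \<theta>) * \<Delta> k + L / 2 * \<theta>\<^sup>2 * (w k)\<^sup>2
          + L / (real T * (real T + 1)) * (\<theta> * w (Suc k)))"
      by (intro mult_left_mono) (auto simp: A_def)
    moreover have "A * (x + L / 2 * \<theta>\<^sup>2 * y) = A * x + L / 2 * (A * \<theta>\<^sup>2) * y" for x y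
      by (simp add: algebra_simps)
    moreover have "A * ((1 - \<theta>) * x + L / 2 * \<theta>\<^sup>2 * y + c * (\<theta> * v))
      = A * (1 - \<theta>) * x + L / 2 * (A * \<theta>\<^sup>2) * y + c * (A * \<theta> * v)" for x y c v
      by (simp add: algebra_simps)
    moreover have "A * \<theta>\<^sup>2 = 1"
      using inv unfolding A_def by (metis power_mult_distrib power_one)
    moreover have "A * (1 - \<theta>) = real k * (real k + 2) / 4"
      by (simp add: A_def \<theta>_def field_simps power2_eq_square)
    moreover have "A * \<theta> = (real k + 2) / 2"
      using inv by (simp add: A_def power2_eq_square mult.assoc)
    ultimately have "A * \<Delta> (Suc k) + L / 2 * (w (Suc k))\<^sup>2
      \<le> F k + L / (real T * (real T + 1)) * ((real k + 2) / 2 * w (Suc k))"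
      by (simp only: F_def mult_1_right)
    moreover have "L / (real T * (real T + 1)) * ((real k + 2) / 2 * w (Suc k)) \<le> L / (2 * real T) * w (Suc k)"
    proof -
      have "L / (real T * (real T + 1)) * ((real k + 2) / 2) \<le> L / (real T * (real T + 1)) * ((real T + 1) / 2)"
        using L T k by (intro mult_left_mono) auto
      also have "\<dots> = L / (2 * real T)"
        by simp
      finally show ?thesis
        unfolding mult.assoc[symmetric] by (rule mult_right_mono) (rule w_nonneg)
    qed
    ultimately show ?thesis
      by (simp add: A_def power_divide)
  qed
  \<comment> \<open>The weight (k + 2)^2 / 4 gained in a step covers (k + 1) (k + 3) / 4, the weight
    needed at the start of the next.\<close>
  have F_Suc: "F (Suc k) \<le> (real k + 2)\<^sup>2 / 4 * \<Delta> (Suc k) + L / 2 * (w (Suc k))\<^sup>2" for k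
  proof -
    have "real (Suc k) * (real (Suc k) + 2) / 4 * \<Delta> (Suc k) \<le> (real k + 2)\<^sup>2 / 4 * \<Delta> (Suc k)"
      by (intro mult_right_mono \<Delta>) (simp add: power2_eq_square algebra_simps)
    then show ?thesis by (simp add: F_def)
  qed
  have growth: "w k \<le> w 0 + 1 \<and> F k \<le> L / 2 * ((w 0)\<^sup>2 + real k / real T * (w 0 + 1))" if "k \<le> T" for k
    using that
  proof (induction k)
    case 0
    then show ?case by (simp add: F_def)
  next
    case (Suc k)
    have F_le: "F (Suc k) \<le> L / 2 * ((w 0)\<^sup>2 + real k / real T * (w 0 + 1)) + L / (2 * real T) * w (Suc k)"
      using Suc step[of k] F_Suc[of k] by linarith
    have rearrange: "L / 2 * ((w 0)\<^sup>2 + real k / real T * (w 0 + 1)) + L / (2 * real T) * x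
        = L / 2 * ((w 0)\<^sup>2 + real k / real T * (w 0 + 1) + 1 / real T * x)" for x
      by (simp add: algebra_simps)
    have kT: "real k / real T + 1 / real T \<le> 1"
      using Suc.prems T by (simp add: field_simps)
    have "w (Suc k) \<le> w 0 + 1"
    \<comment> \<open>If w(k + 1) exceeded w(0) + 1, its square would exceed w(0)^2 + w(k + 1), yet
      the potential bounds it by just that.\<close>
    proof (rule ccontr)
      assume "\<not> w (Suc k) \<le> w 0 + 1"
      then have gt: "w 0 + 1 < w (Suc k)" by simp
      have "L / 2 * (w (Suc k))\<^sup>2 \<le> F (Suc k)"
        using \<Delta>[of "Suc k"] by (simp add: F_def)
      then have "(w (Suc k))\<^sup>2 \<le> (w 0)\<^sup>2 + real k / real T * (w 0 + 1) + 1 / real T * w (Suc k)"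
        using F_le L unfolding rearrange by (smt (verit) mult_less_cancel_left_pos half_gt_zero)
      also have "\<dots> \<le> (w 0)\<^sup>2 + (real k / real T + 1 / real T) * w (Suc k)"
        using gt by (simp add: distrib_right divide_right_mono mult_left_mono)
      also have "\<dots> \<le> (w 0)\<^sup>2 + 1 * w (Suc k)"
        by (intro add_left_mono mult_right_mono kT w_nonneg)
      finally have "w (Suc k) * w (Suc k) \<le> w 0 * w 0 + w (Suc k)"
        by (simp add: power2_eq_square)
      moreover have "(w 0 + 1) * w (Suc k) < w (Suc k) * w (Suc k)"
        using gt w_nonneg[of 0] by (intro mult_strict_right_mono) auto
      moreover have "w 0 * w 0 \<le> w 0 * w (Suc k)"
        using gt w_nonneg[of 0] by (intro mult_left_mono) auto
      ultimately show False
        by (simp add: distrib_right)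
    qed
    moreover have "L / 2 * ((w 0)\<^sup>2 + real k / real T * (w 0 + 1)) + L / (2 * real T) * w (Suc k)
        \<le> L / 2 * ((w 0)\<^sup>2 + real (Suc k) / real T * (w 0 + 1))"
    proof -
      have "1 / real T * w (Suc k) \<le> 1 / real T * (w 0 + 1)"
        using \<open>w (Suc k) \<le> w 0 + 1\<close> by (rule mult_left_mono) simp
      moreover have "real (Suc k) / real T * (w 0 + 1) = real k / real T * (w 0 + 1) + 1 / real T * (w 0 + 1)"
        by (simp add: add_divide_distrib distrib_right)
      ultimately show ?thesis
        unfolding rearrange using L by (intro mult_left_mono) linarith+
    qed
    ultimately show ?case
      using F_le by linarith
  qed
  \<comment> \<open>The last step is used before passing to \<open>F T\<close>: the weight (T + 1)^2
    / 4 gives the stated rate, whereas \<open>F T\<close> has only T (T + 2) / 4.\<close>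
  obtain k where k: "T = Suc k"
    using T gr0_conv_Suc by auto
  have "real k + 2 = real T + 1" "k < T"
    by (simp_all add: k)
  from step[OF this(2), folded k, unfolded this(1)]
  have "(real T + 1)\<^sup>2 / 4 * \<Delta> T + L / 2 * (w T)\<^sup>2 \<le> F k + L / (2 * real T) * w T" .
  moreover have "0 \<le> L / 2 * (w T)\<^sup>2"
    using L by simp
  ultimately have "(real T + 1)\<^sup>2 / 4 * \<Delta> T \<le> F k + L / (2 * real T) * w T"
    by linarith
  also have "\<dots> \<le> L / 2 * ((w 0)\<^sup>2 + real k / real T * (w 0 + 1)) + L / (2 * real T) * (w 0 + 1)"
    using growth[of k] growth[of T] L by (intro add_mono mult_left_mono) (auto simp: k)
  also have "\<dots> = L / 2 * ((w 0)\<^sup>2 + (real k / real T + 1 / real T) * (w 0 + 1))"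
    by (simp add: algebra_simps)
  also have "real k / real T + 1 / real T = 1"
    by (simp add: k field_simps)
  also have "L / 2 * ((w 0)\<^sup>2 + 1 * (w 0 + 1)) \<le> L / 2 * (w 0 + 1)\<^sup>2"
    using L w_nonneg[of 0] by (intro mult_left_mono) (auto simp: power2_eq_square algebra_simps)
  finally have "\<Delta> T \<le> L / 2 * (w 0 + 1)\<^sup>2 / ((real T + 1)\<^sup>2 / 4)"
    by (subst pos_le_divide_eq) (auto simp: mult.commute)
  then show ?thesis
    by (simp add: \<Delta>_def w_def z_def norm_minus_commute)
qed

subsection \<open>Errors of the subroutine and of the dual iterates\<close>

text \<open>From g \<le> exp (-(1 - g)). If x < 1, the count is rounded to 0 and the right-hand side
  exceeds 1.\<close>

lemma discount_power_iterations_le: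
  fixes g x :: real
  assumes "0 \<le> g" "g < 1" "0 < x"
  shows "g ^ nat \<lceil>1 / (1 - g) * ln x\<rceil> \<le> 1 / x"
proof -
  let ?N = "nat \<lceil>1 / (1 - g) * ln x\<rceil>"
  have "1 / (1 - g) * ln x \<le> real ?N"
    by (rule real_nat_ceiling_ge)
  then have "ln x \<le> real ?N * (1 - g)"
    using assms by (simp add: pos_divide_le_eq)
  have "g ^ ?N \<le> exp (- (1 - g)) ^ ?N"
    using assms exp_ge_add_one_self[of "- (1 - g)"] by (intro power_mono) auto
  also have "\<dots> = exp (- (real ?N * (1 - g)))"
    by (simp add: exp_of_nat_mult[symmetric] algebra_simps)
  also have "\<dots> \<le> exp (- ln x)"
    using \<open>ln x \<le> _\<close> by simp
  also have "\<dots> = 1 / x"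
    using assms by (simp add: exp_minus inverse_eq_divide)
  finally show ?thesis .
qed

text \<open>For a single action ln |A| = 0, so \<open>scale\<close> does not control \<tau>; but
  then all policies coincide.\<close>

lemma l1_dist_singleton:
  fixes p q :: "'a::finite pmf"
  assumes "CARD('a) = 1"
  shows "l1_dist p q = 0"
proof -
  obtain a where UNIV: "(UNIV :: 'a set) = {a}"
    using assms by (rule card_1_singletonE)
  have "pmf r a = 1" for r :: "'a pmf"
    using sum_pmf_UNIV[of r] unfolding UNIV by simp
  then show ?thesis
    unfolding l1_dist_def UNIV by simp
qed

context
  fixes M :: "('s::finite, 'a::finite, 'n::finite) cmdp"
  assumes valid: "valid_cmdp M"
begin

lemma npg_sub_in_softmax:
  assumes "\<pi> \<in> softmax_policies" and "\<eta> = (1 - discount M) / temperature M"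
  shows "npg_sub M l \<pi> \<eta> N \<in> softmax_policies"
proof -
  \<comment> \<open>A crude finite gap is enough here, since only membership is wanted.\<close>
  have "opt_V M l s - lag_V M l \<pi> s \<le> (\<Sum>s\<in>UNIV. \<bar>opt_V M l s - lag_V M l \<pi> s\<bar>)" for s
    using member_le_sum[of s UNIV "\<lambda>s. \<bar>opt_V M l s - lag_V M l \<pi> s\<bar>"] by simp
  from npg_sub_convergence(1)[OF valid assms this] show ?thesis .
qed

lemma lag_reward_bounds:
  assumes "\<And>i. - lo i \<le> l $ i" "\<And>i. l $ i \<le> hi i" "\<And>i. 0 \<le> lo i" "\<And>i. 0 \<le> hi i"
  shows "- (\<Sum>i\<in>UNIV. lo i) \<le> lag_reward M l s a" "lag_reward M l s a \<le> 1 + (\<Sum>i\<in>UNIV. hi i)"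
proof -
  have g: "0 \<le> utility M s a $ i" "utility M s a $ i \<le> 1" and r: "0 \<le> reward M s a" "reward M s a \<le> 1" for i
    using valid by (auto simp: valid_cmdp_def)
  have "- lo i \<le> l $ i * utility M s a $ i" "l $ i * utility M s a $ i \<le> hi i" for i
  proof -
    have "- lo i \<le> - lo i * utility M s a $ i"
      using mult_left_mono[OF g(2) assms(3), of i i] by simp
    also have "\<dots> \<le> l $ i * utility M s a $ i"
      by (intro mult_right_mono assms g)
    finally show "- lo i \<le> l $ i * utility M s a $ i" .
    have "l $ i * utility M s a $ i \<le> hi i * utility M s a $ i"
      by (intro mult_right_mono assms g)
    also have "\<dots> \<le> hi i"
      using mult_left_mono[OF g(2) assms(4), of i i] by simp
    finally show "l $ i * utility M s a $ i \<le> hi i" .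
  qed
  then have "(\<Sum>i\<in>UNIV. - lo i) \<le> l \<bullet> utility M s a" "l \<bullet> utility M s a \<le> (\<Sum>i\<in>UNIV. hi i)"
    unfolding inner_vec_def by (auto intro!: sum_mono)
  then show "- (\<Sum>i\<in>UNIV. lo i) \<le> lag_reward M l s a" "lag_reward M l s a \<le> 1 + (\<Sum>i\<in>UNIV. hi i)"
    using r by (auto simp: lag_reward_def sum_negf)
qed

text \<open>For \<open>N = 0\<close> no greedy step has been taken and the bound holds for the trivial reason that
  both utilities lie in \<open>[0, 1 / (1 - \<gamma>)]\<close>; this is where \<open>\<tau> \<le> E\<close> is needed.\<close>

lemma npg_sub_util_error:
  assumes \<pi>: "\<pi> \<in> softmax_policies" and \<eta>: "\<eta> = (1 - discount M) / temperature M"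
    and gap: "\<And>s. opt_V M l s - lag_V M l \<pi> s \<le> E / (1 - discount M)"
    and E: "0 \<le> E" "CARD('a) \<noteq> 1 \<Longrightarrow> temperature M \<le> E"
  shows "\<bar>util M (npg_sub M l \<pi> \<eta> N) $ i - util M (opt_policy M l) $ i\<bar>
    \<le> discount M ^ N * (E / (temperature M * (1 - discount M) ^ 3))"
proof -
  let ?g = "discount M" and ?t = "temperature M"
  let ?\<pi>' = "npg_sub M l \<pi> \<eta> N" and ?\<pi>o = "opt_policy M l"
  have g: "0 < 1 - ?g" "0 \<le> ?g" and t: "0 < ?t"
    using disc[OF valid] temp[OF valid] by auto
  have rhs: "0 \<le> ?g ^ N * (E / (?t * (1 - ?g) ^ 3))"
    using g t E(1) by (intro mult_nonneg_nonneg divide_nonneg_nonneg zero_le_power) auto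
  consider "CARD('a) = 1" | "0 < N" | "CARD('a) \<noteq> 1" "N = 0" by auto
  then show ?thesis
  proof cases
    case 1
    then have "l1_dist (?\<pi>' s) (?\<pi>o s) \<le> 0" for s
      by (simp add: l1_dist_singleton)
    from util_diff_le[OF valid, of ?\<pi>' ?\<pi>o, OF this, of i] show ?thesis
      using rhs by simp
  next
    case 2
    have "l1_dist (?\<pi>' s) (?\<pi>o s) \<le> ?g ^ N * (E / (1 - ?g)) / ?t" for s
      by (rule npg_sub_l1_dist[OF valid \<pi> \<eta> gap 2])
    from util_diff_le[OF valid, of ?\<pi>' ?\<pi>o, OF this, of i] show ?thesis
      by (simp add: power2_eq_square power3_eq_cube mult_ac)
  next
    case 3
    have "\<bar>util M ?\<pi>' $ i - util M ?\<pi>o $ i\<bar> \<le> 1 / (1 - ?g)"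
      using util_bounds[OF valid, of ?\<pi>' i] util_bounds[OF valid, of ?\<pi>o i] by linarith
    also have "1 / (1 - ?g) \<le> E / (?t * (1 - ?g) ^ 3)"
    proof -
      have "?t * (1 - ?g)\<^sup>2 \<le> E * 1"
        using E 3 g t by (intro mult_mono power_le_one) auto
      then have "?t * (1 - ?g)\<^sup>2 * (1 - ?g) \<le> E * (1 - ?g)"
        using g by (intro mult_right_mono) auto
      then show ?thesis
        using g t by (simp add: divide_simps power2_eq_square power3_eq_cube mult_ac)
    qed
    finally show ?thesis
      using 3 by simp
  qed
qed

end

section \<open>The multiplier box and the accelerated dual iterates\<close>

locale slater_cmdp =
  fixes M :: "('s::finite, 'a::finite, 'n::finite) cmdp"
    and \<pi>bar \<pi>star :: "('s, 'a) policy"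
    and \<xi> lstar :: "real ^ 'n"
    and d :: real
  assumes valid: "valid_cmdp M"
    and slater: "\<pi>bar \<in> softmax_policies"
      "\<forall>i. 0 < \<xi> $ i"
      "\<forall>i. \<xi> $ i \<le> util M \<pi>bar $ i - threshold M $ i"
    and primal_optimal: "is_arg_max (reg_value M) (feasible M) \<pi>star"
    and dual_optimal: "is_arg_min (dual_fun M) (\<lambda>l. \<forall>i. 0 \<le> l $ i) lstar"
    and strong_duality: "reg_value M \<pi>star = dual_opt M"
    and exploration: "0 < d" "\<forall>\<pi>\<in>softmax_policies. \<forall>s. d \<le> visitation M \<pi> s"
begin

abbreviation "\<gamma> \<equiv> discount M"
abbreviation "\<tau> \<equiv> temperature M"
abbreviation "C2 \<equiv> const_C2 M \<pi>star \<pi>bar \<xi>"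
abbreviation "multipliers \<equiv> dual_box M \<pi>star \<pi>bar \<xi>"

definition radius :: "'n \<Rightarrow> real" where
  "radius i = (reg_value M \<pi>star - reg_value M \<pi>bar) / \<xi> $ i"

text \<open>For multipliers in the box, \<open>scale\<close> / (1 - \<gamma>) bounds the gap of
  every softmax policy; see \<open>final_gap\<close>.\<close>

definition scale :: real where
  "scale = 1 + C2 + \<tau> * ln (real CARD('a))"

lemma params: "0 \<le> \<gamma>" "\<gamma> < 1" "0 < \<tau>"
  using disc[OF valid] temp[OF valid] by auto

lemma feasible_\<pi>bar: "feasible M \<pi>bar"
  using slater unfolding feasible_def by (smt (verit))

lemma feasible_\<pi>star: "feasible M \<pi>star"
  using primal_optimal by (simp add: is_arg_max_def)

lemma \<pi>star_in: "\<pi>star \<in> softmax_policies"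
  using feasible_\<pi>star by (simp add: feasible_def)

lemma reg_value_le: "reg_value M \<pi>bar \<le> reg_value M \<pi>star"
  using primal_optimal feasible_\<pi>bar by (auto simp: is_arg_max_def not_less)

lemma radius_nonneg: "0 \<le> radius i"
  using reg_value_le slater(2) by (simp add: radius_def less_imp_le)

lemma sum_radius: "(\<Sum>i\<in>UNIV. radius i) = C2"
  by (simp add: radius_def const_C2_def sum_distrib_left)

lemma C2_nonneg: "0 \<le> C2"
  unfolding sum_radius[symmetric] by (intro sum_nonneg radius_nonneg)

lemma mem_multipliers: "l \<in> multipliers \<longleftrightarrow> (\<forall>i. 0 \<le> l $ i \<and> l $ i \<le> radius i)"
  by (simp add: dual_box_def radius_def)

lemma multipliers_eq_cbox: "multipliers = cbox 0 (\<chi> i. radius i)"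
  by (auto simp: mem_multipliers mem_box_cart)

lemma scale_ge: "1 + C2 \<le> scale" "\<tau> * ln (real CARD('a)) \<le> scale" "0 < scale"
proof -
  have "0 \<le> \<tau> * ln (real CARD('a))"
    using params by (intro mult_nonneg_nonneg) (auto simp: Suc_le_eq)
  then show "1 + C2 \<le> scale" "\<tau> * ln (real CARD('a)) \<le> scale" "0 < scale"
    using C2_nonneg by (auto simp: scale_def)
qed

text \<open>Supplies the hypothesis \<tau> \<le> E of \<open>npg_sub_util_error\<close>, which
  covers an iteration number rounded to 0.\<close>

lemma temperature_le_scale: "CARD('a) \<noteq> 1 \<Longrightarrow> \<tau> \<le> 2 * scale"
proof -
  assume "CARD('a) \<noteq> 1"
  then have "2 \<le> CARD('a)"
    using zero_less_card_finite[where 'a='a] by linarith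
  then have "ln 2 \<le> ln (real CARD('a))"
    by simp
  then have "1 / 2 \<le> ln (real CARD('a))"
    using ln2_ge_two_thirds by linarith
  from mult_left_mono[OF this, of \<tau>] show ?thesis
    using scale_ge(2) params by linarith
qed

lemma dual_fun_lstar: "dual_fun M lstar = dual_opt M"
proof -
  have "\<forall>i. 0 \<le> lstar $ i" and min: "\<And>l. \<forall>i. 0 \<le> l $ i \<Longrightarrow> dual_fun M lstar \<le> dual_fun M l"
    using dual_optimal by (auto simp: is_arg_min_def not_less)
  then show ?thesis
    unfolding dual_opt_def by (intro cInf_eq_minimum[symmetric]) auto
qed

lemma dual_opt_le: "\<forall>i. 0 \<le> l $ i \<Longrightarrow> dual_opt M \<le> dual_fun M l"
  using dual_optimal by (auto simp: is_arg_min_def not_less dual_fun_lstar[symmetric])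

text \<open>The Slater policy is a competitor in D at \<open>lstar\<close>, where D equals the
  primal optimum. All its surplus terms are nonnegative, so each single one is bounded by the
  difference of the values.\<close>

lemma lstar_in_multipliers: "lstar \<in> multipliers"
  unfolding mem_multipliers
proof
  fix i
  have nonneg: "0 \<le> lstar $ j" for j
    using dual_optimal by (simp add: is_arg_min_def)
  have slack: "\<xi> $ j \<le> (util M \<pi>bar - threshold M) $ j" for j
    using slater(3) by simp
  have surplus: "0 \<le> (util M \<pi>bar - threshold M) $ j" for j
    using slack[of j] slater(2)[rule_format, of j] by linarith
  have "lstar $ i * \<xi> $ i \<le> lstar $ i * (util M \<pi>bar - threshold M) $ i"
    by (intro mult_left_mono slack nonneg)
  also have "\<dots> \<le> (\<Sum>j\<in>UNIV. lstar $ j * (util M \<pi>bar - threshold M) $ j)"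
    by (intro member_le_sum mult_nonneg_nonneg nonneg surplus) auto
  also have "\<dots> = lstar \<bullet> (util M \<pi>bar - threshold M)"
    by (simp add: inner_vec_def)
  also have "\<dots> \<le> reg_value M \<pi>star - reg_value M \<pi>bar"
    using lagrangian_le_dual_fun[OF valid slater(1), of lstar]
    by (simp add: lagrangian_def dual_fun_lstar strong_duality)
  finally show "0 \<le> lstar $ i \<and> lstar $ i \<le> radius i"
    using nonneg slater(2) by (simp add: radius_def pos_le_divide_eq)
qed

lemma lag_reward_bounds_extrapolated:
  assumes "\<And>i. - radius i \<le> m $ i" "\<And>i. m $ i \<le> 2 * radius i"
  shows "- C2 \<le> lag_reward M m s a" "lag_reward M m s a \<le> 1 + 2 * C2"
  using lag_reward_bounds[OF valid, of radius m "\<lambda>i. 2 * radius i"] assms radius_nonneg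
  by (auto simp: sum_radius sum_distrib_left[symmetric])

text \<open>Extrapolated multipliers give a reward range of 1 + 3 C2, hence the gap 3
  \<open>scale\<close> / (1 - \<gamma>). After cancellation the error is 3 / (2 |A|) times the
  target; the factor |A| inside the logarithm absorbs the 3 once there are two actions.\<close>

lemma N2_gradient_error:
  assumes \<pi>: "\<pi> \<in> softmax_policies" and \<eta>: "\<eta> = (1 - \<gamma>) / \<tau>" and T: "0 < T"
    and m: "\<And>i. - radius i \<le> m $ i" "\<And>i. m $ i \<le> 2 * radius i"
  shows "norm (util M (npg_sub M m \<pi> \<eta> (iter_N2 M d C2 T)) - util M (opt_policy M m))
    \<le> ell M d / (real T * (real T + 1))"
proof -
  let ?\<pi>' = "npg_sub M m \<pi> \<eta> (iter_N2 M d C2 T)"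
  let ?n = "sqrt (real CARD('n))" and ?A = "real CARD('a)" and ?T = "real T * (real T + 1)"
  have pos: "0 < ell M d" "0 < 1 - \<gamma>" "0 < \<tau>" "0 < ?n" "0 < ?A" "0 < ?T" "0 < scale"
    using ell_pos[OF valid exploration] params scale_ge T by auto
  define X where "X = 2 * ?n * ?A * real T * (real T + 1) * scale / ((1 - \<gamma>) ^ 3 * \<tau> * ell M d)"
  have "0 < X"
    unfolding X_def using pos T by (intro divide_pos_pos mult_pos_pos) auto
  have N2: "\<gamma> ^ iter_N2 M d C2 T \<le> 1 / X"
    using discount_power_iterations_le[OF params(1,2) \<open>0 < X\<close>] by (simp add: iter_N2_def X_def scale_def)
  have gap: "opt_V M m s - lag_V M m \<pi> s \<le> 3 * scale / (1 - \<gamma>)" for s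
  proof -
    have "opt_V M m s - lag_V M m \<pi> s \<le> (1 + 2 * C2 - (- C2) + \<tau> * ln ?A) / (1 - \<gamma>)"
      by (rule opt_V_gap_le[OF valid \<pi> lag_reward_bounds_extrapolated]) (use m in auto)
    also have "\<dots> \<le> 3 * scale / (1 - \<gamma>)"
      using scale_ge params C2_nonneg by (intro divide_right_mono) (auto simp: scale_def)
    finally show ?thesis .
  qed
  show ?thesis
  proof (cases "CARD('a) = 1")
    case True
    then have "l1_dist (?\<pi>' s) (opt_policy M m s) \<le> 0" for s
      by (simp add: l1_dist_singleton)
    from util_diff_le[OF valid, of ?\<pi>' "opt_policy M m", OF this] have "util M ?\<pi>' = util M (opt_policy M m)"
      by (simp add: vec_eq_iff)
    then show ?thesis
      using pos by simp
  next
    case False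
    then have A: "2 \<le> ?A"
      using zero_less_card_finite[where 'a='a] by linarith
    have err: "\<bar>util M ?\<pi>' $ i - util M (opt_policy M m) $ i\<bar> \<le> 1 / X * (3 * scale / (\<tau> * (1 - \<gamma>) ^ 3))" for i
    proof -
      have "\<bar>util M ?\<pi>' $ i - util M (opt_policy M m) $ i\<bar>
          \<le> \<gamma> ^ iter_N2 M d C2 T * (3 * scale / (\<tau> * (1 - \<gamma>) ^ 3))"
        using pos temperature_le_scale[OF False] by (intro npg_sub_util_error[OF valid \<pi> \<eta> gap]) auto
      also have "\<dots> \<le> 1 / X * (3 * scale / (\<tau> * (1 - \<gamma>) ^ 3))"
        using pos by (intro mult_right_mono N2 divide_nonneg_nonneg mult_nonneg_nonneg zero_le_power) auto
      finally show ?thesis .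
    qed
    have "norm (util M ?\<pi>' - util M (opt_policy M m)) \<le> ?n * (1 / X * (3 * scale / (\<tau> * (1 - \<gamma>) ^ 3)))"
      using err by (intro norm_vec_le_sqrt_card) simp
    also have "\<dots> = 3 / (2 * ?A) * (ell M d / ?T)"
      using pos T unfolding X_def by (simp add: divide_simps)
    also have "\<dots> \<le> 1 * (ell M d / ?T)"
      using pos A by (intro mult_right_mono) (auto simp: divide_le_eq)
    finally show ?thesis by simp
  qed
qed

context
  fixes \<eta> :: real and l0 :: "real ^ 'n" and \<pi>0 :: "('s, 'a) policy" and T :: nat
  assumes \<eta>: "\<eta> = (1 - \<gamma>) / \<tau>" and l0: "l0 \<in> multipliers" and \<pi>0: "\<pi>0 \<in> softmax_policies" and T: "0 < T"
begin

text \<open>The two initial multipliers agree, so the weight -1 / 2 at time 0 multiplies a zero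
  increment.\<close>

abbreviation iterate where
  "iterate \<equiv> apgm_iter M multipliers l0 l0 \<pi>0 (\<lambda>k. 1 / ell M d) (\<lambda>k. (real k - 1) / (real k + 2)) \<eta> (iter_N2 M d C2 T)"

definition lam :: "nat \<Rightarrow> real ^ 'n" where "lam k = fst (snd (iterate k))"
definition pol :: "nat \<Rightarrow> ('s, 'a) policy" where "pol k = snd (snd (iterate k))"
definition extra :: "nat \<Rightarrow> real ^ 'n" where
  "extra k = lam k + ((real k - 1) / (real k + 2)) *\<^sub>R (lam k - fst (iterate k))"

lemma iterate_Suc:
  "fst (iterate (Suc k)) = lam k"
  "pol (Suc k) = npg_sub M (extra k) (pol k) \<eta> (iter_N2 M d C2 T)"
  "lam (Suc k) = closest_point multipliers (extra k - (1 / ell M d) *\<^sub>R (util M (pol (Suc k)) - threshold M))"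
  by (simp_all add: lam_def pol_def extra_def Let_def split: prod.split)

lemma extra_0: "extra 0 = lam 0" and lam_0: "lam 0 = l0" and pol_0: "pol 0 = \<pi>0"
  by (simp_all add: extra_def lam_def pol_def)

lemma extra_Suc: "extra (Suc k) = lam (Suc k) + (real k / (real k + 3)) *\<^sub>R (lam (Suc k) - lam k)"
  unfolding extra_def[of "Suc k"] iterate_Suc(1) by (simp add: add.commute)

lemma lam_in_multipliers: "lam k \<in> multipliers"
proof (cases k)
  case 0
  then show ?thesis by (simp add: lam_0 l0)
next
  case (Suc j)
  have "closest_point multipliers x \<in> multipliers" for x
    using l0 by (intro closest_point_in_set) (auto simp: multipliers_eq_cbox closed_cbox)
  then show ?thesis by (simp add: Suc iterate_Suc(3))
qed

lemma pol_in: "pol k \<in> softmax_policies"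
  by (induction k) (simp_all add: pol_0 \<pi>0 iterate_Suc(2) npg_sub_in_softmax[OF valid _ \<eta>])

text \<open>An extrapolation weight below 1 overshoots by at most one side length of the box, in
  either direction.\<close>

lemma extra_bounds: "- radius i \<le> extra k $ i" "extra k $ i \<le> 2 * radius i"
proof -
  have "- radius i \<le> extra k $ i \<and> extra k $ i \<le> 2 * radius i"
  proof (cases k)
    case 0
    moreover have "0 \<le> l0 $ i" "l0 $ i \<le> radius i"
      using l0 by (simp_all add: mem_multipliers)
    ultimately show ?thesis
      by (simp add: extra_0 lam_0)
  next
    case (Suc j)
    let ?b = "real j / (real j + 3)"
    have l: "0 \<le> lam j' $ i" "lam j' $ i \<le> radius i" for j'
      using lam_in_multipliers[of j'] by (auto simp: mem_multipliers)
    define h where "h = ?b * (lam (Suc j) $ i - lam j $ i)"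
    have "\<bar>h\<bar> \<le> 1 * radius i"
      unfolding h_def abs_mult using l[of j] l[of "Suc j"] by (intro mult_mono) auto
    moreover have "extra k $ i = lam (Suc j) $ i + h"
      by (simp add: Suc extra_Suc h_def)
    ultimately show ?thesis
      using l[of "Suc j"] by (auto simp: abs_le_iff)
  qed
  then show "- radius i \<le> extra k $ i" "extra k $ i \<le> 2 * radius i" by auto
qed

lemma dual_error: "dual_fun M (lam T) - dual_opt M \<le> eps0 M d T l0 lstar"
proof -
  define g where "g k = util M (opt_policy M (extra k)) - threshold M" for k
  define G where "G k = util M (pol (Suc k)) - threshold M" for k
  have "dual_fun M (lam T) - dual_fun M lstar
      \<le> 2 * ell M d / (real T + 1)\<^sup>2 * (norm (lam 0 - lstar) + 1)\<^sup>2"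
  proof (rule inexact_accelerated_projected_gradient[where S = multipliers and mu = extra and g = g and G = G])
    show "convex multipliers" "closed multipliers"
      by (simp_all add: multipliers_eq_cbox closed_cbox)
    show "norm (G k - g k) \<le> ell M d / (real T * (real T + 1))" for k
      using N2_gradient_error[OF pol_in \<eta> T extra_bounds] by (simp add: G_def g_def iterate_Suc(2))
    show "dual_fun M lstar \<le> dual_fun M x" if "x \<in> multipliers" for x
      using that dual_opt_le by (simp add: dual_fun_lstar mem_multipliers)
    show "dual_fun M (extra k) + (u - extra k) \<bullet> g k \<le> dual_fun M u" for k u
      unfolding g_def by (rule dual_fun_subgradient[OF valid])
    show "dual_fun M (lam (Suc k)) \<le> dual_fun M (extra k) + (lam (Suc k) - extra k) \<bullet> g k
        + ell M d / 2 * (norm (lam (Suc k) - extra k))\<^sup>2" for k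
      unfolding g_def by (rule dual_fun_smooth[OF valid exploration])
  qed (use lstar_in_multipliers lam_in_multipliers ell_pos[OF valid exploration] T in
      \<open>auto simp: extra_0 extra_Suc iterate_Suc(3) G_def\<close>)
  then show ?thesis
    by (simp add: eps0_def dual_fun_lstar lam_0)
qed

end

end

subsection \<open>Errors of the returned policy\<close>

context slater_cmdp
begin

lemma reg_value_le_lagrangian:
  assumes "l \<in> multipliers"
  shows "reg_value M \<pi>star \<le> lagrangian M \<pi>star l"
proof -
  have "0 \<le> l \<bullet> (util M \<pi>star - threshold M)"
    unfolding inner_vec_def using assms feasible_\<pi>star
    by (intro sum_nonneg) (simp add: mem_multipliers feasible_def)
  then show ?thesis by (simp add: lagrangian_def)
qed

lemma C1_pos: "0 < const_C1 M d"
  using params exploration(1) by (simp add: const_C1_def)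

lemma opt_policy_error:
  assumes l: "l \<in> multipliers" and \<epsilon>: "dual_fun M l - dual_opt M \<le> \<epsilon>"
  shows "norm (policy_vec (opt_policy M l) - policy_vec \<pi>star) \<le> const_C1 M d * sqrt \<epsilon>"
proof -
  let ?x = "norm (policy_vec \<pi>star - policy_vec (opt_policy M l))"
  have "\<tau> * d / (1 - \<gamma>) * ?x\<^sup>2 \<le> \<epsilon>"
    using dual_gap_quadratic_growth[OF valid exploration \<pi>star_in, of l] reg_value_le_lagrangian[OF l] \<epsilon>
    by (simp add: strong_duality)
  then have "?x\<^sup>2 \<le> 1 * ((1 - \<gamma>) / (\<tau> * d) * \<epsilon>)"
    using params exploration(1) by (simp add: field_simps)
  \<comment> \<open>Quadratic growth gives the factor 1; the stated \<open>const_C1\<close> has 2 ln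
    2, which is larger. Enlarging requires \<epsilon> \<ge> 0.\<close>
  also have "\<dots> \<le> 2 * ln 2 * ((1 - \<gamma>) / (\<tau> * d) * \<epsilon>)"
  proof (rule mult_right_mono)
    have "0 \<le> \<epsilon>"
      using \<epsilon> dual_opt_le[of l] l by (simp add: mem_multipliers)
    then show "0 \<le> (1 - \<gamma>) / (\<tau> * d) * \<epsilon>"
      using params exploration(1) by simp
  qed (use ln2_ge_two_thirds in simp)
  also have "\<dots> = 2 * (1 - \<gamma>) * ln 2 / (\<tau> * d) * \<epsilon>"
    by simp
  finally have "?x \<le> sqrt (2 * (1 - \<gamma>) * ln 2 / (\<tau> * d) * \<epsilon>)"
    by (rule real_le_rsqrt)
  then show ?thesis
    by (simp only: const_C1_def real_sqrt_mult norm_minus_commute[of "policy_vec (opt_policy M l)"])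
qed

text \<open>The final multiplier lies in the box itself, so the reward range is 1 + C2 instead of 1
  + 3 C2.\<close>

lemma final_gap:
  assumes "\<pi> \<in> softmax_policies" "l \<in> multipliers"
  shows "opt_V M l s - lag_V M l \<pi> s \<le> scale / (1 - \<gamma>)"
proof -
  have "0 \<le> lag_reward M l s a" "lag_reward M l s a \<le> 1 + C2" for s a
    using lag_reward_bounds[OF valid, of "\<lambda>_. 0" l radius s a] assms(2) radius_nonneg
    by (auto simp: mem_multipliers sum_radius)
  from opt_V_gap_le[OF valid assms(1) this] show ?thesis
    by (simp add: scale_def)
qed

lemma N3_power_le:
  assumes "0 < \<epsilon>1" "iter_N3 M C2 \<epsilon>1 + K \<le> N"
  shows "\<gamma> ^ N \<le> \<gamma> ^ K * (\<epsilon>1 * \<tau> * (1 - \<gamma>) / (2 * sqrt (real CARD('n)) * scale))"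
proof -
  define X where "X = 2 * sqrt (real CARD('n)) * scale / (\<epsilon>1 * \<tau> * (1 - \<gamma>))"
  have "0 < X"
    using assms params scale_ge unfolding X_def by (intro divide_pos_pos mult_pos_pos) auto
  have "\<gamma> ^ N \<le> \<gamma> ^ (K + iter_N3 M C2 \<epsilon>1)"
    using assms params by (intro power_decreasing) auto
  also have "\<dots> \<le> \<gamma> ^ K * (1 / X)"
    unfolding power_add using discount_power_iterations_le[OF params(1,2) \<open>0 < X\<close>] params
    by (intro mult_left_mono) (auto simp: iter_N3_def X_def scale_def)
  finally show ?thesis
    by (simp add: X_def)
qed

context
  fixes \<eta> \<epsilon>1 :: real and l :: "real ^ 'n" and \<pi> :: "('s, 'a) policy" and N :: nat
  assumes \<eta>: "\<eta> = (1 - \<gamma>) / \<tau>" and l: "l \<in> multipliers" and \<pi>: "\<pi> \<in> softmax_policies"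
    and \<epsilon>1: "0 < \<epsilon>1"
begin

text \<open>Going from L^1 errors in the states straight to utilities avoids the norm of the policy
  vector and with it the factor sqrt |S|.\<close>

lemma N3_util_error:
  assumes "iter_N3 M C2 \<epsilon>1 \<le> N"
  shows "\<bar>util M (npg_sub M l \<pi> \<eta> N) $ i - util M (opt_policy M l) $ i\<bar> \<le> ell_c M * \<epsilon>1"
proof -
  have pos: "0 < scale" "0 < \<tau>" "0 < 1 - \<gamma>" "0 < sqrt (real CARD('n))"
    using scale_ge params by auto
  \<comment> \<open>Doubled so that \<open>temperature_le_scale\<close> applies; the 2 in the
    formula for N_3 cancels it.\<close>
  have gap: "opt_V M l s - lag_V M l \<pi> s \<le> 2 * scale / (1 - \<gamma>)" for s
  proof -
    have "scale / (1 - \<gamma>) \<le> 2 * scale / (1 - \<gamma>)"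
      using pos by (intro divide_right_mono) auto
    with final_gap[OF \<pi> l, of s] show ?thesis by linarith
  qed
  have "\<bar>util M (npg_sub M l \<pi> \<eta> N) $ i - util M (opt_policy M l) $ i\<bar>
      \<le> \<gamma> ^ N * (2 * scale / (\<tau> * (1 - \<gamma>) ^ 3))"
    using pos temperature_le_scale by (intro npg_sub_util_error[OF valid \<pi> \<eta> gap]) auto
  also have "\<dots> \<le> \<epsilon>1 * \<tau> * (1 - \<gamma>) / (2 * sqrt (real CARD('n)) * scale) * (2 * scale / (\<tau> * (1 - \<gamma>) ^ 3))"
    using N3_power_le[OF \<epsilon>1, of 0 N] assms pos by (intro mult_right_mono) auto
  also have "\<dots> = 1 / sqrt (real CARD('n)) * (\<epsilon>1 / (1 - \<gamma>)\<^sup>2)"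
    using pos by (simp add: divide_simps power2_eq_square power3_eq_cube)
  also have "\<dots> \<le> sqrt (real CARD('a)) * (\<epsilon>1 / (1 - \<gamma>)\<^sup>2)"
  proof (rule mult_right_mono)
    have "1 \<le> sqrt (real CARD('n))" "1 \<le> sqrt (real CARD('a))"
      by (simp_all add: Suc_le_eq)
    moreover from this(1) have "1 / sqrt (real CARD('n)) \<le> 1"
      by (subst divide_le_eq_1_pos) linarith+
    ultimately show "1 / sqrt (real CARD('n)) \<le> sqrt (real CARD('a))"
      by linarith
  qed (use \<epsilon>1 in simp)
  finally show ?thesis
    by (simp add: ell_c_def)
qed

text \<open>The utilities are compared through the maximiser at \<open>l\<close>, not through
  \<open>policy_error\<close>, and so without extra iterations.\<close>

lemma constraint_violation:
  assumes "iter_N3 M C2 \<epsilon>1 \<le> N" and "dual_fun M l - dual_opt M \<le> \<epsilon>"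
  shows "(MAX i. max 0 (threshold M $ i - util M (npg_sub M l \<pi> \<eta> N) $ i))
    \<le> ell_c M * (const_C1 M d * sqrt \<epsilon> + \<epsilon>1)"
proof -
  let ?\<pi>' = "npg_sub M l \<pi> \<eta> N"
  have "max 0 (threshold M $ i - util M ?\<pi>' $ i) \<le> ell_c M * (const_C1 M d * sqrt \<epsilon> + \<epsilon>1)" for i
  proof -
    have "threshold M $ i \<le> util M \<pi>star $ i"
      using feasible_\<pi>star by (simp add: feasible_def)
    moreover have "\<bar>util M (opt_policy M l) $ i - util M \<pi>star $ i\<bar> \<le> ell_c M * (const_C1 M d * sqrt \<epsilon>)"
      using util_diff_le_norm[OF valid, of "opt_policy M l" i \<pi>star]
        mult_left_mono[OF opt_policy_error[OF l assms(2)] ell_c_nonneg[of M]] by linarith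
    moreover note N3_util_error[OF assms(1), of i]
    ultimately show ?thesis
      by (simp add: distrib_left)
  qed
  then show ?thesis by simp
qed

context
  fixes K :: nat
  assumes K: "0 < K" "sqrt (real CARD('s)) * \<gamma> ^ K \<le> 1" "\<gamma> ^ K * \<tau>\<^sup>2 \<le> 3 * \<gamma>"
    and N: "iter_N3 M C2 \<epsilon>1 + K \<le> N"
begin

text \<open>The extra factor \<gamma>^K pays for sqrt |S|; the distance from the maximiser to the
  optimal policy is the dual part.\<close>

lemma policy_error:
  assumes "dual_fun M l - dual_opt M \<le> \<epsilon>"
  shows "norm (policy_vec (npg_sub M l \<pi> \<eta> N) - policy_vec \<pi>star) \<le> const_C1 M d * sqrt \<epsilon> + \<epsilon>1"
proof -
  let ?\<pi>' = "npg_sub M l \<pi> \<eta> N" and ?n = "sqrt (real CARD('n))"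
  have pos: "0 < scale" "0 < \<tau>" "0 < 1 - \<gamma>" "1 \<le> ?n"
    using scale_ge params by (auto simp: Suc_le_eq)
  have "l1_dist (?\<pi>' s) (opt_policy M l s) \<le> \<gamma> ^ K * \<epsilon>1" for s
  proof -
    have "l1_dist (?\<pi>' s) (opt_policy M l s) \<le> \<gamma> ^ N * (scale / (1 - \<gamma>)) / \<tau>"
      using N K(1) by (intro npg_sub_l1_dist[OF valid \<pi> \<eta> final_gap[OF \<pi> l]]) simp
    also have "\<dots> \<le> \<gamma> ^ K * (\<epsilon>1 * \<tau> * (1 - \<gamma>) / (2 * ?n * scale)) * (scale / (1 - \<gamma>)) / \<tau>"
      using N3_power_le[OF \<epsilon>1 N] pos by (intro divide_right_mono mult_right_mono) auto
    also have "\<dots> = \<gamma> ^ K * \<epsilon>1 * (1 / (2 * ?n))"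
      using pos by (simp add: divide_simps)
    also have "\<dots> \<le> \<gamma> ^ K * \<epsilon>1 * 1"
    proof (rule mult_left_mono)
      show "1 / (2 * ?n) \<le> 1"
        using pos(4) by (subst divide_le_eq_1_pos) linarith+
    qed (use \<epsilon>1 params in simp)
    finally show ?thesis by simp
  qed
  then have "norm (policy_vec ?\<pi>' - policy_vec (opt_policy M l)) \<le> sqrt (real CARD('s)) * (\<gamma> ^ K * \<epsilon>1)"
    by (rule norm_policy_vec_diff_le)
  also have "\<dots> \<le> 1 * \<epsilon>1"
    unfolding mult.assoc[symmetric] using K(2) \<epsilon>1 by (intro mult_right_mono) auto
  finally show ?thesis
    using opt_policy_error[OF l assms]
      norm_triangle_ineq[of "policy_vec ?\<pi>' - policy_vec (opt_policy M l)" "policy_vec (opt_policy M l) - policy_vec \<pi>star"]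
    by simp
qed

text \<open>The difference of values splits into the gap of the returned policy, the dual error, the
  change of the utilities paired with \<open>l\<close>, and the surplus of the optimal policy. The
  dual error and the surplus are at most \<epsilon> each, the pairing is bounded by the sum C2 of
  the side lengths of the box, and the third condition on \<open>K\<close> fits the gap into the
  term with 3 \<gamma>.\<close>

lemma value_error:
  assumes \<epsilon>: "dual_fun M l - dual_opt M \<le> \<epsilon>"
  shows "\<bar>reg_value M (npg_sub M l \<pi> \<eta> N) - reg_value M \<pi>star\<bar>
    \<le> 2 * \<epsilon> + ell_c M * const_C1 M d * C2 * sqrt \<epsilon>
      + (ell_c M * C2 + 3 * \<gamma> / (2 * \<tau> * sqrt (real CARD('n)))) * \<epsilon>1"
proof -
  let ?\<pi>' = "npg_sub M l \<pi> \<eta> N" and ?n = "sqrt (real CARD('n))"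
  define e where "e = ell_c M * (const_C1 M d * sqrt \<epsilon> + \<epsilon>1)"
  have pos: "0 < scale" "0 < \<tau>" "0 < 1 - \<gamma>" "0 < ?n"
    using scale_ge params by auto
  have "dual_fun M l - lagrangian M ?\<pi>' l \<le> \<gamma> ^ N * (scale / (1 - \<gamma>))"
    by (rule dual_fun_gap_le[OF valid]) (rule npg_sub_convergence(2)[OF valid \<pi> \<eta> final_gap[OF \<pi> l]])
  also have "\<dots> \<le> \<gamma> ^ K * (\<epsilon>1 * \<tau> * (1 - \<gamma>) / (2 * ?n * scale)) * (scale / (1 - \<gamma>))"
    using N3_power_le[OF \<epsilon>1 N] pos by (intro mult_right_mono) auto
  also have "\<dots> = \<gamma> ^ K * \<tau>\<^sup>2 * (\<epsilon>1 / (2 * \<tau> * ?n))"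
    using pos by (simp add: divide_simps power2_eq_square)
  also have "\<dots> \<le> 3 * \<gamma> * (\<epsilon>1 / (2 * \<tau> * ?n))"
    using pos \<epsilon>1 by (intro mult_right_mono K(3)) auto
  finally have gap: "dual_fun M l - lagrangian M ?\<pi>' l \<le> 3 * \<gamma> / (2 * \<tau> * ?n) * \<epsilon>1"
    by simp
  have gap_nonneg: "lagrangian M ?\<pi>' l \<le> dual_fun M l"
    using lagrangian_le_dual_fun[OF valid npg_sub_in_softmax[OF valid \<pi> \<eta>]] .
  have dual: "dual_opt M \<le> dual_fun M l"
    using dual_opt_le l by (simp add: mem_multipliers)
  have slack: "lagrangian M \<pi>star l \<le> dual_fun M l"
    by (rule lagrangian_le_dual_fun[OF valid \<pi>star_in])
  have "\<bar>(util M ?\<pi>' - util M \<pi>star) $ i\<bar> \<le> e" for i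
    using util_diff_le_norm[OF valid, of ?\<pi>' i \<pi>star] mult_left_mono[OF policy_error[OF \<epsilon>] ell_c_nonneg[of M]]
    by (simp add: e_def)
  then have "\<bar>l \<bullet> (util M ?\<pi>' - util M \<pi>star)\<bar> \<le> (\<Sum>i\<in>UNIV. radius i * e)"
    unfolding inner_vec_def using l radius_nonneg
    by (intro order_trans[OF sum_abs] sum_mono) (auto simp: abs_mult mem_multipliers intro!: mult_mono)
  also have "\<dots> = C2 * e"
    by (simp add: sum_distrib_right[symmetric] sum_radius)
  finally have cross: "\<bar>l \<bullet> (util M ?\<pi>' - util M \<pi>star)\<bar> \<le> C2 * e" .
  have "reg_value M ?\<pi>' - reg_value M \<pi>star
      = (lagrangian M ?\<pi>' l - dual_fun M l) + (dual_fun M l - dual_opt M)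
        - l \<bullet> (util M ?\<pi>' - util M \<pi>star) - (lagrangian M \<pi>star l - reg_value M \<pi>star)"
    by (simp add: lagrangian_def strong_duality inner_diff_right)
  then have "\<bar>reg_value M ?\<pi>' - reg_value M \<pi>star\<bar> \<le> 2 * \<epsilon> + C2 * e + 3 * \<gamma> / (2 * \<tau> * ?n) * \<epsilon>1"
    using gap gap_nonneg dual slack \<epsilon> cross reg_value_le_lagrangian[OF l] strong_duality by linarith
  also have "\<dots> = 2 * \<epsilon> + ell_c M * const_C1 M d * C2 * sqrt \<epsilon>
      + (ell_c M * C2 + 3 * \<gamma> / (2 * \<tau> * ?n)) * \<epsilon>1"
    by (simp add: e_def distrib_left distrib_right mult_ac)
  finally show ?thesis .
qed

end

end

text \<open>For \<gamma> = 0 the second bound is 0, met by K = 1 since \<gamma>^1 = 0. Otherwise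
  both bounds are positive thresholds for a power of \<gamma>.\<close>

lemma exists_extra_iterations:
  "\<exists>K>0. sqrt (real CARD('s)) * \<gamma> ^ K \<le> 1 \<and> \<gamma> ^ K * \<tau>\<^sup>2 \<le> 3 * \<gamma>"
proof (cases "\<gamma> = 0")
  case True
  then show ?thesis by (intro exI[of _ 1]) simp
next
  case False
  define c where "c = min (1 / sqrt (real CARD('s))) (3 * \<gamma> / \<tau>\<^sup>2)"
  have pos: "0 < sqrt (real CARD('s))" "0 < \<tau>\<^sup>2" "0 < \<gamma>"
    using params False by auto
  then have "0 < c"
    by (simp add: c_def)
  then obtain K where "\<gamma> ^ K < c"
    using real_arch_pow_inv params by blast
  moreover have "\<gamma> ^ Suc K \<le> \<gamma> ^ K"
    using params by (intro power_decreasing) auto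
  ultimately have "\<gamma> ^ Suc K \<le> 1 / sqrt (real CARD('s))" "\<gamma> ^ Suc K \<le> 3 * \<gamma> / \<tau>\<^sup>2"
    by (auto simp: c_def)
  then show ?thesis
    using pos by (intro exI[of _ "Suc K"]) (simp add: le_divide_eq mult.commute del: power_Suc)
qed

lemma apgm_eq:
  assumes "\<eta> = (1 - \<gamma>) / \<tau>" "l0 \<in> multipliers" "\<pi>0 \<in> softmax_policies" "0 < T"
  shows "apgm M multipliers l0 l0 \<pi>0 (\<lambda>k. 1 / ell M d) (\<lambda>k. (real k - 1) / (real k + 2)) \<eta>
      T (iter_N2 M d C2 T) N = (npg_sub M (lam \<eta> l0 \<pi>0 T T) (pol \<eta> l0 \<pi>0 T T) \<eta> N, lam \<eta> l0 \<pi>0 T T)"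
  unfolding apgm_def lam_def[OF assms] pol_def[OF assms] by (simp add: case_prod_beta Let_def)

end

section \<open>Growth rates of the iteration numbers and of the error bounds\<close>

lemma real_nat_ceiling_le: "real (nat \<lceil>x\<rceil>) \<le> \<bar>x\<bar> + 1"
  by linarith

lemma bigo_cmult: "f \<in> O[F](g) \<Longrightarrow> (\<lambda>x. c * f x) \<in> O[F](g)" for c :: real
  by (cases "c = 0") simp_all

text \<open>For T \<ge> 2, constants are absorbed through ln T \<ge> ln 2, and T + 1 \<le> T^2
  bounds the second logarithm.\<close>

lemma nat_ceiling_ln_bigo:
  fixes c k :: real
  assumes "0 < k"
  shows "(\<lambda>T. real (nat \<lceil>c * ln (k * (real T * (real T + 1)))\<rceil>)) \<in> O(\<lambda>T. ln (real T))"
proof (rule bigoI)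
  define B where "B = \<bar>c\<bar> * (\<bar>ln k\<bar> / ln 2 + 3) + 1 / ln 2"
  show "\<forall>\<^sub>F T in sequentially. norm (real (nat \<lceil>c * ln (k * (real T * (real T + 1)))\<rceil>)) \<le> B * norm (ln (real T))"
    using eventually_ge_at_top[of 2]
  proof eventually_elim
    case (elim T)
    then have ln2: "0 < ln (2::real)" "ln 2 \<le> ln (real T)"
      by auto
    then have one: "1 \<le> ln (real T) / ln 2"
      by simp
    have "2 * real T \<le> real T * real T"
      using elim by (intro mult_right_mono) auto
    then have "real T + 1 \<le> real T * real T"
      using elim by linarith
    then have "ln (real T + 1) \<le> ln (real T * real T)"
      using elim by (subst ln_le_cancel_iff) auto
    then have ln_Suc: "0 \<le> ln (real T + 1)" "ln (real T + 1) \<le> 2 * ln (real T)"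
      using elim by (auto simp: ln_mult)
    have "ln (k * (real T * (real T + 1))) = ln k + (ln (real T) + ln (real T + 1))"
      using assms elim by (simp add: ln_mult)
    then have "\<bar>ln (k * (real T * (real T + 1)))\<bar> \<le> \<bar>ln k\<bar> * 1 + 3 * ln (real T)"
      using ln2 ln_Suc by linarith
    also have "\<dots> \<le> \<bar>ln k\<bar> * (ln (real T) / ln 2) + 3 * ln (real T)"
      using one by (intro add_mono mult_left_mono) auto
    also have "\<dots> = (\<bar>ln k\<bar> / ln 2 + 3) * ln (real T)"
      by (simp add: distrib_right)
    finally have "\<bar>c\<bar> * \<bar>ln (k * (real T * (real T + 1)))\<bar> \<le> \<bar>c\<bar> * ((\<bar>ln k\<bar> / ln 2 + 3) * ln (real T))"
      by (rule mult_left_mono) simp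
    then have "real (nat \<lceil>c * ln (k * (real T * (real T + 1)))\<rceil>) \<le> \<bar>c\<bar> * ((\<bar>ln k\<bar> / ln 2 + 3) * ln (real T)) + ln (real T) / ln 2"
      using real_nat_ceiling_le[of "c * ln (k * (real T * (real T + 1)))"] one by (simp only: abs_mult)
    also have "\<dots> = B * ln (real T)"
      by (simp add: B_def distrib_right)
    finally show ?case
      using abs_of_nonneg[of "ln (real T)"] ln2 unfolding real_norm_def by linarith
  qed
qed

context slater_cmdp
begin

lemma iter_N2_bigo: "(\<lambda>T. real (iter_N2 M d C2 T)) \<in> O(\<lambda>T. ln (real T))"
proof -
  define k where "k = 2 * sqrt (real CARD('n)) * real CARD('a) * scale / ((1 - \<gamma>) ^ 3 * \<tau> * ell M d)"
  have "0 < k"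
    unfolding k_def using scale_ge params ell_pos[OF valid exploration]
    by (intro divide_pos_pos mult_pos_pos) auto
  from nat_ceiling_ln_bigo[OF this, of "1 / (1 - \<gamma>)"] show ?thesis
    by (simp add: iter_N2_def k_def scale_def mult_ac)
qed

text \<open>Explicit and uniform in the accuracy, so that it serves both for accuracy tending to 0
  and for accuracy depending on T.\<close>

lemma iter_N3_le:
  "\<exists>B\<ge>0. \<forall>\<epsilon>1>0. real (iter_N3 M C2 \<epsilon>1) \<le> B + \<bar>ln (1 / \<epsilon>1)\<bar> / (1 - \<gamma>)"
proof (intro exI conjI allI impI)
  define k where "k = 2 * sqrt (real CARD('n)) * scale / (\<tau> * (1 - \<gamma>))"
  have k: "0 < k"
    unfolding k_def using scale_ge params by (intro divide_pos_pos mult_pos_pos) auto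
  show "0 \<le> \<bar>ln k\<bar> / (1 - \<gamma>) + 1"
    using params by simp
  fix \<epsilon>1 :: real
  assume \<epsilon>1: "0 < \<epsilon>1"
  have "iter_N3 M C2 \<epsilon>1 = nat \<lceil>1 / (1 - \<gamma>) * ln (k * (1 / \<epsilon>1))\<rceil>"
    by (simp add: iter_N3_def k_def scale_def mult_ac)
  also have "ln (k * (1 / \<epsilon>1)) = ln k + ln (1 / \<epsilon>1)"
    using k \<epsilon>1 by (simp only: ln_mult_pos zero_less_divide_1_iff)
  finally have N3: "iter_N3 M C2 \<epsilon>1 = nat \<lceil>1 / (1 - \<gamma>) * (ln k + ln (1 / \<epsilon>1))\<rceil>" .
  have "real (iter_N3 M C2 \<epsilon>1) \<le> \<bar>1 / (1 - \<gamma>) * (ln k + ln (1 / \<epsilon>1))\<bar> + 1"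
    unfolding N3 by (rule real_nat_ceiling_le)
  also have "\<dots> \<le> 1 / (1 - \<gamma>) * (\<bar>ln k\<bar> + \<bar>ln (1 / \<epsilon>1)\<bar>) + 1"
    unfolding abs_mult using params by (intro add_right_mono mult_mono abs_triangle_ineq) auto
  finally show "real (iter_N3 M C2 \<epsilon>1) \<le> \<bar>ln k\<bar> / (1 - \<gamma>) + 1 + \<bar>ln (1 / \<epsilon>1)\<bar> / (1 - \<gamma>)"
    by (simp add: add_divide_distrib)
qed

lemma iter_N3_bigo: "(\<lambda>\<epsilon>1. real (iter_N3 M C2 \<epsilon>1 + K)) \<in> O[at_right 0](\<lambda>\<epsilon>1. ln (1 / \<epsilon>1))"
proof -
  obtain B where B: "0 \<le> B" "\<And>\<epsilon>1. 0 < \<epsilon>1 \<Longrightarrow> real (iter_N3 M C2 \<epsilon>1) \<le> B + \<bar>ln (1 / \<epsilon>1)\<bar> / (1 - \<gamma>)"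
    using iter_N3_le by blast
  show ?thesis
  proof (rule bigoI)
    show "\<forall>\<^sub>F \<epsilon>1 in at_right 0. norm (real (iter_N3 M C2 \<epsilon>1 + K))
        \<le> (B + real K + 1 / (1 - \<gamma>)) * norm (ln (1 / \<epsilon>1))"
      using eventually_at_right_less[of "0::real"] eventually_at_right_real[of 0 "exp (- 1)", simplified]
    proof eventually_elim
      case (elim \<epsilon>1)
      have "ln \<epsilon>1 \<le> - 1"
        using elim by (metis greaterThanLessThan_iff less_imp_le ln_exp ln_le_cancel_iff exp_gt_zero)
      then have big: "1 \<le> ln (1 / \<epsilon>1)"
        using elim by (simp add: ln_div)
      have "real (iter_N3 M C2 \<epsilon>1 + K) \<le> (B + real K) * 1 + \<bar>ln (1 / \<epsilon>1)\<bar> / (1 - \<gamma>)"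
        using B(2)[of \<epsilon>1] elim by simp
      also have "\<dots> \<le> (B + real K) * \<bar>ln (1 / \<epsilon>1)\<bar> + \<bar>ln (1 / \<epsilon>1)\<bar> / (1 - \<gamma>)"
        using big B(1) by (intro add_right_mono mult_left_mono) auto
      finally show ?case
        by (simp add: distrib_right)
    qed
  qed
qed

text \<open>The accuracy may vary with T as long as its logarithm is of order ln T; a single
  logarithmic factor then suffices.\<close>

lemma total_iterations_soft_O:
  assumes e: "\<And>T. 0 < e T" and ln_e: "(\<lambda>T. ln (1 / e T)) \<in> O(\<lambda>T. ln (real T))"
  shows "(\<lambda>T. real (T * iter_N2 M d C2 T + (iter_N3 M C2 (e T) + K))) \<in> soft_O real"
proof -
  obtain B where B: "0 \<le> B" "\<And>\<epsilon>1. 0 < \<epsilon>1 \<Longrightarrow> real (iter_N3 M C2 \<epsilon>1) \<le> B + \<bar>ln (1 / \<epsilon>1)\<bar> / (1 - \<gamma>)"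
    using iter_N3_le by blast
  have "(\<lambda>T. real T * real (iter_N2 M d C2 T)) \<in> O(\<lambda>T. real T * ln (real T))"
    by (intro landau_o.big.mult_left iter_N2_bigo)
  moreover have "(\<lambda>T. real (iter_N3 M C2 (e T) + K)) \<in> O(\<lambda>T. real T * ln (real T))"
  proof -
    have "(\<lambda>T. real (iter_N3 M C2 (e T) + K)) \<in> O(\<lambda>T. B + real K + \<bar>ln (1 / e T)\<bar> / (1 - \<gamma>))"
    proof (intro bigoI always_eventually allI)
      fix T
      have "0 \<le> \<bar>ln (1 / e T)\<bar> / (1 - \<gamma>)"
        using params by simp
      then show "norm (real (iter_N3 M C2 (e T) + K)) \<le> 1 * norm (B + real K + \<bar>ln (1 / e T)\<bar> / (1 - \<gamma>))"
        using B(1) B(2)[OF e, of T] by simp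
    qed
    also have "(\<lambda>T. B + real K + \<bar>ln (1 / e T)\<bar> / (1 - \<gamma>)) \<in> O(\<lambda>T. ln (real T))"
    proof (rule sum_in_bigo)
      show "(\<lambda>T. B + real K) \<in> O(\<lambda>T. ln (real T))"
        by real_asymp
      show "(\<lambda>T. \<bar>ln (1 / e T)\<bar> / (1 - \<gamma>)) \<in> O(\<lambda>T. ln (real T))"
        using ln_e params by simp
    qed
    also have "(\<lambda>T. ln (real T)) \<in> O(\<lambda>T. real T * ln (real T))"
      by real_asymp
    finally show ?thesis .
  qed
  ultimately have "(\<lambda>T. real (T * iter_N2 M d C2 T + (iter_N3 M C2 (e T) + K))) \<in> O(\<lambda>T. real T * ln (real T))"
    using sum_in_bigo(1) by fastforce
  then show ?thesis
    unfolding soft_O_def by (intro CollectI exI[of _ 1]) simp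
qed

lemma eps0_bigo: "(\<lambda>T. eps0 M d T l0 lstar) \<in> O(\<lambda>T. 1 / (real T)\<^sup>2)"
proof -
  have "eps0 M d T l0 lstar = 2 * ell M d * (norm (l0 - lstar) + 1)\<^sup>2 * (1 / (real T + 1)\<^sup>2)" for T
    by (simp add: eps0_def)
  moreover have "(\<lambda>T. 1 / (real T + 1)\<^sup>2) \<in> O(\<lambda>T. 1 / (real T)\<^sup>2)"
    by real_asymp
  ultimately show ?thesis
    by (simp only: bigo_cmult)
qed

lemma sqrt_eps0_bigo: "(\<lambda>T. sqrt (eps0 M d T l0 lstar)) \<in> O(\<lambda>T. 1 / real T)"
proof -
  have "sqrt (eps0 M d T l0 lstar) = sqrt (2 * ell M d) * (norm (l0 - lstar) + 1) * (1 / (real T + 1))" for T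
    by (simp add: eps0_def real_sqrt_mult real_sqrt_divide abs_of_nonneg)
  moreover have "(\<lambda>T. 1 / (real T + 1)) \<in> O(\<lambda>T. 1 / real T)"
    by real_asymp
  ultimately show ?thesis
    by (simp only: bigo_cmult)
qed

end

text \<open>\<open>K\<close> is fixed before accuracy, horizon and initialisation, so adding it
  leaves N_3 of order ln (1 / \<epsilon>1). Positivity of C2 is tied to a strict inequality because
  C2 = 0 when the Slater policy attains the optimal value.\<close>

theorem theorem5p2:
  fixes M :: "('s::finite, 'a::finite, 'n::finite) cmdp"
    and \<pi>bar \<pi>star :: "('s, 'a) policy"
    and \<xi> lstar :: "real ^ 'n"
    and d C1 C2 \<eta> :: real
    and \<Lambda> :: "(real ^ 'n) set"
  assumes valid: "valid_cmdp M"
    and slater: "\<pi>bar \<in> softmax_policies"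
      "\<forall>i. 0 < \<xi> $ i"
      "\<forall>i. \<xi> $ i \<le> util M \<pi>bar $ i - threshold M $ i"
    and primal_optimal: "is_arg_max (reg_value M) (feasible M) \<pi>star"
    and dual_optimal: "is_arg_min (dual_fun M) (\<lambda>l. \<forall>i. 0 \<le> l $ i) lstar"
    and strong_duality: "reg_value M \<pi>star = dual_opt M"
      "dual_opt M = lagrangian M \<pi>star lstar"
    and exploration: "0 < d" "\<forall>\<pi>\<in>softmax_policies. \<forall>s. d \<le> visitation M \<pi> s"
    and C1: "C1 = const_C1 M d"
    and C2: "C2 = const_C2 M \<pi>star \<pi>bar \<xi>"
    and \<Lambda>: "\<Lambda> = dual_box M \<pi>star \<pi>bar \<xi>"
    and \<eta>: "\<eta> = (1 - discount M) / temperature M"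
  shows "0 < C1 \<and> (reg_value M \<pi>bar < reg_value M \<pi>star \<longrightarrow> 0 < C2) \<and>
    (\<exists>K::nat.
      (\<forall>\<epsilon>1>0. \<forall>T\<ge>1. \<forall>l0\<in>\<Lambda>. \<forall>\<pi>0\<in>softmax_policies. \<forall>N3\<ge>iter_N3 M C2 \<epsilon>1. \<forall>\<pi> l \<epsilon>0.
         (\<pi>, l) = apgm M \<Lambda> l0 l0 \<pi>0 (\<lambda>k. 1 / ell M d) (\<lambda>k. (real k - 1) / (real k + 2)) \<eta>
                    T (iter_N2 M d C2 T) N3 \<longrightarrow>
         \<epsilon>0 = eps0 M d T l0 lstar \<longrightarrow>
           dual_fun M l - dual_opt M \<le> \<epsilon>0 \<and>
           (MAX i. max 0 (threshold M $ i - util M \<pi> $ i)) \<le> ell_c M * (C1 * sqrt \<epsilon>0 + \<epsilon>1) \<and>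
           (iter_N3 M C2 \<epsilon>1 + K \<le> N3 \<longrightarrow>
              norm (policy_vec \<pi> - policy_vec \<pi>star) \<le> C1 * sqrt \<epsilon>0 + \<epsilon>1 \<and>
              \<bar>reg_value M \<pi> - reg_value M \<pi>star\<bar>
                \<le> 2 * \<epsilon>0 + ell_c M * C1 * C2 * sqrt \<epsilon>0
                  + (ell_c M * C2 + 3 * discount M / (2 * temperature M * sqrt (real CARD('n)))) * \<epsilon>1)) \<and>
      (\<lambda>T. real (iter_N2 M d C2 T)) \<in> O(\<lambda>T. ln (real T)) \<and>
      (\<lambda>\<epsilon>1. real (iter_N3 M C2 \<epsilon>1 + K)) \<in> O[at_right 0](\<lambda>\<epsilon>1. ln (1 / \<epsilon>1)) \<and>
      (\<forall>e. (\<forall>T. 0 < e T) \<longrightarrow> (\<lambda>T. ln (1 / e T)) \<in> O(\<lambda>T. ln (real T)) \<longrightarrow>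
         (\<lambda>T. real (T * iter_N2 M d C2 T + (iter_N3 M C2 (e T) + K))) \<in> soft_O real)) \<and>
    (\<forall>l0\<in>\<Lambda>.
      (\<lambda>T. eps0 M d T l0 lstar) \<in> O(\<lambda>T. 1 / (real T)\<^sup>2) \<and>
      (\<forall>e. (\<forall>T. 0 < e T) \<longrightarrow> e \<in> O(\<lambda>T. 1 / real T) \<longrightarrow>
         (\<lambda>T. C1 * sqrt (eps0 M d T l0 lstar) + e T) \<in> O(\<lambda>T. 1 / real T) \<and>
         (\<lambda>T. 2 * eps0 M d T l0 lstar + ell_c M * C1 * C2 * sqrt (eps0 M d T l0 lstar)
               + (ell_c M * C2 + 3 * discount M / (2 * temperature M * sqrt (real CARD('n)))) * e T)
           \<in> O(\<lambda>T. 1 / real T) \<and>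
         (\<lambda>T. ell_c M * (C1 * sqrt (eps0 M d T l0 lstar) + e T)) \<in> O(\<lambda>T. 1 / real T)))"
proof (intro conjI)
  interpret slater_cmdp M \<pi>bar \<pi>star \<xi> lstar d
    by unfold_locales (use assms in auto)
  show "0 < C1"
    using C1_pos by (simp add: C1)
  show "reg_value M \<pi>bar < reg_value M \<pi>star \<longrightarrow> 0 < C2"
    using slater(2) by (auto simp: C2 const_C2_def intro!: mult_pos_pos sum_pos)
  obtain K where K: "0 < K" "sqrt (real CARD('s)) * discount M ^ K \<le> 1"
    "discount M ^ K * (temperature M)\<^sup>2 \<le> 3 * discount M"
    using exists_extra_iterations by blast
  have bounds: "dual_fun M l - dual_opt M \<le> \<epsilon>0 \<and>
       (MAX i. max 0 (threshold M $ i - util M \<pi> $ i)) \<le> ell_c M * (C1 * sqrt \<epsilon>0 + \<epsilon>1) \<and>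
       (iter_N3 M C2 \<epsilon>1 + K \<le> N3 \<longrightarrow>
          norm (policy_vec \<pi> - policy_vec \<pi>star) \<le> C1 * sqrt \<epsilon>0 + \<epsilon>1 \<and>
          \<bar>reg_value M \<pi> - reg_value M \<pi>star\<bar>
            \<le> 2 * \<epsilon>0 + ell_c M * C1 * C2 * sqrt \<epsilon>0
              + (ell_c M * C2 + 3 * discount M / (2 * temperature M * sqrt (real CARD('n)))) * \<epsilon>1)"
    if \<epsilon>1: "0 < \<epsilon>1" and "1 \<le> T" and l0: "l0 \<in> \<Lambda>" and \<pi>0: "\<pi>0 \<in> softmax_policies"
      and N3: "iter_N3 M C2 \<epsilon>1 \<le> N3"
      and result: "(\<pi>, l) = apgm M \<Lambda> l0 l0 \<pi>0 (\<lambda>k. 1 / ell M d) (\<lambda>k. (real k - 1) / (real k + 2)) \<eta>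
                    T (iter_N2 M d C2 T) N3"
      and \<epsilon>0: "\<epsilon>0 = eps0 M d T l0 lstar"
    for \<epsilon>1 T l0 \<pi>0 N3 \<pi> l \<epsilon>0
  proof -
    have T: "0 < T" using \<open>1 \<le> T\<close> by simp
    note input = \<eta> l0[unfolded \<Lambda>] \<pi>0 T
    let ?\<pi> = "pol \<eta> l0 \<pi>0 T T"
    have out: "\<pi> = npg_sub M l ?\<pi> \<eta> N3" "l = lam \<eta> l0 \<pi>0 T T"
      using result apgm_eq[OF input, of N3] by (simp_all add: \<Lambda> C2)
    have l: "l \<in> dual_box M \<pi>star \<pi>bar \<xi>" and \<pi>T: "?\<pi> \<in> softmax_policies"
      and dual: "dual_fun M l - dual_opt M \<le> \<epsilon>0"
      using lam_in_multipliers[OF input] pol_in[OF input] dual_error[OF input] by (simp_all add: out(2) \<epsilon>0)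
    show ?thesis
      using dual constraint_violation[OF \<eta> l \<pi>T \<epsilon>1 N3[unfolded C2] dual]
        policy_error[OF \<eta> l \<pi>T \<epsilon>1 K _ dual] value_error[OF \<eta> l \<pi>T \<epsilon>1 K _ dual]
      by (simp add: out(1) C1 C2)
  qed
  show "\<exists>K::nat.
      (\<forall>\<epsilon>1>0. \<forall>T\<ge>1. \<forall>l0\<in>\<Lambda>. \<forall>\<pi>0\<in>softmax_policies. \<forall>N3\<ge>iter_N3 M C2 \<epsilon>1. \<forall>\<pi> l \<epsilon>0.
         (\<pi>, l) = apgm M \<Lambda> l0 l0 \<pi>0 (\<lambda>k. 1 / ell M d) (\<lambda>k. (real k - 1) / (real k + 2)) \<eta>
                    T (iter_N2 M d C2 T) N3 \<longrightarrow>
         \<epsilon>0 = eps0 M d T l0 lstar \<longrightarrow>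
           dual_fun M l - dual_opt M \<le> \<epsilon>0 \<and>
           (MAX i. max 0 (threshold M $ i - util M \<pi> $ i)) \<le> ell_c M * (C1 * sqrt \<epsilon>0 + \<epsilon>1) \<and>
           (iter_N3 M C2 \<epsilon>1 + K \<le> N3 \<longrightarrow>
              norm (policy_vec \<pi> - policy_vec \<pi>star) \<le> C1 * sqrt \<epsilon>0 + \<epsilon>1 \<and>
              \<bar>reg_value M \<pi> - reg_value M \<pi>star\<bar>
                \<le> 2 * \<epsilon>0 + ell_c M * C1 * C2 * sqrt \<epsilon>0
                  + (ell_c M * C2 + 3 * discount M / (2 * temperature M * sqrt (real CARD('n)))) * \<epsilon>1)) \<and>
      (\<lambda>T. real (iter_N2 M d C2 T)) \<in> O(\<lambda>T. ln (real T)) \<and>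
      (\<lambda>\<epsilon>1. real (iter_N3 M C2 \<epsilon>1 + K)) \<in> O[at_right 0](\<lambda>\<epsilon>1. ln (1 / \<epsilon>1)) \<and>
      (\<forall>e. (\<forall>T. 0 < e T) \<longrightarrow> (\<lambda>T. ln (1 / e T)) \<in> O(\<lambda>T. ln (real T)) \<longrightarrow>
         (\<lambda>T. real (T * iter_N2 M d C2 T + (iter_N3 M C2 (e T) + K))) \<in> soft_O real)"
    using iter_N2_bigo iter_N3_bigo total_iterations_soft_O
    by (intro exI[of _ K] conjI allI ballI impI bounds) (simp_all add: C2)
  show "\<forall>l0\<in>\<Lambda>.
      (\<lambda>T. eps0 M d T l0 lstar) \<in> O(\<lambda>T. 1 / (real T)\<^sup>2) \<and>
      (\<forall>e. (\<forall>T. 0 < e T) \<longrightarrow> e \<in> O(\<lambda>T. 1 / real T) \<longrightarrow>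
         (\<lambda>T. C1 * sqrt (eps0 M d T l0 lstar) + e T) \<in> O(\<lambda>T. 1 / real T) \<and>
         (\<lambda>T. 2 * eps0 M d T l0 lstar + ell_c M * C1 * C2 * sqrt (eps0 M d T l0 lstar)
               + (ell_c M * C2 + 3 * discount M / (2 * temperature M * sqrt (real CARD('n)))) * e T)
           \<in> O(\<lambda>T. 1 / real T) \<and>
         (\<lambda>T. ell_c M * (C1 * sqrt (eps0 M d T l0 lstar) + e T)) \<in> O(\<lambda>T. 1 / real T))"
  proof (intro ballI conjI allI impI)
    fix l0 :: "real ^ 'n" and e :: "nat \<Rightarrow> real"
    show eps0: "(\<lambda>T. eps0 M d T l0 lstar) \<in> O(\<lambda>T. 1 / (real T)\<^sup>2)"
      by (rule eps0_bigo)
    have "(\<lambda>T. 1 / (real T)\<^sup>2) \<in> O(\<lambda>T. 1 / real T)"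
      by real_asymp
    with eps0 have eps0': "(\<lambda>T. eps0 M d T l0 lstar) \<in> O(\<lambda>T. 1 / real T)"
      by (rule landau_o.big_trans)
    assume e: "e \<in> O(\<lambda>T. 1 / real T)"
    show policy: "(\<lambda>T. C1 * sqrt (eps0 M d T l0 lstar) + e T) \<in> O(\<lambda>T. 1 / real T)"
      by (intro sum_in_bigo bigo_cmult sqrt_eps0_bigo e)
    show "(\<lambda>T. 2 * eps0 M d T l0 lstar + ell_c M * C1 * C2 * sqrt (eps0 M d T l0 lstar)
               + (ell_c M * C2 + 3 * discount M / (2 * temperature M * sqrt (real CARD('n)))) * e T)
           \<in> O(\<lambda>T. 1 / real T)"
      by (intro sum_in_bigo bigo_cmult sqrt_eps0_bigo eps0' e)
    show "(\<lambda>T. ell_c M * (C1 * sqrt (eps0 M d T l0 lstar) + e T)) \<in> O(\<lambda>T. 1 / real T)"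
      by (rule bigo_cmult[OF policy])
  qed
qed

end
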